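(* Let $(\mathcal{A};\mathcal{E})$ be a Frobenius category with stable category $\underline{\mathcal{A}}$ and stable quotient functor $\pi\colon\mathcal{A}\to\underline{\mathcal{A}}$. An ideal cotorsion pair $(\mathcal{I},\mathcal{J})$ in $(\mathcal{A};\mathcal{E})$ is complete if and only if the corresponding ideal torsion pair $(\pi(\mathcal{I}),\pi(\Sigma(\mathcal{J})))$ in $\underline{\mathcal{A}}$ is complete.
   Context: An ideal of an additive category is an additive subbifunctor of $\mathrm{Hom}$. A Frobenius category is a (Quillen) exact category $(\mathcal{A};\mathcal{E})$ with enough projective objects, enough injective objects, and in which the projective objects coincide with the injective objects. Its stable category $\underline{\mathcal{A}}$ has the same objects (written $\pi(A)$), and $\underline{\mathrm{Hom}}(\pi(A),\pi(B))=\mathrm{Hom}(A,B)/\mathrm{Proj}(A,B)$, where $\mathrm{Proj}(A,B)$ is the subgroup of morphisms factoring through a projective object; $\pi$ is the quotient functor. $\underline{\mathcal{A}}$ is triangulated in the usual way (Happel), with shift $\Sigma$ given by cosyzygies (conflations $A\to E\to\Sigma(A)$ with $E$ injective) and inverse $\Omega$ given by syzygies. Ext-side. $\mathrm{Ext}(A,B)$ is the group of equivalence classes of conflations $B\to C\to A$. For $f\colon X\to A$ and $g\colon B\to Y$, $\mathrm{Ext}(f,g)\colon\mathrm{Ext}(A,B)\to\mathrm{Ext}(X,Y)$ is the induced map (pullback along $f$, pushout along $g$). For an ideal $\mathcal{I}$, $\mathcal{I}^{\perp_1}=\{g\mid\mathrm{Ext}(i,g)=0\ \forall i\in\mathcal{I}\}$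 and ${}^{\perp_1}\mathcal{J}=\{f\mid\mathrm{Ext}(f,j)=0\ \forall j\in\mathcal{J}\}$. $(\mathcal{I},\mathcal{J})$ is an ideal cotorsion pair if $\mathcal{I}={}^{\perp_1}\mathcal{J}$ and $\mathcal{J}=\mathcal{I}^{\perp_1}$. An Ext-special $\mathcal{I}$-precover of $X$ is a morphism $i\colon T\to X$ in $\mathcal{I}$ that is the deflation of a conflation $F\to T\xrightarrow{i}X$ for which there are a conflation $\Omega(X)\to P\to X$ with $P$ projective and a morphism of conflations $(g,\ast,1_X)$ from $\Omega(X)\to P\to X$ to $F\to T\to X$ with $g\in\mathcal{I}^{\perp_1}$. Ext-special $\mathcal{J}$-preenvelopes are defined dually. The ideal cotorsion pair is complete if every object has an Ext-special $\mathcal{I}$-precover and an Ext-special $\mathcal{J}$-preenvelope. Hom-side. In $\underline{\mathcal{A}}$, for a collection $\mathcal{M}$ of morphisms, $\mathcal{M}^{\perp}$ is the ideal of all $j$ with $jxf=0$ for all $f\in\mathcal{M}$ and all $x$ from the codomain of $f$ to the domain of $j$; ${}^{\perp}\mathcal{M}$ is defined dually; a pair $(\mathcal{I}',\mathcal{J}')$ of ideals of $\underline{\mathcal{A}}$ is an ideal torsion pair if $\mathcal{I}'={}^{\perp}\mathcal{J}'$ and $\mathcal{J}'=\mathcal{I}'^{\perp}$. It is complete if every object $X$ has an $\mathcal{I}'$-precover $i\colon T\to X$ (a morphism in $\mathcal{I}'$ through which every morphism of $\mathcal{I}'$ with codomain $X$ factors) that is Hom-special, i.e. part of a weak conflation $T\xrightarrow{i}X\to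 F$; here weak conflations in $\underline{\mathcal{A}}$ are the sequences $A\to B\to C$ that extend to a distinguished triangle $A\to B\to C\to\Sigma A$ (equivalently, every object has a Hom-special $\mathcal{J}'$-preenvelope, defined dually). The correspondence: $(\mathcal{I},\mathcal{J})\mapsto(\pi(\mathcal{I}),\pi(\Sigma(\mathcal{J})))$ is a bijection between ideal cotorsion pairs in $(\mathcal{A};\mathcal{E})$ and ideal torsion pairs in $\underline{\mathcal{A}}$, where $\pi(\mathcal{I})=\{\pi(i)\mid i\in\mathcal{I}\}$ and $\pi(\Sigma(\mathcal{J}))$ is the ideal of $\underline{\mathcal{A}}$ consisting of the morphisms $\Sigma(\pi(j))$, $j\in\mathcal{J}$ (up to isomorphism of morphisms; equivalently all $h$ with $\Omega(h)\in\pi(\mathcal{J})$). *)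

theory Defs
  imports "HOL-Algebra.Coset"
begin

section \<open>Additive categories\<close>

text \<open>
  Arrows carry their source and target, so a collection of morphisms is a plain set of arrows.
  \<open>Cmp C g f\<close>, written \<open>g \<cdot> f\<close>, is ``\<open>g\<close> after \<open>f\<close>''. All operations are only meaningful on
  the arrows (objects) of \<open>C\<close>.
\<close>

record ('o, 'm) addcat =
  Obj :: "'o set"
  Arr :: "'m set"
  Src :: "'m \<Rightarrow> 'o"
  Trg :: "'m \<Rightarrow> 'o"
  Ide :: "'o \<Rightarrow> 'm"
  Cmp :: "'m \<Rightarrow> 'm \<Rightarrow> 'm"  (infixl \<open>\<cdot>\<index>\<close> 70)
  Add :: "'m \<Rightarrow> 'm \<Rightarrow> 'm"
  Zer :: "'o \<Rightarrow> 'o \<Rightarrow> 'm"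

definition Hom :: "('o, 'm) addcat \<Rightarrow> 'o \<Rightarrow> 'o \<Rightarrow> 'm set" where
  "Hom C A B = {f \<in> Arr C. Src C f = A \<and> Trg C f = B}"

definition hom_group :: "('o, 'm) addcat \<Rightarrow> 'o \<Rightarrow> 'o \<Rightarrow> 'm monoid" where
  "hom_group C A B = \<lparr>carrier = Hom C A B, mult = Add C, one = Zer C A B\<rparr>"

definition is_iso :: "('o, 'm) addcat \<Rightarrow> 'm \<Rightarrow> bool" where
  "is_iso C f \<longleftrightarrow> f \<in> Arr C \<and>
     (\<exists>g \<in> Hom C (Trg C f) (Src C f).
        g \<cdot>\<^bsub>C\<^esub> f = Ide C (Src C f) \<and> f \<cdot>\<^bsub>C\<^esub> g = Ide C (Trg C f))"

definition zero_object :: "('o, 'm) addcat \<Rightarrow> 'o \<Rightarrow> bool" where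
  "zero_object C Z \<longleftrightarrow> Z \<in> Obj C \<and>
     (\<forall>A \<in> Obj C. (\<exists>!f. f \<in> Hom C Z A) \<and> (\<exists>!f. f \<in> Hom C A Z))"

definition biproduct ::
  "('o, 'm) addcat \<Rightarrow> 'o \<Rightarrow> 'o \<Rightarrow> 'o \<Rightarrow> 'm \<Rightarrow> 'm \<Rightarrow> 'm \<Rightarrow> 'm \<Rightarrow> bool" where
  "biproduct C A B S i1 i2 p1 p2 \<longleftrightarrow>
     i1 \<in> Hom C A S \<and> i2 \<in> Hom C B S \<and> p1 \<in> Hom C S A \<and> p2 \<in> Hom C S B \<and>
     p1 \<cdot>\<^bsub>C\<^esub> i1 = Ide C A \<and> p2 \<cdot>\<^bsub>C\<^esub> i2 = Ide C B \<and>
     p1 \<cdot>\<^bsub>C\<^esub> i2 = Zer C B A \<and> p2 \<cdot>\<^bsub>C\<^esub> i1 = Zer C A B \<and>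
     Add C (i1 \<cdot>\<^bsub>C\<^esub> p1) (i2 \<cdot>\<^bsub>C\<^esub> p2) = Ide C S"

locale additive_category =
  fixes C :: "('o, 'm) addcat" (structure)
  assumes Src_Obj: "f \<in> Arr C \<Longrightarrow> Src C f \<in> Obj C"
    and Trg_Obj: "f \<in> Arr C \<Longrightarrow> Trg C f \<in> Obj C"
    and Ide_Hom: "A \<in> Obj C \<Longrightarrow> Ide C A \<in> Hom C A A"
    and Cmp_Hom: "\<lbrakk>f \<in> Hom C A B; g \<in> Hom C B D\<rbrakk> \<Longrightarrow> g \<cdot> f \<in> Hom C A D"
    and Cmp_Ide: "f \<in> Hom C A B \<Longrightarrow> f \<cdot> Ide C A = f"
    and Ide_Cmp: "f \<in> Hom C A B \<Longrightarrow> Ide C B \<cdot> f = f"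
    and Cmp_assoc:
      "\<lbrakk>f \<in> Hom C A B; g \<in> Hom C B D; h \<in> Hom C D F\<rbrakk> \<Longrightarrow> (h \<cdot> g) \<cdot> f = h \<cdot> (g \<cdot> f)"
    and Hom_comm_group: "\<lbrakk>A \<in> Obj C; B \<in> Obj C\<rbrakk> \<Longrightarrow> comm_group (hom_group C A B)"
    and Cmp_Add: "\<lbrakk>f \<in> Hom C A B; f' \<in> Hom C A B; g \<in> Hom C B D\<rbrakk>
      \<Longrightarrow> g \<cdot> Add C f f' = Add C (g \<cdot> f) (g \<cdot> f')"
    and Add_Cmp: "\<lbrakk>f \<in> Hom C A B; g \<in> Hom C B D; g' \<in> Hom C B D\<rbrakk>
      \<Longrightarrow> Add C g g' \<cdot> f = Add C (g \<cdot> f) (g' \<cdot> f)"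
    and ex_zero_object: "\<exists>Z. zero_object C Z"
    and ex_biproduct: "\<lbrakk>A \<in> Obj C; B \<in> Obj C\<rbrakk>
      \<Longrightarrow> \<exists>S \<in> Obj C. \<exists>i1 i2 p1 p2. biproduct C A B S i1 i2 p1 p2"

definition cat_ideal :: "('o, 'm) addcat \<Rightarrow> 'm set \<Rightarrow> bool" where
  "cat_ideal C I \<longleftrightarrow> I \<subseteq> Arr C \<and>
     (\<forall>A \<in> Obj C. \<forall>B \<in> Obj C. subgroup (I \<inter> Hom C A B) (hom_group C A B)) \<and>
     (\<forall>f \<in> I. \<forall>g \<in> Arr C. Src C g = Trg C f \<longrightarrow> g \<cdot>\<^bsub>C\<^esub> f \<in> I) \<and>
     (\<forall>f \<in> I. \<forall>g \<in> Arr C. Trg C g = Src C f \<longrightarrow> f \<cdot>\<^bsub>C\<^esub> g \<in> I)"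

definition iso_arrows :: "('o, 'm) addcat \<Rightarrow> 'm \<Rightarrow> 'm \<Rightarrow> bool" where
  "iso_arrows C f g \<longleftrightarrow> f \<in> Arr C \<and> g \<in> Arr C \<and>
     (\<exists>a \<in> Hom C (Src C f) (Src C g). \<exists>b \<in> Hom C (Trg C f) (Trg C g).
        is_iso C a \<and> is_iso C b \<and> b \<cdot>\<^bsub>C\<^esub> f = g \<cdot>\<^bsub>C\<^esub> a)"


section \<open>Exact categories\<close>


definition is_kernel :: "('o, 'm) addcat \<Rightarrow> 'm \<Rightarrow> 'm \<Rightarrow> bool" where
  "is_kernel C i p \<longleftrightarrow> i \<in> Arr C \<and> p \<in> Arr C \<and> Trg C i = Src C p \<and>
     p \<cdot>\<^bsub>C\<^esub> i = Zer C (Src C i) (Trg C p) \<and>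
     (\<forall>f \<in> Arr C. Trg C f = Src C p \<and> p \<cdot>\<^bsub>C\<^esub> f = Zer C (Src C f) (Trg C p) \<longrightarrow>
        (\<exists>!u. u \<in> Hom C (Src C f) (Src C i) \<and> i \<cdot>\<^bsub>C\<^esub> u = f))"

definition is_cokernel :: "('o, 'm) addcat \<Rightarrow> 'm \<Rightarrow> 'm \<Rightarrow> bool" where
  "is_cokernel C p i \<longleftrightarrow> i \<in> Arr C \<and> p \<in> Arr C \<and> Trg C i = Src C p \<and>
     p \<cdot>\<^bsub>C\<^esub> i = Zer C (Src C i) (Trg C p) \<and>
     (\<forall>f \<in> Arr C. Src C f = Trg C i \<and> f \<cdot>\<^bsub>C\<^esub> i = Zer C (Src C i) (Trg C f) \<longrightarrow>
        (\<exists>!u. u \<in> Hom C (Trg C p) (Trg C f) \<and> u \<cdot>\<^bsub>C\<^esub> p = f))"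

text \<open>
  \<open>pullback_square C p f f' p'\<close>: the commutative square \<open>p \<cdot> f' = f \<cdot> p'\<close> is a pullback of the
  cospan \<open>(p, f)\<close>. \<open>pushout_square C i f f' i'\<close>: the commutative square \<open>f' \<cdot> i = i' \<cdot> f\<close> is a
  pushout of the span \<open>(i, f)\<close>. In both cases \<open>f'\<close> is parallel to \<open>f\<close> in the square.
\<close>

definition pullback_square ::
  "('o, 'm) addcat \<Rightarrow> 'm \<Rightarrow> 'm \<Rightarrow> 'm \<Rightarrow> 'm \<Rightarrow> bool" where
  "pullback_square C p f f' p' \<longleftrightarrow>
     p \<in> Arr C \<and> f \<in> Arr C \<and> f' \<in> Arr C \<and> p' \<in> Arr C \<and>
     Trg C p = Trg C f \<and> Src C f' = Src C p' \<and> Trg C f' = Src C p \<and> Trg C p' = Src C f \<and>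
     p \<cdot>\<^bsub>C\<^esub> f' = f \<cdot>\<^bsub>C\<^esub> p' \<and>
     (\<forall>x \<in> Arr C. \<forall>y \<in> Arr C.
        Src C x = Src C y \<and> Trg C x = Src C p \<and> Trg C y = Src C f \<and>
        p \<cdot>\<^bsub>C\<^esub> x = f \<cdot>\<^bsub>C\<^esub> y \<longrightarrow>
        (\<exists>!u. u \<in> Hom C (Src C x) (Src C f') \<and> f' \<cdot>\<^bsub>C\<^esub> u = x \<and> p' \<cdot>\<^bsub>C\<^esub> u = y))"

definition pushout_square ::
  "('o, 'm) addcat \<Rightarrow> 'm \<Rightarrow> 'm \<Rightarrow> 'm \<Rightarrow> 'm \<Rightarrow> bool" where
  "pushout_square C i f f' i' \<longleftrightarrow>
     i \<in> Arr C \<and> f \<in> Arr C \<and> f' \<in> Arr C \<and> i' \<in> Arr C \<and>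
     Src C i = Src C f \<and> Trg C f' = Trg C i' \<and> Src C f' = Trg C i \<and> Src C i' = Trg C f \<and>
     f' \<cdot>\<^bsub>C\<^esub> i = i' \<cdot>\<^bsub>C\<^esub> f \<and>
     (\<forall>x \<in> Arr C. \<forall>y \<in> Arr C.
        Trg C x = Trg C y \<and> Src C x = Trg C i \<and> Src C y = Trg C f \<and>
        x \<cdot>\<^bsub>C\<^esub> i = y \<cdot>\<^bsub>C\<^esub> f \<longrightarrow>
        (\<exists>!u. u \<in> Hom C (Trg C f') (Trg C x) \<and> u \<cdot>\<^bsub>C\<^esub> f' = x \<and> u \<cdot>\<^bsub>C\<^esub> i' = y))"

text \<open>The triple \<open>(a, b, c)\<close> is a morphism between the composable pairs \<open>(i, p)\<close> and \<open>(i', p')\<close>.\<close>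

fun seq_morphism ::
  "('o, 'm) addcat \<Rightarrow> 'm \<times> 'm \<Rightarrow> 'm \<times> 'm \<Rightarrow> 'm \<Rightarrow> 'm \<Rightarrow> 'm \<Rightarrow> bool" where
  "seq_morphism C (i, p) (i', p') a b c \<longleftrightarrow>
     a \<in> Hom C (Src C i) (Src C i') \<and> b \<in> Hom C (Trg C i) (Trg C i') \<and>
     c \<in> Hom C (Trg C p) (Trg C p') \<and>
     b \<cdot>\<^bsub>C\<^esub> i = i' \<cdot>\<^bsub>C\<^esub> a \<and> c \<cdot>\<^bsub>C\<^esub> p = p' \<cdot>\<^bsub>C\<^esub> b"

text \<open>
  Quillen's axioms in Buehler's form. A conflation is a pair \<open>(i, p) \<in> E\<close>; its first component is
  an inflation, its second one a deflation.
\<close>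

locale exact_category = additive_category C
  for C :: "('o, 'm) addcat" (structure) and E :: "('m \<times> 'm) set" +
  assumes kernel_cokernel_pair: "(i, p) \<in> E \<Longrightarrow> is_kernel C i p \<and> is_cokernel C p i"
    and iso_closed:
      "\<lbrakk>(i, p) \<in> E; i' \<in> Arr C; p' \<in> Arr C; Trg C i' = Src C p';
        seq_morphism C (i, p) (i', p') a b c; is_iso C a; is_iso C b; is_iso C c\<rbrakk>
       \<Longrightarrow> (i', p') \<in> E"
    and Ide_inflation: "A \<in> Obj C \<Longrightarrow> \<exists>p. (Ide C A, p) \<in> E"
    and Ide_deflation: "A \<in> Obj C \<Longrightarrow> \<exists>i. (i, Ide C A) \<in> E"
    and inflation_Cmp:
      "\<lbrakk>(i, p) \<in> E; (j, q) \<in> E; Trg C i = Src C j\<rbrakk> \<Longrightarrow> \<exists>r. (j \<cdot> i, r) \<in> E"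
    and deflation_Cmp:
      "\<lbrakk>(i, p) \<in> E; (j, q) \<in> E; Trg C p = Src C q\<rbrakk> \<Longrightarrow> \<exists>k. (k, q \<cdot> p) \<in> E"
    and inflation_pushout:
      "\<lbrakk>(i, p) \<in> E; f \<in> Arr C; Src C f = Src C i\<rbrakk>
       \<Longrightarrow> \<exists>f' i' p'. pushout_square C i f f' i' \<and> (i', p') \<in> E"
    and deflation_pullback:
      "\<lbrakk>(i, p) \<in> E; f \<in> Arr C; Trg C f = Trg C p\<rbrakk>
       \<Longrightarrow> \<exists>f' i' p'. pullback_square C p f f' p' \<and> (i', p') \<in> E"

definition projective :: "('o, 'm) addcat \<Rightarrow> ('m \<times> 'm) set \<Rightarrow> 'o \<Rightarrow> bool" where
  "projective C E P \<longleftrightarrow> P \<in> Obj C \<and>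
     (\<forall>(i, p) \<in> E. \<forall>f \<in> Hom C P (Trg C p). \<exists>g \<in> Hom C P (Src C p). p \<cdot>\<^bsub>C\<^esub> g = f)"

definition injective :: "('o, 'm) addcat \<Rightarrow> ('m \<times> 'm) set \<Rightarrow> 'o \<Rightarrow> bool" where
  "injective C E Q \<longleftrightarrow> Q \<in> Obj C \<and>
     (\<forall>(i, p) \<in> E. \<forall>f \<in> Hom C (Src C i) Q. \<exists>g \<in> Hom C (Trg C i) Q. g \<cdot>\<^bsub>C\<^esub> i = f)"

definition syzygy_conflation ::
  "('o, 'm) addcat \<Rightarrow> ('m \<times> 'm) set \<Rightarrow> 'o \<Rightarrow> 'm \<times> 'm \<Rightarrow> bool" where
  "syzygy_conflation C E A \<xi> \<longleftrightarrow>
     \<xi> \<in> E \<and> Trg C (snd \<xi>) = A \<and> projective C E (Src C (snd \<xi>))"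

definition cosyzygy_conflation ::
  "('o, 'm) addcat \<Rightarrow> ('m \<times> 'm) set \<Rightarrow> 'o \<Rightarrow> 'm \<times> 'm \<Rightarrow> bool" where
  "cosyzygy_conflation C E A \<xi> \<longleftrightarrow>
     \<xi> \<in> E \<and> Src C (fst \<xi>) = A \<and> injective C E (Trg C (fst \<xi>))"

locale frobenius_category = exact_category C E
  for C :: "('o, 'm) addcat" (structure) and E :: "('m \<times> 'm) set" +
  assumes enough_projectives: "A \<in> Obj C \<Longrightarrow> \<exists>\<xi>. syzygy_conflation C E A \<xi>"
    and enough_injectives: "A \<in> Obj C \<Longrightarrow> \<exists>\<xi>. cosyzygy_conflation C E A \<xi>"
    and projective_iff_injective: "A \<in> Obj C \<Longrightarrow> projective C E A \<longleftrightarrow> injective C E A"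


section \<open>Ext and ideal cotorsion pairs\<close>

definition conflations ::
  "('o, 'm) addcat \<Rightarrow> ('m \<times> 'm) set \<Rightarrow> 'o \<Rightarrow> 'o \<Rightarrow> ('m \<times> 'm) set" where
  "conflations C E A B = {(i, p) \<in> E. Src C i = B \<and> Trg C p = A}"

definition ext_equiv ::
  "('o, 'm) addcat \<Rightarrow> ('m \<times> 'm) set \<Rightarrow> 'o \<Rightarrow> 'o \<Rightarrow> (('m \<times> 'm) \<times> ('m \<times> 'm)) set" where
  "ext_equiv C E A B =
     {(\<xi>, \<eta>). \<xi> \<in> conflations C E A B \<and> \<eta> \<in> conflations C E A B \<and>
        (\<exists>c. is_iso C c \<and> seq_morphism C \<xi> \<eta> (Ide C B) c (Ide C A))}"

definition Ext :: "('o, 'm) addcat \<Rightarrow> ('m \<times> 'm) set \<Rightarrow> 'o \<Rightarrow> 'o \<Rightarrow> ('m \<times> 'm) set set" where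
  "Ext C E A B = conflations C E A B // ext_equiv C E A B"

text \<open>The neutral element of the Baer sum on \<open>Ext C E A B\<close>: the class of the split conflations.\<close>

definition ext_zero :: "('o, 'm) addcat \<Rightarrow> ('m \<times> 'm) set \<Rightarrow> 'o \<Rightarrow> 'o \<Rightarrow> ('m \<times> 'm) set" where
  "ext_zero C E A B =
     {(i, p) \<in> conflations C E A B. \<exists>s \<in> Hom C A (Src C p). p \<cdot>\<^bsub>C\<^esub> s = Ide C A}"

fun ext_pullback :: "('o, 'm) addcat \<Rightarrow> 'm \<Rightarrow> 'm \<times> 'm \<Rightarrow> 'm \<times> 'm \<Rightarrow> bool" where
  "ext_pullback C f (i, p) (i', p') \<longleftrightarrow>
     Src C i' = Src C i \<and> (\<exists>b. pullback_square C p f b p' \<and> b \<cdot>\<^bsub>C\<^esub> i' = i)"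

fun ext_pushout :: "('o, 'm) addcat \<Rightarrow> 'm \<Rightarrow> 'm \<times> 'm \<Rightarrow> 'm \<times> 'm \<Rightarrow> bool" where
  "ext_pushout C g (i, p) (i', p') \<longleftrightarrow>
     Trg C p' = Trg C p \<and> (\<exists>b. pushout_square C i g b i' \<and> p' \<cdot>\<^bsub>C\<^esub> b = p)"

text \<open>
  \<open>Ext (f, g)\<close> for \<open>f : X \<rightarrow> A\<close> and \<open>g : B \<rightarrow> Y\<close>. Pullbacks and pushouts being unique only up to
  isomorphism, the set of all conflations arising from representatives of a class in
  \<open>Ext C E A B\<close> is exactly one class in \<open>Ext C E X Y\<close>.
\<close>

definition ext_map ::
  "('o, 'm) addcat \<Rightarrow> ('m \<times> 'm) set \<Rightarrow> 'm \<Rightarrow> 'm \<Rightarrow> ('m \<times> 'm) set \<Rightarrow> ('m \<times> 'm) set" where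
  "ext_map C E f g \<Xi> =
     {\<zeta> \<in> E. \<exists>\<xi> \<in> \<Xi>. \<exists>\<eta> \<in> E. ext_pullback C f \<xi> \<eta> \<and> ext_pushout C g \<eta> \<zeta>}"

definition ext_orthogonal ::
  "('o, 'm) addcat \<Rightarrow> ('m \<times> 'm) set \<Rightarrow> 'm \<Rightarrow> 'm \<Rightarrow> bool" where
  "ext_orthogonal C E f g \<longleftrightarrow>
     (\<forall>\<Xi> \<in> Ext C E (Trg C f) (Src C g). ext_map C E f g \<Xi> = ext_zero C E (Src C f) (Trg C g))"

definition ext_right_perp ::
  "('o, 'm) addcat \<Rightarrow> ('m \<times> 'm) set \<Rightarrow> 'm set \<Rightarrow> 'm set" where
  "ext_right_perp C E I = {g \<in> Arr C. \<forall>i \<in> I. ext_orthogonal C E i g}"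

definition ext_left_perp ::
  "('o, 'm) addcat \<Rightarrow> ('m \<times> 'm) set \<Rightarrow> 'm set \<Rightarrow> 'm set" where
  "ext_left_perp C E J = {f \<in> Arr C. \<forall>j \<in> J. ext_orthogonal C E f j}"

definition ideal_cotorsion_pair ::
  "('o, 'm) addcat \<Rightarrow> ('m \<times> 'm) set \<Rightarrow> 'm set \<Rightarrow> 'm set \<Rightarrow> bool" where
  "ideal_cotorsion_pair C E I J \<longleftrightarrow> cat_ideal C I \<and> cat_ideal C J \<and>
     I = ext_left_perp C E J \<and> J = ext_right_perp C E I"

definition ext_special_precover ::
  "('o, 'm) addcat \<Rightarrow> ('m \<times> 'm) set \<Rightarrow> 'm set \<Rightarrow> 'o \<Rightarrow> 'm \<Rightarrow> bool" where
  "ext_special_precover C E I X i \<longleftrightarrow> i \<in> I \<and> Trg C i = X \<and>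
     (\<exists>k. (k, i) \<in> E \<and>
        (\<exists>\<xi> g b. syzygy_conflation C E X \<xi> \<and> g \<in> ext_right_perp C E I \<and>
           seq_morphism C \<xi> (k, i) g b (Ide C X)))"

definition ext_special_preenvelope ::
  "('o, 'm) addcat \<Rightarrow> ('m \<times> 'm) set \<Rightarrow> 'm set \<Rightarrow> 'o \<Rightarrow> 'm \<Rightarrow> bool" where
  "ext_special_preenvelope C E J X j \<longleftrightarrow> j \<in> J \<and> Src C j = X \<and>
     (\<exists>q. (j, q) \<in> E \<and>
        (\<exists>\<xi> b f. cosyzygy_conflation C E X \<xi> \<and> f \<in> ext_left_perp C E J \<and>
           seq_morphism C (j, q) \<xi> (Ide C X) b f))"

definition complete_ideal_cotorsion_pair ::
  "('o, 'm) addcat \<Rightarrow> ('m \<times> 'm) set \<Rightarrow> 'm set \<Rightarrow> 'm set \<Rightarrow> bool" where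
  "complete_ideal_cotorsion_pair C E I J \<longleftrightarrow> ideal_cotorsion_pair C E I J \<and>
     (\<forall>X \<in> Obj C. (\<exists>i. ext_special_precover C E I X i) \<and>
                   (\<exists>j. ext_special_preenvelope C E J X j))"


section \<open>Ideal torsion pairs\<close>

definition right_perp :: "('o, 'm) addcat \<Rightarrow> 'm set \<Rightarrow> 'm set" where
  "right_perp D M = {j \<in> Arr D. \<forall>f \<in> M. \<forall>x \<in> Hom D (Trg D f) (Src D j).
     j \<cdot>\<^bsub>D\<^esub> x \<cdot>\<^bsub>D\<^esub> f = Zer D (Src D f) (Trg D j)}"

definition left_perp :: "('o, 'm) addcat \<Rightarrow> 'm set \<Rightarrow> 'm set" where
  "left_perp D M = {f \<in> Arr D. \<forall>j \<in> M. \<forall>x \<in> Hom D (Trg D f) (Src D j).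
     j \<cdot>\<^bsub>D\<^esub> x \<cdot>\<^bsub>D\<^esub> f = Zer D (Src D f) (Trg D j)}"

definition ideal_torsion_pair :: "('o, 'm) addcat \<Rightarrow> 'm set \<Rightarrow> 'm set \<Rightarrow> bool" where
  "ideal_torsion_pair D I J \<longleftrightarrow> cat_ideal D I \<and> cat_ideal D J \<and>
     I = left_perp D J \<and> J = right_perp D I"

definition precover :: "('o, 'm) addcat \<Rightarrow> 'm set \<Rightarrow> 'o \<Rightarrow> 'm \<Rightarrow> bool" where
  "precover D I X i \<longleftrightarrow> i \<in> I \<and> Trg D i = X \<and>
     (\<forall>f \<in> I. Trg D f = X \<longrightarrow> (\<exists>u \<in> Hom D (Src D f) (Src D i). i \<cdot>\<^bsub>D\<^esub> u = f))"

text \<open>Here \<open>W\<close> is the collection of weak conflations of \<open>D\<close>.\<close>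

definition hom_special_precover ::
  "('o, 'm) addcat \<Rightarrow> ('m \<times> 'm) set \<Rightarrow> 'm set \<Rightarrow> 'o \<Rightarrow> 'm \<Rightarrow> bool" where
  "hom_special_precover D W I X i \<longleftrightarrow> precover D I X i \<and> (\<exists>j. (i, j) \<in> W)"

definition complete_ideal_torsion_pair ::
  "('o, 'm) addcat \<Rightarrow> ('m \<times> 'm) set \<Rightarrow> 'm set \<Rightarrow> 'm set \<Rightarrow> bool" where
  "complete_ideal_torsion_pair D W I J \<longleftrightarrow> ideal_torsion_pair D I J \<and>
     (\<forall>X \<in> Obj D. \<exists>i. hom_special_precover D W I X i)"


section \<open>The stable category and its triangulation\<close>

definition Proj :: "('o, 'm) addcat \<Rightarrow> ('m \<times> 'm) set \<Rightarrow> 'o \<Rightarrow> 'o \<Rightarrow> 'm set" where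
  "Proj C E A B = {f \<in> Hom C A B. \<exists>P. projective C E P \<and>
     (\<exists>u \<in> Hom C A P. \<exists>v \<in> Hom C P B. f = v \<cdot>\<^bsub>C\<^esub> u)}"

definition stable_hom_group ::
  "('o, 'm) addcat \<Rightarrow> ('m \<times> 'm) set \<Rightarrow> 'o \<Rightarrow> 'o \<Rightarrow> 'm set monoid" where
  "stable_hom_group C E A B = hom_group C A B Mod Proj C E A B"

text \<open>The quotient functor on morphisms; it is the identity on objects.\<close>

definition stable_map :: "('o, 'm) addcat \<Rightarrow> ('m \<times> 'm) set \<Rightarrow> 'm \<Rightarrow> 'm set" where
  "stable_map C E f =
     Proj C E (Src C f) (Trg C f) #>\<^bsub>hom_group C (Src C f) (Trg C f)\<^esub> f"

text \<open>
  All members of a coset are parallel, and the coset of a composite does not depend on the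
  representatives, so that \<open>the_elem\<close> is applied to singletons.
\<close>

definition stable_category ::
  "('o, 'm) addcat \<Rightarrow> ('m \<times> 'm) set \<Rightarrow> ('o, 'm set) addcat" where
  "stable_category C E =
    \<lparr>Obj = Obj C,
     Arr = (\<Union>A \<in> Obj C. \<Union>B \<in> Obj C. carrier (stable_hom_group C E A B)),
     Src = (\<lambda>F. the_elem (Src C ` F)),
     Trg = (\<lambda>F. the_elem (Trg C ` F)),
     Ide = (\<lambda>A. stable_map C E (Ide C A)),
     Cmp = (\<lambda>G F. the_elem ((\<lambda>(g, f). stable_map C E (g \<cdot>\<^bsub>C\<^esub> f)) ` (G \<times> F))),
     Add = (\<lambda>F G. mult (stable_hom_group C E (the_elem (Src C ` F)) (the_elem (Trg C ` F))) F G),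
     Zer = (\<lambda>A B. one (stable_hom_group C E A B))\<rparr>"

text \<open>
  The suspension depends on a choice \<open>S\<close> of a conflation \<open>A \<rightarrow> Q \<rightarrow> \<Sigma> A\<close> with \<open>Q\<close> injective for
  every object \<open>A\<close>.
\<close>

definition cosyzygy_choice ::
  "('o, 'm) addcat \<Rightarrow> ('m \<times> 'm) set \<Rightarrow> ('o \<Rightarrow> 'm \<times> 'm) \<Rightarrow> bool" where
  "cosyzygy_choice C E S \<longleftrightarrow> (\<forall>A \<in> Obj C. cosyzygy_conflation C E A (S A))"

definition shift_obj :: "('o, 'm) addcat \<Rightarrow> ('o \<Rightarrow> 'm \<times> 'm) \<Rightarrow> 'o \<Rightarrow> 'o" where
  "shift_obj C S A = Trg C (snd (S A))"

text \<open>The suspension of the class of \<open>f\<close> is the class of any \<open>s\<close> making \<open>(f, e, s)\<close> a morphism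
  between the chosen conflations.\<close>

definition shift_arr ::
  "('o, 'm) addcat \<Rightarrow> ('m \<times> 'm) set \<Rightarrow> ('o \<Rightarrow> 'm \<times> 'm) \<Rightarrow> 'm set \<Rightarrow> 'm set" where
  "shift_arr C E S F =
     the_elem {stable_map C E s | f e s.
       f \<in> F \<and> seq_morphism C (S (Src C f)) (S (Trg C f)) f e s}"

text \<open>
  The standard triangle on \<open>f : A \<rightarrow> B\<close>, given by the pushout \<open>g : B \<rightarrow> M\<close> of the chosen
  inflation \<open>A \<rightarrow> Q\<close> along \<open>f\<close> and the induced \<open>h : M \<rightarrow> \<Sigma> A\<close>.
\<close>

definition standard_triangle ::
  "('o, 'm) addcat \<Rightarrow> ('o \<Rightarrow> 'm \<times> 'm) \<Rightarrow> 'm \<Rightarrow> 'm \<Rightarrow> 'm \<Rightarrow> bool" where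
  "standard_triangle C S f g h \<longleftrightarrow> f \<in> Arr C \<and>
     (\<exists>e. pushout_square C (fst (S (Src C f))) f e g \<and>
        h \<in> Hom C (Trg C g) (shift_obj C S (Src C f)) \<and>
        h \<cdot>\<^bsub>C\<^esub> e = snd (S (Src C f)) \<and>
        h \<cdot>\<^bsub>C\<^esub> g = Zer C (Trg C f) (shift_obj C S (Src C f)))"

definition distinguished_triangle ::
  "('o, 'm) addcat \<Rightarrow> ('m \<times> 'm) set \<Rightarrow> ('o \<Rightarrow> 'm \<times> 'm) \<Rightarrow> 'm set \<Rightarrow> 'm set \<Rightarrow> 'm set \<Rightarrow> bool" where
  "distinguished_triangle C E S u v w \<longleftrightarrow>
     (let D = stable_category C E in
        u \<in> Arr D \<and> v \<in> Hom D (Trg D u) (Src D w) \<and>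
        w \<in> Hom D (Trg D v) (shift_obj C S (Src D u)) \<and>
        (\<exists>f g h. standard_triangle C S f g h \<and>
          (\<exists>a \<in> Hom D (Src D u) (Src C f). \<exists>b \<in> Hom D (Trg D u) (Trg C f).
           \<exists>c \<in> Hom D (Trg D v) (Trg C g).
             is_iso D a \<and> is_iso D b \<and> is_iso D c \<and>
             b \<cdot>\<^bsub>D\<^esub> u = stable_map C E f \<cdot>\<^bsub>D\<^esub> a \<and>
             c \<cdot>\<^bsub>D\<^esub> v = stable_map C E g \<cdot>\<^bsub>D\<^esub> b \<and>
             shift_arr C E S a \<cdot>\<^bsub>D\<^esub> w = stable_map C E h \<cdot>\<^bsub>D\<^esub> c)))"

definition weak_conflations ::
  "('o, 'm) addcat \<Rightarrow> ('m \<times> 'm) set \<Rightarrow> ('o \<Rightarrow> 'm \<times> 'm) \<Rightarrow> ('m set \<times> 'm set) set" where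
  "weak_conflations C E S = {(u, v). \<exists>w. distinguished_triangle C E S u v w}"

text \<open>The morphisms \<open>\<Sigma> (\<pi> (j))\<close> with \<open>j \<in> J\<close>, up to isomorphism of morphisms.\<close>

definition stable_shift_image ::
  "('o, 'm) addcat \<Rightarrow> ('m \<times> 'm) set \<Rightarrow> ('o \<Rightarrow> 'm \<times> 'm) \<Rightarrow> 'm set \<Rightarrow> 'm set set" where
  "stable_shift_image C E S J =
     {h. \<exists>j \<in> J. iso_arrows (stable_category C E) h (shift_arr C E S (stable_map C E j))}"

end

(*
  A morphism (a, b, c) of conflations is null on the left (a factors through the inflation) exactly
  if it is null on the right (c factors through the deflation). As every conflation starting in B is
  a pullback of the chosen conflation B -> Q -> Sigma B, this turns Ext(f, g) = 0 into the vanishing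
  of Sigma(g) x f in the stable category for all x, which matches the two kinds of pairs.

  Every morphism of the stable category starts a triangle, so Hom-special precovers are just
  precovers. A special I-precover is one because (g, b, 1) with g in the perp of I makes every f in I
  lift. Conversely, let i : T -> X represent a precover in the stable category and let K -> P -> X be
  a conflation with P projective. Then [i, p] : T + P -> X is a special I-precover, and the pullback
  of K -> P -> X along i is an inflation K -> T x_X P which is a special J-preenvelope of K; every
  object occurs as such a K, namely for X = Sigma K.
*)

theory Submission
  imports Defs
begin

section \<open>Arrows of an additive category\<close>

text \<open>The stable category is handled through representatives: \<open>null_arr\<close> gathers
  the arrows that factor through projectives, and statements about cosets become statements about
  arrows of \<open>C\<close> whose difference is null. Since \<open>I\<close> is a left perp, it
  contains \<open>null_arr\<close>, so passing to cosets loses no information about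
  \<open>I\<close>. Suspension is well defined only modulo null arrows, hence the relation
  \<open>shift_of\<close> in place of a function on arrows. As \<open>ext_map\<close> returns a
  whole set of pairs, Ext-orthogonality is an equation between sets, which has to be reduced to
  diagrams before any homotopy argument applies. The reduced form is an extension property: for
  every morphism of conflations with left component 1 and right component \<open>f\<close>, the
  arrow \<open>g\<close> extends along the inflation of the source. That every split conflation is
  hit is the content of \<open>pushout_split\<close>. The summand P in [i, p] has two jobs: it makes
  the arrow a deflation, and it absorbs the null error f - i u left by a stable factorization,
  because a null arrow lifts along every deflation onto its target.\<close>

context additive_category
begin

lemma Hom_iff: "f \<in> Hom C A B \<longleftrightarrow> f \<in> Arr C \<and> Src C f = A \<and> Trg C f = B"
  by (auto simp: Hom_def)

lemma Hom_Obj: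
  assumes "f \<in> Hom C A B"
  shows "A \<in> Obj C" "B \<in> Obj C"
  using assms Src_Obj Trg_Obj by (auto simp: Hom_def)

lemma Cmp_simps [simp]:
  assumes "f \<in> Arr C" "g \<in> Arr C" "Src C g = Trg C f"
  shows "g \<cdot> f \<in> Arr C" "Src C (g \<cdot> f) = Src C f" "Trg C (g \<cdot> f) = Trg C g"
  using Cmp_Hom[of f "Src C f" "Trg C f" g "Trg C g"] assms by (auto simp: Hom_def)

lemma Cmp_assoc_Arr [simp]:
  "\<lbrakk>f \<in> Arr C; g \<in> Arr C; h \<in> Arr C; Src C g = Trg C f; Src C h = Trg C g\<rbrakk>
    \<Longrightarrow> (h \<cdot> g) \<cdot> f = h \<cdot> (g \<cdot> f)"
  using Cmp_assoc[of f "Src C f" "Trg C f" g "Trg C g" h "Trg C h"] by (simp add: Hom_def)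

lemma Ide_simps [simp]:
  assumes "A \<in> Obj C"
  shows "Ide C A \<in> Arr C" "Src C (Ide C A) = A" "Trg C (Ide C A) = A"
  using Ide_Hom[OF assms] by (auto simp: Hom_def)

lemma Cmp_Ide_Arr [simp]:
  assumes "f \<in> Arr C"
  shows "Src C f = A \<Longrightarrow> f \<cdot> Ide C A = f" "Trg C f = A \<Longrightarrow> Ide C A \<cdot> f = f"
  using Cmp_Ide[of f] Ide_Cmp[of f] assms by (auto simp: Hom_def)

lemma Src_Trg_Obj [simp]: "f \<in> Arr C \<Longrightarrow> Src C f \<in> Obj C" "f \<in> Arr C \<Longrightarrow> Trg C f \<in> Obj C"
  by (fact Src_Obj, fact Trg_Obj)

text \<open>Composites are simplified to right-bracketed form, where \<open>a \<cdot> b\<close> no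
  longer occurs in \<open>a \<cdot> (b \<cdot> w)\<close>; this form carries a commuting square past
  a further factor \<open>w\<close>.\<close>

lemma Cmp_extend:
  assumes "a \<cdot> b = c \<cdot> d" "a \<in> Arr C" "b \<in> Arr C" "c \<in> Arr C" "d \<in> Arr C" "w \<in> Arr C"
    and "Src C a = Trg C b" "Src C c = Trg C d" "Src C b = Trg C w"
  shows "a \<cdot> (b \<cdot> w) = c \<cdot> (d \<cdot> w)"
proof -
  have "Src C d = Src C b"
    using assms by (metis Cmp_simps(2))
  then have "a \<cdot> (b \<cdot> w) = (a \<cdot> b) \<cdot> w" "c \<cdot> (d \<cdot> w) = (c \<cdot> d) \<cdot> w"
    using assms(2-) by auto
  then show ?thesis by (simp only: assms(1))
qed

section \<open>Zero arrows, sums and differences of parallel arrows\<close>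

lemma Zer_Hom: "\<lbrakk>A \<in> Obj C; B \<in> Obj C\<rbrakk> \<Longrightarrow> Zer C A B \<in> Hom C A B"
  using comm_group.axioms(2)[OF Hom_comm_group, of A B] group.is_monoid monoid.one_closed
  by (fastforce simp: hom_group_def)

lemma Zer_simps [simp]:
  assumes "A \<in> Obj C" "B \<in> Obj C"
  shows "Zer C A B \<in> Arr C" "Src C (Zer C A B) = A" "Trg C (Zer C A B) = B"
  using Zer_Hom[OF assms] by (auto simp: Hom_def)

lemma Add_Hom: "\<lbrakk>f \<in> Hom C A B; g \<in> Hom C A B\<rbrakk> \<Longrightarrow> Add C f g \<in> Hom C A B"
  using comm_group.axioms(2)[OF Hom_comm_group, of A B] Hom_Obj[of f A B]
    monoid.m_closed[OF group.is_monoid, of "hom_group C A B" f g]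
  by (simp add: hom_group_def)

lemma Add_simps [simp]:
  assumes "f \<in> Arr C" "g \<in> Arr C" "Src C g = Src C f" "Trg C g = Trg C f"
  shows "Add C f g \<in> Arr C" "Src C (Add C f g) = Src C f" "Trg C (Add C f g) = Trg C f"
  using Add_Hom[of f "Src C f" "Trg C f" g] assms by (auto simp: Hom_def)

text \<open>The record provides no negation; it is recovered as the inverse in the Hom group that
  the ends of \<open>f\<close> single out, so that no object parameters have to be carried
  along.\<close>

definition arr_neg :: "'m \<Rightarrow> 'm" where
  "arr_neg f = inv\<^bsub>hom_group C (Src C f) (Trg C f)\<^esub> f"

definition arr_diff :: "'m \<Rightarrow> 'm \<Rightarrow> 'm" where
  "arr_diff f g = Add C f (arr_neg g)"

lemma hom_group_simps:
  "carrier (hom_group C A B) = Hom C A B" "mult (hom_group C A B) = Add C"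
  "one (hom_group C A B) = Zer C A B"
  by (simp_all add: hom_group_def)

lemma Hom_group:
  assumes "f \<in> Hom C A B"
  shows "comm_group (hom_group C A B)" "group (hom_group C A B)"
  using Hom_comm_group Hom_Obj[OF assms] comm_group.axioms(2) by auto

lemma neg_Hom: "f \<in> Hom C A B \<Longrightarrow> arr_neg f \<in> Hom C A B"
  using group.inv_closed[OF Hom_group(2), of f A B] by (auto simp: arr_neg_def hom_group_simps Hom_iff)

lemma diff_Hom: "\<lbrakk>f \<in> Hom C A B; g \<in> Hom C A B\<rbrakk> \<Longrightarrow> arr_diff f g \<in> Hom C A B"
  by (simp add: arr_diff_def Add_Hom neg_Hom)

lemma diff_simps [simp]:
  assumes "f \<in> Arr C" "g \<in> Arr C" "Src C g = Src C f" "Trg C g = Trg C f"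
  shows "arr_diff f g \<in> Arr C" "Src C (arr_diff f g) = Src C f" "Trg C (arr_diff f g) = Trg C f"
  using diff_Hom[of f "Src C f" "Trg C f" g] assms by (auto simp: Hom_def)

lemma Add_neg: "f \<in> Hom C A B \<Longrightarrow> Add C f (arr_neg f) = Zer C A B"
  using group.r_inv[OF Hom_group(2), of f A B] by (auto simp: arr_neg_def hom_group_simps Hom_iff)

lemma Add_assoc:
  "\<lbrakk>f \<in> Hom C A B; g \<in> Hom C A B; h \<in> Hom C A B\<rbrakk>
    \<Longrightarrow> Add C (Add C f g) h = Add C f (Add C g h)"
  using monoid.m_assoc[OF group.is_monoid[OF Hom_group(2)], of f A B f g h]
  by (simp add: hom_group_simps)

lemma Add_comm: "\<lbrakk>f \<in> Hom C A B; g \<in> Hom C A B\<rbrakk> \<Longrightarrow> Add C f g = Add C g f"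
  using comm_monoid.m_comm[OF comm_group.axioms(1)[OF Hom_group(1)], of f A B f g]
  by (simp add: hom_group_simps)

lemma Add_Zer:
  assumes "f \<in> Hom C A B"
  shows "Add C f (Zer C A B) = f" "Add C (Zer C A B) f = f"
  using monoid.r_one[OF group.is_monoid[OF Hom_group(2)], of f A B f]
    monoid.l_one[OF group.is_monoid[OF Hom_group(2)], of f A B f] assms
  by (simp_all add: hom_group_simps)

lemma Add_Zer_Arr [simp]:
  assumes "f \<in> Arr C" "Src C f = A" "Trg C f = B"
  shows "Add C f (Zer C A B) = f" "Add C (Zer C A B) f = f"
  using Add_Zer assms by (auto simp: Hom_iff)

lemma diff_self: "f \<in> Hom C A B \<Longrightarrow> arr_diff f f = Zer C A B"
  by (simp add: arr_diff_def Add_neg)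

lemma Add_diff_cancel:
  assumes "f \<in> Hom C A B" "g \<in> Hom C A B"
  shows "Add C (arr_diff f g) g = f" "arr_diff (Add C f g) g = f"
    "arr_diff (Add C g f) g = f" "Add C g (arr_diff f g) = f"
proof -
  show *: "Add C (arr_diff f g) g = f"
    using assms Add_neg[OF assms(2)] neg_Hom[OF assms(2)] Add_comm[of g A B "arr_neg g"]
    by (simp add: arr_diff_def Add_assoc[of f A B "arr_neg g" g] Add_Zer)
  show **: "arr_diff (Add C f g) g = f"
    using assms Add_neg[OF assms(2)] neg_Hom[OF assms(2)]
    by (simp add: arr_diff_def Add_assoc[of f A B g] Add_Zer)
  show "arr_diff (Add C g f) g = f" using ** Add_comm assms by simp
  show "Add C g (arr_diff f g) = f" using * Add_comm assms diff_Hom by metis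
qed

lemma diff_Zer:
  assumes "f \<in> Hom C A B"
  shows "arr_diff f (Zer C A B) = f"
  using Add_diff_cancel(2)[OF assms Zer_Hom] Hom_Obj[OF assms] assms by (simp add: Add_Zer)

lemma Add_cancel:
  "\<lbrakk>f \<in> Hom C A B; g \<in> Hom C A B; h \<in> Hom C A B; Add C f h = Add C g h\<rbrakk> \<Longrightarrow> f = g"
  using Add_diff_cancel(2) by metis

lemma diff_eq_iff:
  "\<lbrakk>f \<in> Hom C A B; g \<in> Hom C A B; h \<in> Hom C A B\<rbrakk> \<Longrightarrow> arr_diff f g = h \<longleftrightarrow> f = Add C h g"
  using Add_diff_cancel by metis

text \<open>Distributivity gives g 0 = g 0 + g 0, and Hom groups have cancellation.\<close>

lemma Cmp_Zer [simp]:
  assumes "g \<in> Arr C" "Src C g = B" "A \<in> Obj C"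
  shows "g \<cdot> Zer C A B = Zer C A (Trg C g)"
proof -
  let ?z = "Zer C A B"
  have z: "?z \<in> Hom C A B" using assms Zer_Hom by auto
  have gz: "g \<cdot> ?z \<in> Hom C A (Trg C g)" using assms z by (auto simp: Hom_iff)
  have "Add C (g \<cdot> ?z) (g \<cdot> ?z) = g \<cdot> ?z"
    using Cmp_Add[OF z z, of g "Trg C g"] assms Add_Zer[OF z] by (simp add: Hom_iff)
  then show ?thesis
    using Add_cancel[OF gz Zer_Hom gz] gz assms Add_Zer(2)[OF gz] by auto
qed

lemma Zer_Cmp [simp]:
  assumes "f \<in> Arr C" "Trg C f = B" "D \<in> Obj C"
  shows "Zer C B D \<cdot> f = Zer C (Src C f) D"
proof -
  let ?z = "Zer C B D"
  have z: "?z \<in> Hom C B D" using assms Zer_Hom by auto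
  have gz: "?z \<cdot> f \<in> Hom C (Src C f) D" using assms z by (auto simp: Hom_iff)
  have "Add C (?z \<cdot> f) (?z \<cdot> f) = ?z \<cdot> f"
    using Add_Cmp[of f "Src C f" B, OF _ z z] assms Add_Zer[OF z] by (simp add: Hom_iff)
  then show ?thesis
    using Add_cancel[OF gz Zer_Hom gz] gz assms Add_Zer(2)[OF gz] by auto
qed

lemma Cmp_Zer_extend:
  assumes "a \<cdot> b = Zer C X Y" "a \<in> Arr C" "b \<in> Arr C" "w \<in> Arr C"
    and "Src C a = Trg C b" "Src C b = X" "Trg C a = Y" "Trg C w = X"
  shows "a \<cdot> (b \<cdot> w) = Zer C (Src C w) Y"
proof -
  have "a \<cdot> (b \<cdot> w) = (a \<cdot> b) \<cdot> w"
    using assms(2-) by simp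
  then show ?thesis using assms by (simp only: Zer_Cmp Src_Trg_Obj) (metis Src_Trg_Obj(2) Zer_Cmp)
qed

lemma Cmp_Add_Arr [simp]:
  "\<lbrakk>f \<in> Arr C; f' \<in> Arr C; g \<in> Arr C; Src C f' = Src C f; Trg C f' = Trg C f; Src C g = Trg C f\<rbrakk>
    \<Longrightarrow> g \<cdot> Add C f f' = Add C (g \<cdot> f) (g \<cdot> f')"
  using Cmp_Add[of f "Src C f" "Trg C f"] by (simp add: Hom_iff)

lemma Add_Cmp_Arr [simp]:
  "\<lbrakk>f \<in> Arr C; g' \<in> Arr C; g \<in> Arr C; Src C g' = Src C g; Trg C g' = Trg C g; Src C g = Trg C f\<rbrakk>
    \<Longrightarrow> Add C g g' \<cdot> f = Add C (g \<cdot> f) (g' \<cdot> f)"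
  using Add_Cmp[of f "Src C f" "Trg C f"] by (simp add: Hom_iff)

lemma Cmp_diff [simp]:
  assumes "f \<in> Arr C" "f' \<in> Arr C" "g \<in> Arr C"
    and "Src C f' = Src C f" "Trg C f' = Trg C f" "Src C g = Trg C f"
  shows "g \<cdot> arr_diff f f' = arr_diff (g \<cdot> f) (g \<cdot> f')"
proof -
  have "Add C (g \<cdot> arr_diff f f') (g \<cdot> f') = g \<cdot> Add C (arr_diff f f') f'"
    using assms by simp
  also have "\<dots> = g \<cdot> f"
    using assms Add_diff_cancel(1)[of f _ _ f'] by (simp add: Hom_iff)
  finally show ?thesis
    using diff_eq_iff[of "g \<cdot> f" "Src C f" "Trg C g" "g \<cdot> f'" "g \<cdot> arr_diff f f'"] assms
    by (simp add: Hom_iff)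
qed

lemma diff_Cmp [simp]:
  assumes "f \<in> Arr C" "g' \<in> Arr C" "g \<in> Arr C"
    and "Src C g' = Src C g" "Trg C g' = Trg C g" "Src C g = Trg C f"
  shows "arr_diff g g' \<cdot> f = arr_diff (g \<cdot> f) (g' \<cdot> f)"
proof -
  have "Add C (arr_diff g g' \<cdot> f) (g' \<cdot> f) = Add C (arr_diff g g') g' \<cdot> f"
    using assms by simp
  also have "\<dots> = g \<cdot> f"
    using assms Add_diff_cancel(1)[of g _ _ g'] by (simp add: Hom_iff)
  finally show ?thesis
    using diff_eq_iff[of "g \<cdot> f" "Src C f" "Trg C g" "g' \<cdot> f" "arr_diff g g' \<cdot> f"] assms
    by (simp add: Hom_iff)
qed

lemma is_iso_Ide: "A \<in> Obj C \<Longrightarrow> is_iso C (Ide C A)"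
  unfolding is_iso_def by (auto simp: Hom_iff intro!: bexI[of _ "Ide C A"])

lemma is_isoI:
  "\<lbrakk>f \<in> Hom C A B; g \<in> Hom C B A; g \<cdot> f = Ide C A; f \<cdot> g = Ide C B\<rbrakk> \<Longrightarrow> is_iso C f"
  unfolding is_iso_def by (auto simp: Hom_iff)

section \<open>Ideals\<close>

lemma ideal_memD:
  assumes "cat_ideal C I"
  shows "f \<in> I \<Longrightarrow> f \<in> Arr C"
    and "\<lbrakk>f \<in> I; g \<in> Arr C; Src C g = Trg C f\<rbrakk> \<Longrightarrow> g \<cdot> f \<in> I"
    and "\<lbrakk>f \<in> I; g \<in> Arr C; Trg C g = Src C f\<rbrakk> \<Longrightarrow> f \<cdot> g \<in> I"
  using assms unfolding cat_ideal_def by auto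

lemma ideal_Add:
  assumes "cat_ideal C I" "f \<in> I" "g \<in> I" "f \<in> Hom C A B" "g \<in> Hom C A B"
  shows "Add C f g \<in> I"
proof -
  have "subgroup (I \<inter> Hom C A B) (hom_group C A B)"
    using assms Hom_Obj[of f A B] unfolding cat_ideal_def by blast
  from subgroup.m_closed[OF this, of f g] show ?thesis
    using assms by (simp add: hom_group_simps)
qed

lemma ideal_Zer:
  assumes "cat_ideal C I" "A \<in> Obj C" "B \<in> Obj C"
  shows "Zer C A B \<in> I"
proof -
  have "subgroup (I \<inter> Hom C A B) (hom_group C A B)"
    using assms unfolding cat_ideal_def by blast
  from subgroup.one_closed[OF this] show ?thesis
    using assms by (simp add: hom_group_simps)
qed

text \<open>The subgroup test by differences: a negative is 0 - g and a sum is f - (-g), so zero and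
  closure under \<open>arr_diff\<close> suffice.\<close>

lemma cat_idealI:
  assumes "I \<subseteq> Arr C"
    and "\<And>A B. \<lbrakk>A \<in> Obj C; B \<in> Obj C\<rbrakk> \<Longrightarrow> Zer C A B \<in> I"
    and "\<And>f g A B. \<lbrakk>f \<in> I; g \<in> I; f \<in> Hom C A B; g \<in> Hom C A B\<rbrakk> \<Longrightarrow> arr_diff f g \<in> I"
    and "\<And>f g. \<lbrakk>f \<in> I; g \<in> Arr C; Src C g = Trg C f\<rbrakk> \<Longrightarrow> g \<cdot> f \<in> I"
    and "\<And>f g. \<lbrakk>f \<in> I; g \<in> Arr C; Trg C g = Src C f\<rbrakk> \<Longrightarrow> f \<cdot> g \<in> I"
  shows "cat_ideal C I"
proof -
  have "subgroup (I \<inter> Hom C A B) (hom_group C A B)" if AB: "A \<in> Obj C" "B \<in> Obj C" for A B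
  proof -
    interpret G: comm_group "hom_group C A B" using AB by (rule Hom_comm_group)
    have neg: "inv\<^bsub>hom_group C A B\<^esub> g \<in> I" if g: "g \<in> I" "g \<in> Hom C A B" for g
    proof -
      have "arr_diff (Zer C A B) g \<in> I"
        using assms(3)[OF assms(2)[OF AB] g(1) Zer_Hom[OF AB] g(2)] .
      moreover have "arr_diff (Zer C A B) g = inv\<^bsub>hom_group C A B\<^esub> g"
        using g neg_Hom[OF g(2)] Add_Zer(2)[OF neg_Hom[OF g(2)]]
        by (simp add: arr_diff_def arr_neg_def Hom_iff)
      ultimately show ?thesis by simp
    qed
    show ?thesis
    proof (rule G.subgroupI)
      show "I \<inter> Hom C A B \<subseteq> carrier (hom_group C A B)" by (simp add: hom_group_simps)
      show "I \<inter> Hom C A B \<noteq> {}" using assms(2)[OF AB] Zer_Hom[OF AB] by blast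
      show "inv\<^bsub>hom_group C A B\<^esub> g \<in> I \<inter> Hom C A B" if "g \<in> I \<inter> Hom C A B" for g
        using neg G.inv_closed[of g] that by (auto simp: hom_group_simps)
      show "f \<otimes>\<^bsub>hom_group C A B\<^esub> g \<in> I \<inter> Hom C A B"
        if fg: "f \<in> I \<inter> Hom C A B" "g \<in> I \<inter> Hom C A B" for f g
      proof -
        let ?n = "inv\<^bsub>hom_group C A B\<^esub> g"
        have n: "?n \<in> I" "?n \<in> Hom C A B"
          using neg G.inv_closed[of g] fg by (auto simp: hom_group_simps)
        have "arr_diff f ?n = Add C f g"
          using n(2) G.inv_inv[of g] fg by (simp add: arr_diff_def arr_neg_def Hom_iff hom_group_simps)
        then show ?thesis
          using assms(3)[of f ?n A B] fg n Add_Hom[of f A B g] by (simp add: hom_group_simps)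
      qed
    qed
  qed
  then show ?thesis unfolding cat_ideal_def using assms(1,4,5) by blast
qed

end

section \<open>Conflations\<close>

lemma (in additive_category) pullback_ex1:
  assumes "pullback_square C p f f' p'" "x \<in> Hom C A (Src C p)" "y \<in> Hom C A (Src C f)" "p \<cdot> x = f \<cdot> y"
  shows "\<exists>!u. u \<in> Hom C A (Src C f') \<and> f' \<cdot> u = x \<and> p' \<cdot> u = y"
  using assms(1)[unfolded pullback_square_def, THEN conjunct2, THEN conjunct2, THEN conjunct2,
      THEN conjunct2, THEN conjunct2, THEN conjunct2, THEN conjunct2, THEN conjunct2,
      THEN conjunct2, rule_format, of x y] assms(2-4) by (simp add: Hom_iff)

lemma (in additive_category) pushout_ex1:
  assumes "pushout_square C i f f' i'" "x \<in> Hom C (Trg C i) A" "y \<in> Hom C (Trg C f) A" "x \<cdot> i = y \<cdot> f"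
  shows "\<exists>!u. u \<in> Hom C (Trg C f') A \<and> u \<cdot> f' = x \<and> u \<cdot> i' = y"
  using assms(1)[unfolded pushout_square_def, THEN conjunct2, THEN conjunct2, THEN conjunct2,
      THEN conjunct2, THEN conjunct2, THEN conjunct2, THEN conjunct2, THEN conjunct2,
      THEN conjunct2, rule_format, of x y] assms(2-4) by (simp add: Hom_iff)

lemma (in additive_category) pullback_lift:
  assumes "pullback_square C p f f' p'" "x \<in> Hom C A (Src C p)" "y \<in> Hom C A (Src C f)" "p \<cdot> x = f \<cdot> y"
  obtains u where "u \<in> Hom C A (Src C f')" "f' \<cdot> u = x" "p' \<cdot> u = y"
  using pullback_ex1[OF assms] by blast

lemma (in additive_category) pushout_desc:
  assumes "pushout_square C i f f' i'" "x \<in> Hom C (Trg C i) A" "y \<in> Hom C (Trg C f) A" "x \<cdot> i = y \<cdot> f"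
  obtains u where "u \<in> Hom C (Trg C f') A" "u \<cdot> f' = x" "u \<cdot> i' = y"
  using pushout_ex1[OF assms] by blast

text \<open>Both arrows mediate the same cone, with legs \<open>f' \<cdot> u\<close> and
  \<open>p' \<cdot> u\<close>.\<close>

lemma (in additive_category) pullback_unique:
  assumes pb: "pullback_square C p f f' p'"
    and u: "u \<in> Hom C A (Src C f')" and v: "v \<in> Hom C A (Src C f')"
    and eq: "f' \<cdot> u = f' \<cdot> v" "p' \<cdot> u = p' \<cdot> v"
  shows "u = v"
proof -
  have arr: "p \<in> Arr C" "f \<in> Arr C" "f' \<in> Arr C" "p' \<in> Arr C" "Trg C p = Trg C f"
    "Src C p' = Src C f'" "Src C p = Trg C f'" "Src C f = Trg C p'" "p \<cdot> f' = f \<cdot> p'"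
    using pb unfolding pullback_square_def by auto
  have "p \<cdot> (f' \<cdot> u) = f \<cdot> (p' \<cdot> u)"
    using Cmp_extend[OF arr(9)] arr u by (simp add: Hom_iff)
  moreover have "f' \<cdot> u \<in> Hom C A (Src C p)" "p' \<cdot> u \<in> Hom C A (Src C f)"
    using arr u by (simp_all add: Hom_iff)
  ultimately show ?thesis using pullback_ex1[OF pb, of "f' \<cdot> u" A "p' \<cdot> u"] u v eq by metis
qed

lemma (in additive_category) pushout_unique:
  assumes po: "pushout_square C i f f' i'"
    and u: "u \<in> Hom C (Trg C f') A" and v: "v \<in> Hom C (Trg C f') A"
    and eq: "u \<cdot> f' = v \<cdot> f'" "u \<cdot> i' = v \<cdot> i'"
  shows "u = v"
proof -
  have arr: "i \<in> Arr C" "f \<in> Arr C" "f' \<in> Arr C" "i' \<in> Arr C" "Src C i = Src C f"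
    "Trg C i' = Trg C f'" "Src C f' = Trg C i" "Src C i' = Trg C f" "f' \<cdot> i = i' \<cdot> f"
    using po unfolding pushout_square_def by auto
  have "(u \<cdot> f') \<cdot> i = (u \<cdot> i') \<cdot> f"
    using arr u by (simp add: Hom_iff)
  moreover have "u \<cdot> f' \<in> Hom C (Trg C i) A" "u \<cdot> i' \<in> Hom C (Trg C f) A"
    using arr u by (simp_all add: Hom_iff)
  ultimately show ?thesis using pushout_ex1[OF po, of "u \<cdot> f'" A "u \<cdot> i'"] u v eq by metis
qed

section \<open>Kernels and cokernels in conflations\<close>

context exact_category
begin

lemma conflationD:
  assumes "(i, p) \<in> E"
  shows "i \<in> Arr C" "p \<in> Arr C" "Src C p = Trg C i" "p \<cdot> i = Zer C (Src C i) (Trg C p)"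
  using kernel_cokernel_pair[OF assms] unfolding is_kernel_def by auto

lemma kernel_ex1:
  assumes "(i, p) \<in> E" "f \<in> Hom C A (Trg C i)" "p \<cdot> f = Zer C A (Trg C p)"
  shows "\<exists>!u. u \<in> Hom C A (Src C i) \<and> i \<cdot> u = f"
  using kernel_cokernel_pair[OF assms(1), THEN conjunct1, unfolded is_kernel_def,
      THEN conjunct2, THEN conjunct2, THEN conjunct2, THEN conjunct2, rule_format, of f]
    assms(2,3) conflationD[OF assms(1)] by (simp add: Hom_iff)

lemma cokernel_ex1:
  assumes "(i, p) \<in> E" "f \<in> Hom C (Trg C i) A" "f \<cdot> i = Zer C (Src C i) A"
  shows "\<exists>!u. u \<in> Hom C (Trg C p) A \<and> u \<cdot> p = f"
  using kernel_cokernel_pair[OF assms(1), THEN conjunct2, unfolded is_cokernel_def,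
      THEN conjunct2, THEN conjunct2, THEN conjunct2, THEN conjunct2, rule_format, of f]
    assms(2,3) conflationD[OF assms(1)] by (simp add: Hom_iff)

lemma kernel_lift:
  assumes "(i, p) \<in> E" "f \<in> Hom C A (Trg C i)" "p \<cdot> f = Zer C A (Trg C p)"
  obtains u where "u \<in> Hom C A (Src C i)" "i \<cdot> u = f"
  using kernel_ex1[OF assms] by blast

lemma cokernel_desc:
  assumes "(i, p) \<in> E" "f \<in> Hom C (Trg C i) A" "f \<cdot> i = Zer C (Src C i) A"
  obtains u where "u \<in> Hom C (Trg C p) A" "u \<cdot> p = f"
  using cokernel_ex1[OF assms] by blast

text \<open>The arrow \<open>i \<cdot> u\<close> is killed by \<open>p\<close>, so its factorization
  through the kernel \<open>i\<close> is unique.\<close>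

lemma inflation_mono:
  assumes E: "(i, p) \<in> E" and u: "u \<in> Hom C A (Src C i)" and v: "v \<in> Hom C A (Src C i)"
    and eq: "i \<cdot> u = i \<cdot> v"
  shows "u = v"
proof -
  note D = conflationD[OF E]
  have "p \<cdot> (i \<cdot> u) = Zer C A (Trg C p)"
    using D u Cmp_assoc_Arr[of u i p] by (simp add: Hom_iff)
  moreover have "i \<cdot> u \<in> Hom C A (Trg C i)"
    using D u by (simp add: Hom_iff)
  ultimately show ?thesis using kernel_ex1[OF E, of "i \<cdot> u" A] u v eq by metis
qed

lemma deflation_epi:
  assumes E: "(i, p) \<in> E" and u: "u \<in> Hom C (Trg C p) A" and v: "v \<in> Hom C (Trg C p) A"
    and eq: "u \<cdot> p = v \<cdot> p"
  shows "u = v"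
proof -
  note D = conflationD[OF E]
  have "(u \<cdot> p) \<cdot> i = Zer C (Src C i) A"
    using D u by (simp add: Hom_iff)
  moreover have "u \<cdot> p \<in> Hom C (Trg C i) A"
    using D u by (simp add: Hom_iff)
  ultimately show ?thesis using cokernel_ex1[OF E, of "u \<cdot> p" A] u v eq by metis
qed

section \<open>Morphisms of conflations\<close>

lemma seq_morphism_Cmp:
  assumes "(i, p) \<in> E" "(i', p') \<in> E" "(i'', p'') \<in> E"
    and "seq_morphism C (i, p) (i', p') a b c" "seq_morphism C (i', p') (i'', p'') a' b' c'"
  shows "seq_morphism C (i, p) (i'', p'') (a' \<cdot> a) (b' \<cdot> b) (c' \<cdot> c)"
proof -
  note D = conflationD[OF assms(1)] conflationD[OF assms(2)] conflationD[OF assms(3)]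
  have eq: "b \<cdot> i = i' \<cdot> a" "c \<cdot> p = p' \<cdot> b" "b' \<cdot> i' = i'' \<cdot> a'" "c' \<cdot> p' = p'' \<cdot> b'"
    using assms by auto
  have 1: "b' \<cdot> (i' \<cdot> a) = i'' \<cdot> (a' \<cdot> a)"
    by (rule Cmp_extend[OF eq(3)]) (use assms D in \<open>auto simp: Hom_iff\<close>)
  have 2: "c' \<cdot> (p' \<cdot> b) = p'' \<cdot> (b' \<cdot> b)"
    by (rule Cmp_extend[OF eq(4)]) (use assms D in \<open>auto simp: Hom_iff\<close>)
  show ?thesis using assms D 1 2 eq by (simp add: Hom_iff)
qed

text \<open>The arrow \<open>p' \<cdot> b\<close> kills \<open>i\<close> because p' i' = 0, hence it
  descends along the cokernel \<open>p\<close>.\<close>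

lemma seq_morphism_mid:
  assumes E: "(i, p) \<in> E" "(i', p') \<in> E"
    and b: "b \<in> Hom C (Trg C i) (Trg C i')" and a: "a \<in> Hom C (Src C i) (Src C i')" "b \<cdot> i = i' \<cdot> a"
  obtains c where "seq_morphism C (i, p) (i', p') a b c"
proof -
  note D = conflationD[OF E(1)] conflationD[OF E(2)]
  have "p' \<cdot> (i' \<cdot> a) = Zer C (Src C i) (Trg C p')"
    using D a Cmp_assoc_Arr[of a i' p'] by (simp add: Hom_iff)
  then have "(p' \<cdot> b) \<cdot> i = Zer C (Src C i) (Trg C p')"
    using D a b by (simp add: Hom_iff)
  then obtain c where "c \<in> Hom C (Trg C p) (Trg C p')" "c \<cdot> p = p' \<cdot> b"
    using cokernel_desc[OF E(1), of "p' \<cdot> b" "Trg C p'"] D b by (auto simp: Hom_iff)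
  then show ?thesis using that[of c] a b by simp
qed

text \<open>Dually, \<open>b \<cdot> i\<close> is killed by \<open>p'\<close> and lifts to the
  kernel \<open>i'\<close>.\<close>

lemma seq_morphism_mid':
  assumes E: "(i, p) \<in> E" "(i', p') \<in> E"
    and b: "b \<in> Hom C (Trg C i) (Trg C i')" and c: "c \<in> Hom C (Trg C p) (Trg C p')" "c \<cdot> p = p' \<cdot> b"
  obtains a where "seq_morphism C (i, p) (i', p') a b c"
proof -
  note D = conflationD[OF E(1)] conflationD[OF E(2)]
  have "p' \<cdot> (b \<cdot> i) = c \<cdot> (p \<cdot> i)"
    by (rule Cmp_extend[OF c(2)[symmetric]]) (use D b c in \<open>auto simp: Hom_iff\<close>)
  then have "p' \<cdot> (b \<cdot> i) = Zer C (Src C i) (Trg C p')"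
    using D b c by (simp add: Hom_iff)
  then obtain a where "a \<in> Hom C (Src C i) (Src C i')" "i' \<cdot> a = b \<cdot> i"
    using kernel_lift[OF E(2), of "b \<cdot> i" "Src C i"] D b by (auto simp: Hom_iff)
  then show ?thesis using that[of a] b c by simp
qed

text \<open>One step of the comparison of injective resolutions: \<open>i' \<cdot> a\<close> extends
  along \<open>i\<close> because it ends in an injective object.\<close>

lemma seq_morphism_injective:
  assumes E: "(i, p) \<in> E" "(i', p') \<in> E"
    and inj: "injective C E (Trg C i')" and a: "a \<in> Hom C (Src C i) (Src C i')"
  obtains b c where "seq_morphism C (i, p) (i', p') a b c"
proof -
  note D = conflationD[OF E(1)] conflationD[OF E(2)]
  have "i' \<cdot> a \<in> Hom C (Src C i) (Trg C i')" using D a by (simp add: Hom_iff)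
  then obtain b where "b \<in> Hom C (Trg C i) (Trg C i')" "b \<cdot> i = i' \<cdot> a"
    using inj E(1) unfolding injective_def by blast
  then show ?thesis using seq_morphism_mid[OF E _ a] that by metis
qed

lemma seq_morphism_projective:
  assumes E: "(i, p) \<in> E" "(i', p') \<in> E"
    and prj: "projective C E (Src C p)" and c: "c \<in> Hom C (Trg C p) (Trg C p')"
  obtains a b where "seq_morphism C (i, p) (i', p') a b c"
proof -
  note D = conflationD[OF E(1)] conflationD[OF E(2)]
  have "c \<cdot> p \<in> Hom C (Src C p) (Trg C p')" using D c by (simp add: Hom_iff)
  then obtain b where "b \<in> Hom C (Src C p) (Src C p')" "p' \<cdot> b = c \<cdot> p"
    using prj E(2) unfolding projective_def by blast
  then show ?thesis using seq_morphism_mid'[OF E _ c, of b] D that by metis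
qed

text \<open>Morphisms of conflations behave like chain maps: the left component is null-homotopic exactly
  if the right one is.\<close>

lemma seq_morphism_left_to_right:
  assumes E: "(i, p) \<in> E" "(i', p') \<in> E" and m: "seq_morphism C (i, p) (i', p') a b c"
    and t: "t \<in> Hom C (Trg C i) (Src C i')" "t \<cdot> i = a"
  obtains u where "u \<in> Hom C (Trg C p) (Src C p')" "p' \<cdot> u = c"
proof -
  note D = conflationD[OF E(1)] conflationD[OF E(2)]
  \<comment> \<open>Once the homotopy \<open>t\<close> is subtracted, the middle arrow kills
    \<open>i\<close>; its factor \<open>u\<close> through \<open>p\<close> is the homotopy on the
    other side.\<close>
  let ?d = "arr_diff b (i' \<cdot> t)"
  have d: "?d \<in> Hom C (Trg C i) (Trg C i')" using D m t by (simp add: Hom_iff)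
  have "?d \<cdot> i = Zer C (Src C i) (Trg C i')"
    using D m t diff_self[of "i' \<cdot> a" "Src C i" "Trg C i'"] by (simp add: Hom_iff)
  from cokernel_desc[OF E(1) d this] obtain u
    where u: "u \<in> Hom C (Trg C p) (Trg C i')" "u \<cdot> p = ?d" .
  have "p' \<cdot> (i' \<cdot> t) = Zer C (Trg C i) (Trg C p')"
    using D t Cmp_assoc_Arr[of t i' p'] by (simp add: Hom_iff)
  then have "p' \<cdot> (u \<cdot> p) = p' \<cdot> b"
    using D m t u diff_Zer[of "p' \<cdot> b" "Trg C i" "Trg C p'"] by (simp add: Hom_iff)
  then have "(p' \<cdot> u) \<cdot> p = c \<cdot> p"
    using D m u by (simp add: Hom_iff)
  from deflation_epi[OF E(1) _ _ this, of "Trg C p'"] have "p' \<cdot> u = c"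
    using D m u by (simp add: Hom_iff)
  then show ?thesis using u that D by simp
qed

lemma seq_morphism_right_to_left:
  assumes E: "(i, p) \<in> E" "(i', p') \<in> E" and m: "seq_morphism C (i, p) (i', p') a b c"
    and u: "u \<in> Hom C (Trg C p) (Src C p')" "p' \<cdot> u = c"
  obtains t where "t \<in> Hom C (Trg C i) (Src C i')" "t \<cdot> i = a"
proof -
  note D = conflationD[OF E(1)] conflationD[OF E(2)]
  \<comment> \<open>Here \<open>b\<close> is corrected by \<open>u \<cdot> p\<close>, so that the
    difference is killed by \<open>p'\<close> and lifts to the kernel \<open>i'\<close>.\<close>
  let ?d = "arr_diff b (u \<cdot> p)"
  have d: "?d \<in> Hom C (Trg C i) (Trg C i')" using D m u by (simp add: Hom_iff)
  have "p' \<cdot> (u \<cdot> p) = p' \<cdot> b"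
    using D m u Cmp_assoc_Arr[of p u p'] by (simp add: Hom_iff)
  then have "p' \<cdot> ?d = Zer C (Trg C i) (Trg C p')"
    using D m u diff_self[of "p' \<cdot> b" "Trg C i" "Trg C p'"] by (simp add: Hom_iff)
  from kernel_lift[OF E(2) d this] obtain t
    where t: "t \<in> Hom C (Trg C i) (Src C i')" "i' \<cdot> t = ?d" .
  have "i' \<cdot> (t \<cdot> i) = ?d \<cdot> i"
    using D t Cmp_assoc_Arr[of i t i'] by (simp add: Hom_iff)
  also have "\<dots> = i' \<cdot> a"
    using D m u diff_Zer[of "i' \<cdot> a" "Src C i" "Trg C i'"] by (simp add: Hom_iff)
  finally have "i' \<cdot> (t \<cdot> i) = i' \<cdot> a" .
  from inflation_mono[OF E(2) _ _ this, of "Src C i"] have "t \<cdot> i = a"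
    using D m t by (simp add: Hom_iff)
  then show ?thesis using t that by simp
qed

text \<open>The axioms only provide some kernel of the pulled back deflation; here it is replaced by one
  with the same source as the given inflation.\<close>

lemma conflation_pullback:
  assumes E: "(i, p) \<in> E" and f: "f \<in> Hom C X (Trg C p)"
  obtains i' p' b where "(i', p') \<in> E" "pullback_square C p f b p'" "b \<cdot> i' = i" "Src C i' = Src C i"
    "seq_morphism C (i', p') (i, p) (Ide C (Src C i)) b f"
proof -
  note D = conflationD[OF E]
  obtain b i0 p' where pb: "pullback_square C p f b p'" and E0: "(i0, p') \<in> E"
    using deflation_pullback[OF E, of f] f by (auto simp: Hom_iff)
  note D0 = conflationD[OF E0]
  have arr: "f \<in> Arr C" "b \<in> Arr C" "Src C f = X" "Trg C f = Trg C p"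
    "Src C b = Trg C i0" "Trg C b = Trg C i" "Trg C p' = X" "p \<cdot> b = f \<cdot> p'"
    using pb f D D0 unfolding pullback_square_def by (auto simp: Hom_iff)
  have X: "X \<in> Obj C" using f by (rule Hom_Obj)
  \<comment> \<open>The wanted inflation has the components \<open>i\<close> and 0, which form a
    cone since \<open>p \<cdot> i\<close> is zero.\<close>
  have "i \<in> Hom C (Src C i) (Src C p)" "Zer C (Src C i) X \<in> Hom C (Src C i) (Src C f)"
    "p \<cdot> i = f \<cdot> Zer C (Src C i) X"
    using D X arr by (auto simp: Hom_iff)
  from pullback_lift[OF pb this] obtain i'
    where i': "i' \<in> Hom C (Src C i) (Src C b)" "b \<cdot> i' = i" "p' \<cdot> i' = Zer C (Src C i) X" .
  have "p \<cdot> (b \<cdot> i0) = f \<cdot> (p' \<cdot> i0)"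
    by (rule Cmp_extend) (use arr D D0 in auto)
  then have "p \<cdot> (b \<cdot> i0) = Zer C (Src C i0) (Trg C p)" using arr D0 by simp
  then obtain a where a: "a \<in> Hom C (Src C i0) (Src C i)" "i \<cdot> a = b \<cdot> i0"
    using kernel_lift[OF E, of "b \<cdot> i0" "Src C i0"] arr D D0 by (auto simp: Hom_iff)
  obtain a' where a': "a' \<in> Hom C (Src C i) (Src C i0)" "i0 \<cdot> a' = i'"
    using kernel_lift[OF E0, of i' "Src C i"] i' arr by auto
  \<comment> \<open>This identity makes \<open>a\<close> and \<open>a'\<close> inverse to each
    other: i0 a' a = i' a = i0 and i a a' = b i0 a' = b i' = i, and \<open>i0\<close> and
    \<open>i\<close> can be cancelled.\<close>
  have i'a: "i' \<cdot> a = i0"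
  proof (rule pullback_unique[OF pb])
    show "i' \<cdot> a \<in> Hom C (Src C i0) (Src C b)" "i0 \<in> Hom C (Src C i0) (Src C b)"
      using i' a arr D0 by (auto simp: Hom_iff)
    show "b \<cdot> (i' \<cdot> a) = b \<cdot> i0"
      using i' a arr Cmp_assoc_Arr[of a i' b] by (simp add: Hom_iff)
    show "p' \<cdot> (i' \<cdot> a) = p' \<cdot> i0"
      using i' a arr D0 X Cmp_assoc_Arr[of a i' p'] by (simp add: Hom_iff)
  qed
  have "i0 \<cdot> (a' \<cdot> a) = i0 \<cdot> Ide C (Src C i0)"
    using a a' i'a D0 Cmp_assoc_Arr[of a a' i0] by (simp add: Hom_iff)
  from inflation_mono[OF E0 _ _ this, of "Src C i0"]
  have 1: "a' \<cdot> a = Ide C (Src C i0)" using a a' D0 by (simp add: Hom_iff)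
  have "i \<cdot> (a \<cdot> a') = (i \<cdot> a) \<cdot> a'"
    by (rule Cmp_assoc_Arr[symmetric]) (use a a' D in \<open>auto simp: Hom_iff\<close>)
  also have "\<dots> = b \<cdot> (i0 \<cdot> a')" using a a' arr D0 by (simp add: Hom_iff)
  also have "\<dots> = i \<cdot> Ide C (Src C i)" using a' i' D by simp
  finally have "i \<cdot> (a \<cdot> a') = i \<cdot> Ide C (Src C i)" .
  from inflation_mono[OF E _ _ this, of "Src C i"]
  have 2: "a \<cdot> a' = Ide C (Src C i)" using a a' D by (simp add: Hom_iff)
  have "seq_morphism C (i0, p') (i', p') a (Ide C (Trg C i0)) (Ide C X)"
    using a i' i'a arr D0 X by (simp add: Hom_iff)
  from iso_closed[OF E0 _ _ _ this is_isoI[OF a(1) a'(1) 1 2] is_iso_Ide is_iso_Ide]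
  have E': "(i', p') \<in> E"
    using X D0 i' arr by (simp add: Hom_iff)
  show ?thesis
    by (rule that[OF E' pb]) (use i' arr D D0 in \<open>auto simp: Hom_iff\<close>)
qed

text \<open>The pushout axiom leaves open which cokernel of \<open>i'\<close> is taken. The arrow
  induced by \<open>p\<close> and 0 is a cokernel with the target of \<open>p\<close>, so that the
  right component of the comparison can be an identity.\<close>

lemma conflation_pushout:
  assumes E: "(i, p) \<in> E" and g: "g \<in> Hom C (Src C i) Y"
  obtains i' p' b where "(i', p') \<in> E" "pushout_square C i g b i'" "p' \<cdot> b = p" "Trg C p' = Trg C p"
    "seq_morphism C (i, p) (i', p') g b (Ide C (Trg C p))"
proof -
  note D = conflationD[OF E]
  obtain b i' p0 where po: "pushout_square C i g b i'" and E0: "(i', p0) \<in> E"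
    using inflation_pushout[OF E, of g] g by (auto simp: Hom_iff)
  note D0 = conflationD[OF E0]
  have arr: "g \<in> Arr C" "b \<in> Arr C" "Trg C g = Y" "Src C g = Src C i"
    "Trg C b = Trg C i'" "Src C b = Trg C i" "Src C i' = Y" "b \<cdot> i = i' \<cdot> g"
    using po g D D0 unfolding pushout_square_def by (auto simp: Hom_iff)
  have Y: "Y \<in> Obj C" using g by (rule Hom_Obj)
  have "p \<in> Hom C (Trg C i) (Trg C p)" "Zer C Y (Trg C p) \<in> Hom C (Trg C g) (Trg C p)"
    "p \<cdot> i = Zer C Y (Trg C p) \<cdot> g"
    using D Y arr by (auto simp: Hom_iff)
  from pushout_desc[OF po this] obtain p'
    where p': "p' \<in> Hom C (Trg C b) (Trg C p)" "p' \<cdot> b = p" "p' \<cdot> i' = Zer C Y (Trg C p)" .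
  have "p0 \<cdot> (i' \<cdot> g) = Zer C (Src C i) (Trg C p0)"
    using Cmp_Zer_extend[OF D0(4)] arr D0 by simp
  then have "(p0 \<cdot> b) \<cdot> i = Zer C (Src C i) (Trg C p0)" using arr D D0 by simp
  then obtain a where a: "a \<in> Hom C (Trg C p) (Trg C p0)" "a \<cdot> p = p0 \<cdot> b"
    using cokernel_desc[OF E, of "p0 \<cdot> b" "Trg C p0"] arr D D0 by (auto simp: Hom_iff)
  obtain a' where a': "a' \<in> Hom C (Trg C p0) (Trg C p)" "a' \<cdot> p0 = p'"
    using cokernel_desc[OF E0, of p' "Trg C p"] p' arr by auto
  have p'a: "a \<cdot> p' = p0"
  proof (rule pushout_unique[OF po])
    show "a \<cdot> p' \<in> Hom C (Trg C b) (Trg C p0)" "p0 \<in> Hom C (Trg C b) (Trg C p0)"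
      using p' a arr D0 by (auto simp: Hom_iff)
    show "(a \<cdot> p') \<cdot> b = p0 \<cdot> b"
      using p' a arr by (simp add: Hom_iff)
    show "(a \<cdot> p') \<cdot> i' = p0 \<cdot> i'"
      using p' a arr D0 Y by (simp add: Hom_iff)
  qed
  have "(a \<cdot> a') \<cdot> p0 = Ide C (Trg C p0) \<cdot> p0"
    using a a' p'a D0 by (simp add: Hom_iff)
  from deflation_epi[OF E0 _ _ this, of "Trg C p0"]
  have 1: "a \<cdot> a' = Ide C (Trg C p0)" using a a' D0 by (simp add: Hom_iff)
  have "(a' \<cdot> a) \<cdot> p = a' \<cdot> (a \<cdot> p)" using a a' D by (simp add: Hom_iff)
  also have "\<dots> = a' \<cdot> (p0 \<cdot> b)" using a by simp
  also have "\<dots> = (a' \<cdot> p0) \<cdot> b"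
    by (rule Cmp_assoc_Arr[symmetric]) (use a' arr D0 in \<open>auto simp: Hom_iff\<close>)
  also have "\<dots> = Ide C (Trg C p) \<cdot> p" using a' p' D by simp
  finally have "(a' \<cdot> a) \<cdot> p = Ide C (Trg C p) \<cdot> p" .
  from deflation_epi[OF E _ _ this, of "Trg C p"]
  have 2: "a' \<cdot> a = Ide C (Trg C p)" using a a' D by (simp add: Hom_iff)
  have "seq_morphism C (i', p0) (i', p') (Ide C Y) (Ide C (Trg C i')) a'"
    using a' p' arr D0 Y by (simp add: Hom_iff)
  from iso_closed[OF E0 _ _ _ this is_iso_Ide is_iso_Ide is_isoI[OF a'(1) a(1) 1 2]]
  have E': "(i', p') \<in> E"
    using Y D0 p' arr by (simp add: Hom_iff)
  show ?thesis
    by (rule that[OF E' po]) (use p' arr D D0 in \<open>auto simp: Hom_iff\<close>)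
qed

end

section \<open>Orthogonality\<close>

context exact_category
begin

lemma conflations_iff: "(i, p) \<in> conflations C E A B \<longleftrightarrow> (i, p) \<in> E \<and> Src C i = B \<and> Trg C p = A"
  by (simp add: conflations_def)

text \<open>Reflexivity of \<open>ext_equiv\<close>, witnessed by three identities, puts the
  representative of a class into that class.\<close>

lemma Ext_class_memE:
  assumes "\<Xi> \<in> Ext C E A B"
  obtains \<xi> where "\<xi> \<in> \<Xi>" "\<Xi> \<subseteq> conflations C E A B"
proof -
  obtain i p where \<xi>: "(i, p) \<in> conflations C E A B" "\<Xi> = ext_equiv C E A B `` {(i, p)}"
    using assms unfolding Ext_def by (auto elim!: quotientE)
  note D = conflationD[of i p]
  have "is_iso C (Ide C (Trg C i))"
    "seq_morphism C (i, p) (i, p) (Ide C B) (Ide C (Trg C i)) (Ide C A)"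
    using \<xi>(1) D is_iso_Ide by (auto simp: conflations_iff Hom_iff)
  then have "(i, p) \<in> \<Xi>" using \<xi> unfolding ext_equiv_def by blast
  moreover have "\<Xi> \<subseteq> conflations C E A B" using \<xi> by (auto simp: ext_equiv_def)
  ultimately show ?thesis using that by blast
qed

lemma Ext_class_of:
  assumes "(i, p) \<in> conflations C E A B"
  obtains \<Xi> where "\<Xi> \<in> Ext C E A B" "(i, p) \<in> \<Xi>"
proof -
  note D = conflationD[of i p]
  have "is_iso C (Ide C (Trg C i))"
    "seq_morphism C (i, p) (i, p) (Ide C B) (Ide C (Trg C i)) (Ide C A)"
    using assms D is_iso_Ide by (auto simp: conflations_iff Hom_iff)
  then have "(i, p) \<in> ext_equiv C E A B `` {(i, p)}"
    using assms unfolding ext_equiv_def by blast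
  moreover have "ext_equiv C E A B `` {(i, p)} \<in> Ext C E A B"
    unfolding Ext_def using assms by (rule quotientI)
  ultimately show ?thesis using that by blast
qed

lemma pullback_squareD:
  assumes "pullback_square C p f f' p'"
  shows "p \<in> Arr C" "f \<in> Arr C" "f' \<in> Arr C" "p' \<in> Arr C" "Trg C p = Trg C f"
    "Src C p' = Src C f'" "Src C p = Trg C f'" "Src C f = Trg C p'" "p \<cdot> f' = f \<cdot> p'"
  using assms unfolding pullback_square_def by auto

lemma pushout_squareD:
  assumes "pushout_square C i f f' i'"
  shows "i \<in> Arr C" "f \<in> Arr C" "f' \<in> Arr C" "i' \<in> Arr C" "Src C i = Src C f"
    "Trg C i' = Trg C f'" "Src C f' = Trg C i" "Src C i' = Trg C f" "f' \<cdot> i = i' \<cdot> f"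
  using assms unfolding pushout_square_def by auto

text \<open>The splitting identifies the middle of \<open>(i', p')\<close> with the sum of its two
  ends, and in these coordinates the arrow between the middles is (t, p). Thus every split
  conflation with matching ends is a pushout along any arrow that extends over
  \<open>i\<close>.\<close>

lemma pushout_split:
  assumes E: "(i, p) \<in> E" "(i', p') \<in> E"
    and t: "t \<in> Hom C (Trg C i) (Src C i')"
    and s: "s \<in> Hom C (Trg C p) (Src C p')" "p' \<cdot> s = Ide C (Trg C p)"
    and X: "Trg C p' = Trg C p"
  shows "pushout_square C i (t \<cdot> i) (Add C (i' \<cdot> t) (s \<cdot> p)) i'"
    and "p' \<cdot> Add C (i' \<cdot> t) (s \<cdot> p) = p"
proof -
  note D = conflationD[OF E(1)] conflationD[OF E(2)]
  let ?b = "Add C (i' \<cdot> t) (s \<cdot> p)"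
  have b: "?b \<in> Hom C (Trg C i) (Trg C i')" using D t s X by (simp add: Hom_iff)
  have "p' \<cdot> (i' \<cdot> t) = Zer C (Trg C i) (Trg C p)"
    using Cmp_Zer_extend[OF D(8)] D t X by (simp add: Hom_iff)
  moreover have "p' \<cdot> (s \<cdot> p) = p"
    using Cmp_assoc_Arr[of p s p'] D s X by (simp add: Hom_iff)
  ultimately show p'b: "p' \<cdot> ?b = p"
    using D t s X by (simp add: Hom_iff)
  \<comment> \<open>The idempotent 1 - s p' projects onto the kernel of \<open>p'\<close> along
    \<open>s\<close>; its factor \<open>r\<close> is the retraction of \<open>i'\<close>.\<close>
  let ?e = "arr_diff (Ide C (Trg C i')) (s \<cdot> p')"
  have e: "?e \<in> Hom C (Trg C i') (Trg C i')" using D s X by (simp add: Hom_iff)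
  have "p' \<cdot> (s \<cdot> p') = p'"
    using Cmp_assoc_Arr[of p' s p'] D s X by (simp add: Hom_iff)
  then have "p' \<cdot> ?e = Zer C (Trg C i') (Trg C p')"
    using D s X diff_self[of p' "Trg C i'" "Trg C p'"] by (simp add: Hom_iff)
  from kernel_lift[OF E(2) e this] obtain r where r: "r \<in> Hom C (Trg C i') (Src C i')" "i' \<cdot> r = ?e" .
  have sp'i': "s \<cdot> (p' \<cdot> i') = Zer C (Src C i') (Trg C i')"
    using D s X by (simp add: Hom_iff)
  have "i' \<cdot> (r \<cdot> i') = ?e \<cdot> i'"
    using Cmp_assoc_Arr[of i' r i'] D r by (simp add: Hom_iff)
  also have "\<dots> = i' \<cdot> Ide C (Src C i')"
    using D s X sp'i' diff_Zer[of i' "Src C i'" "Trg C i'"] by (simp add: Hom_iff)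
  finally have "i' \<cdot> (r \<cdot> i') = i' \<cdot> Ide C (Src C i')" .
  from inflation_mono[OF E(2) _ _ this, of "Src C i'"]
  have ri': "r \<cdot> i' = Ide C (Src C i')" using D r by (simp add: Hom_iff)
  have "i' \<cdot> (r \<cdot> s) = ?e \<cdot> s"
    using Cmp_assoc_Arr[of s r i'] D r s X by (simp add: Hom_iff)
  also have "\<dots> = i' \<cdot> Zer C (Trg C p) (Src C i')"
    using D s X diff_self[of s "Trg C p" "Trg C i'"] by (simp add: Hom_iff)
  finally have "i' \<cdot> (r \<cdot> s) = i' \<cdot> Zer C (Trg C p) (Src C i')" .
  from inflation_mono[OF E(2) _ _ this, of "Trg C p"]
  have rs: "r \<cdot> s = Zer C (Trg C p) (Src C i')" using D r s X by (simp add: Hom_iff)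
  have rb: "r \<cdot> ?b = t"
  proof -
    have "r \<cdot> (i' \<cdot> t) = t"
      using Cmp_assoc_Arr[of t i' r] D r t ri' by (simp add: Hom_iff)
    moreover have "r \<cdot> (s \<cdot> p) = Zer C (Trg C i) (Src C i')"
      using Cmp_Zer_extend[OF rs] D r s X by (simp add: Hom_iff)
    ultimately show ?thesis using D r s t X by (simp add: Hom_iff)
  qed
  show "pushout_square C i (t \<cdot> i) ?b i'"
    unfolding pushout_square_def
  proof (intro conjI ballI impI)
    show "i \<in> Arr C" "t \<cdot> i \<in> Arr C" "?b \<in> Arr C" "i' \<in> Arr C" "Src C i = Src C (t \<cdot> i)"
      "Trg C ?b = Trg C i'" "Src C ?b = Trg C i" "Src C i' = Trg C (t \<cdot> i)"
      using D t b by (auto simp: Hom_iff)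
    show "?b \<cdot> i = i' \<cdot> (t \<cdot> i)"
      using D t s X by (simp add: Hom_iff)
    fix x y assume xy: "x \<in> Arr C" "y \<in> Arr C"
      and h: "Trg C x = Trg C y \<and> Src C x = Trg C i \<and> Src C y = Trg C (t \<cdot> i) \<and> x \<cdot> i = y \<cdot> (t \<cdot> i)"
    have xy': "Src C x = Trg C i" "Src C y = Src C i'" "Trg C y = Trg C x" "y \<cdot> (t \<cdot> i) = x \<cdot> i"
      using h D t by (auto simp: Hom_iff)
    \<comment> \<open>On the kernel the mediating arrow must be \<open>y\<close>; on the complement
      given by \<open>s\<close> it must be the descent of x - y t along \<open>p\<close>.\<close>
    let ?d = "arr_diff x (y \<cdot> t)"
    have "?d \<in> Hom C (Trg C i) (Trg C x)" using xy xy' D t by (simp add: Hom_iff)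
    moreover have "?d \<cdot> i = Zer C (Src C i) (Trg C x)"
      using xy xy' D t diff_self[of "x \<cdot> i" "Src C i" "Trg C x"] by (simp add: Hom_iff)
    ultimately obtain w where w: "w \<in> Hom C (Trg C p) (Trg C x)" "w \<cdot> p = ?d"
      using cokernel_desc[OF E(1)] by blast
    let ?u = "Add C (y \<cdot> r) (w \<cdot> p')"
    show "\<exists>!u. u \<in> Hom C (Trg C ?b) (Trg C x) \<and> u \<cdot> ?b = x \<and> u \<cdot> i' = y"
    proof (rule ex1I[of _ ?u])
      have "?u \<in> Hom C (Trg C ?b) (Trg C x)"
        using D r w xy xy' b X by (simp add: Hom_iff)
      moreover have "?u \<cdot> ?b = Add C (y \<cdot> t) ?d"
        using D r w xy xy' b X rb p'b by (simp add: Hom_iff del: Cmp_Add_Arr)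
      moreover have "Add C (y \<cdot> t) ?d = x"
        using Add_diff_cancel(4)[of x "Trg C i" "Trg C x" "y \<cdot> t"] xy xy' D t by (simp add: Hom_iff)
      moreover have "?u \<cdot> i' = y"
        using D r w xy xy' X ri' by (simp add: Hom_iff)
      ultimately show "?u \<in> Hom C (Trg C ?b) (Trg C x) \<and> ?u \<cdot> ?b = x \<and> ?u \<cdot> i' = y" by simp
      fix v assume v: "v \<in> Hom C (Trg C ?b) (Trg C x) \<and> v \<cdot> ?b = x \<and> v \<cdot> i' = y"
      have vH: "v \<in> Arr C" "Src C v = Trg C i'" "Trg C v = Trg C x"
        using v b by (auto simp: Hom_iff)
      have vb: "v \<cdot> ?b = Add C (y \<cdot> t) ((v \<cdot> s) \<cdot> p)"
        using vH D t s X v Cmp_assoc_Arr[of t i' v] by (simp add: Hom_iff)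
      have "(v \<cdot> s) \<cdot> p = arr_diff (v \<cdot> ?b) (y \<cdot> t)"
        unfolding vb
        using Add_diff_cancel(3)[of "(v \<cdot> s) \<cdot> p" "Trg C i" "Trg C x" "y \<cdot> t"] vH xy xy' D t s X
        by (simp add: Hom_iff)
      then have "(v \<cdot> s) \<cdot> p = w \<cdot> p" using v w by simp
      from deflation_epi[OF E(1) _ _ this, of "Trg C x"]
      have vs: "v \<cdot> s = w" using vH s w X D by (simp add: Hom_iff)
      \<comment> \<open>Since 1 = i' r + s p', the arrow \<open>v\<close> is determined by v i' = y
        and v s = w.\<close>
      have "v \<cdot> ?e = y \<cdot> r"
        using r(2)[symmetric] vH D r v Cmp_assoc_Arr[of r i' v] by (simp add: Hom_iff)
      moreover have "v \<cdot> ?e = arr_diff v (w \<cdot> p')"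
        using vH D s X vs Cmp_assoc_Arr[of p' s v] by (simp add: Hom_iff)
      ultimately have "y \<cdot> r = arr_diff v (w \<cdot> p')" by simp
      then show "v = ?u"
        using Add_diff_cancel(1)[of v "Trg C i'" "Trg C x" "w \<cdot> p'"] vH w D X by (simp add: Hom_iff)
    qed
  qed
qed

text \<open>Vanishing of \<open>ext_map\<close> splits one concrete pushout, and the homotopy
  transfer turns the section into an extension of \<open>g\<close> over the inflation of the
  pullback along \<open>f\<close>. A general \<open>(i', p')\<close> maps to that pullback by the
  universal property, with the left end fixed.\<close>

lemma ext_orthogonalD:
  assumes orth: "ext_orthogonal C E f g" and f: "f \<in> Arr C" and g: "g \<in> Arr C"
    and E: "(i, p) \<in> conflations C E (Trg C f) (Src C g)" "(i', p') \<in> E"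
    and m: "seq_morphism C (i', p') (i, p) (Ide C (Src C g)) b f"
  obtains t where "t \<in> Hom C (Trg C i') (Trg C g)" "t \<cdot> i' = g"
proof -
  have ip: "(i, p) \<in> E" "Src C i = Src C g" "Trg C p = Trg C f" using E by (auto simp: conflations_iff)
  note D = conflationD[OF ip(1)] conflationD[OF E(2)]
  have "f \<in> Hom C (Src C f) (Trg C p)" using ip f by (simp add: Hom_iff)
  from conflation_pullback[OF ip(1) this] obtain i0 p0 b0
    where E0: "(i0, p0) \<in> E" and pb: "pullback_square C p f b0 p0" "b0 \<cdot> i0 = i" "Src C i0 = Src C i"
      and m0: "seq_morphism C (i0, p0) (i, p) (Ide C (Src C i)) b0 f" .
  note D0 = conflationD[OF E0]
  have "g \<in> Hom C (Src C i0) (Trg C g)" using g pb ip by (simp add: Hom_iff)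
  from conflation_pushout[OF E0 this] obtain i1 p1 b1
    where E1: "(i1, p1) \<in> E" and po: "pushout_square C i0 g b1 i1" "p1 \<cdot> b1 = p0" "Trg C p1 = Trg C p0"
      and m1: "seq_morphism C (i0, p0) (i1, p1) g b1 (Ide C (Trg C p0))" .
  note D1 = conflationD[OF E1]
  obtain \<Xi> where \<Xi>: "\<Xi> \<in> Ext C E (Trg C f) (Src C g)" "(i, p) \<in> \<Xi>"
    using Ext_class_of[OF E(1)] .
  have "(i1, p1) \<in> ext_map C E f g \<Xi>"
  proof -
    have "ext_pullback C f (i, p) (i0, p0)" "ext_pushout C g (i0, p0) (i1, p1)"
      using pb po by auto
    then show ?thesis unfolding ext_map_def using \<Xi>(2) E0 E1 by blast
  qed
  then have "(i1, p1) \<in> ext_zero C E (Src C f) (Trg C g)"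
    using orth \<Xi>(1) unfolding ext_orthogonal_def by blast
  then obtain s where s: "s \<in> Hom C (Src C f) (Src C p1)" "p1 \<cdot> s = Ide C (Src C f)"
    unfolding ext_zero_def by auto
  have tp0: "Trg C p0 = Src C f" using pullback_squareD[OF pb(1)] by simp
  from seq_morphism_right_to_left[OF E0 E1 m1, of s] s tp0 obtain t0
    where t0: "t0 \<in> Hom C (Trg C i0) (Src C i1)" "t0 \<cdot> i0 = g" by auto
  have "b \<in> Hom C (Trg C i') (Src C p)" "p' \<in> Hom C (Trg C i') (Src C f)" "p \<cdot> b = f \<cdot> p'"
    using m D ip f by (auto simp: Hom_iff)
  from pullback_lift[OF pb(1) this] obtain u
    where u: "u \<in> Hom C (Trg C i') (Src C b0)" "b0 \<cdot> u = b" "p0 \<cdot> u = p'" .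
  have b0: "b0 \<in> Arr C" "Src C b0 = Trg C i0" using pullback_squareD[OF pb(1)] D0 by auto
  have si': "Src C i' = Src C i0" using m ip pb g by (simp add: Hom_iff)
  have "u \<cdot> i' = i0"
  proof (rule pullback_unique[OF pb(1)])
    show "u \<cdot> i' \<in> Hom C (Src C i0) (Src C b0)" "i0 \<in> Hom C (Src C i0) (Src C b0)"
      using u b0 D D0 si' by (auto simp: Hom_iff)
    show "b0 \<cdot> (u \<cdot> i') = b0 \<cdot> i0"
      using Cmp_assoc_Arr[of i' u b0] u b0 D m pb ip by (simp add: Hom_iff)
    show "p0 \<cdot> (u \<cdot> i') = p0 \<cdot> i0"
      using Cmp_assoc_Arr[of i' u p0] u b0 D D0 m pb ip f tp0 si' by (simp add: Hom_iff)
  qed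
  then have "(t0 \<cdot> u) \<cdot> i' = g"
    using t0 u b0 D by (simp add: Hom_iff)
  moreover have "t0 \<cdot> u \<in> Hom C (Trg C i') (Trg C g)"
    using t0 u b0 D pushout_squareD[OF po(1)] by (simp add: Hom_iff)
  ultimately show ?thesis using that by blast
qed

text \<open>Both inclusions pass through the pullback along \<open>f\<close>: an extension of
  \<open>g\<close> over its inflation splits the pushout along \<open>g\<close>, and by
  \<open>pushout_split\<close> any prescribed split conflation is such a pushout.\<close>

lemma ext_orthogonalI:
  assumes f: "f \<in> Arr C" and g: "g \<in> Arr C"
    and ex: "\<And>i p i' p' b. \<lbrakk>(i, p) \<in> conflations C E (Trg C f) (Src C g); (i', p') \<in> E;
        seq_morphism C (i', p') (i, p) (Ide C (Src C g)) b f\<rbrakk>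
      \<Longrightarrow> \<exists>t \<in> Hom C (Trg C i') (Trg C g). t \<cdot> i' = g"
  shows "ext_orthogonal C E f g"
  unfolding ext_orthogonal_def
proof
  fix \<Xi> assume \<Xi>: "\<Xi> \<in> Ext C E (Trg C f) (Src C g)"
  obtain \<xi> where \<xi>: "\<xi> \<in> \<Xi>" "\<Xi> \<subseteq> conflations C E (Trg C f) (Src C g)"
    using Ext_class_memE[OF \<Xi>] .
  show "ext_map C E f g \<Xi> = ext_zero C E (Src C f) (Trg C g)"
  proof (intro equalityI subsetI)
    fix \<zeta> assume "\<zeta> \<in> ext_map C E f g \<Xi>"
    then obtain i p i0 p0 i1 p1 where \<zeta>: "\<zeta> = (i1, p1)" "(i1, p1) \<in> E" "(i, p) \<in> \<Xi>" "(i0, p0) \<in> E"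
      "ext_pullback C f (i, p) (i0, p0)" "ext_pushout C g (i0, p0) (i1, p1)"
      unfolding ext_map_def by (cases \<zeta>) (auto simp del: ext_pullback.simps ext_pushout.simps)
    have ip: "(i, p) \<in> conflations C E (Trg C f) (Src C g)" using \<zeta> \<xi> by blast
    then have ip': "(i, p) \<in> E" "Src C i = Src C g" "Trg C p = Trg C f"
      by (auto simp: conflations_iff)
    note D = conflationD[OF ip'(1)] conflationD[OF \<zeta>(2)] conflationD[OF \<zeta>(4)]
    obtain b where b: "pullback_square C p f b p0" "b \<cdot> i0 = i" "Src C i0 = Src C i"
      using \<zeta> by auto
    obtain b1 where b1: "pushout_square C i0 g b1 i1" "p1 \<cdot> b1 = p0" "Trg C p1 = Trg C p0"
      using \<zeta> by auto
    note Q = pullback_squareD[OF b(1)] pushout_squareD[OF b1(1)]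
    have "seq_morphism C (i0, p0) (i, p) (Ide C (Src C g)) b f"
      using D Q b ip' by (simp add: Hom_iff)
    then obtain t where t: "t \<in> Hom C (Trg C i0) (Trg C g)" "t \<cdot> i0 = g"
      using ex[OF ip \<zeta>(4)] by blast
    have m1: "seq_morphism C (i0, p0) (i1, p1) g b1 (Ide C (Trg C p0))"
      using D Q b1 by (simp add: Hom_iff)
    from seq_morphism_left_to_right[OF \<zeta>(4,2) m1] t Q
    obtain u where "u \<in> Hom C (Trg C p0) (Src C p1)" "p1 \<cdot> u = Ide C (Trg C p0)" by auto
    then show "\<zeta> \<in> ext_zero C E (Src C f) (Trg C g)"
      using \<zeta> D Q b1 unfolding ext_zero_def by (auto simp: conflations_iff)
  next
    fix \<zeta> assume \<zeta>: "\<zeta> \<in> ext_zero C E (Src C f) (Trg C g)"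
    then obtain i1 p1 s where z: "\<zeta> = (i1, p1)" "(i1, p1) \<in> E" "Src C i1 = Trg C g" "Trg C p1 = Src C f"
      "s \<in> Hom C (Src C f) (Src C p1)" "p1 \<cdot> s = Ide C (Src C f)"
      unfolding ext_zero_def by (auto simp: conflations_iff)
    obtain i p where ip: "\<xi> = (i, p)" "(i, p) \<in> conflations C E (Trg C f) (Src C g)"
      "(i, p) \<in> E" "Src C i = Src C g" "Trg C p = Trg C f"
      using \<xi> by (cases \<xi>) (auto simp: conflations_iff)
    note D = conflationD[OF ip(3)] conflationD[OF z(2)]
    have "f \<in> Hom C (Src C f) (Trg C p)" using ip f by (simp add: Hom_iff)
    from conflation_pullback[OF ip(3) this] obtain i0 p0 b0
      where E0: "(i0, p0) \<in> E" and pb: "pullback_square C p f b0 p0" "b0 \<cdot> i0 = i" "Src C i0 = Src C i"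
        and m0: "seq_morphism C (i0, p0) (i, p) (Ide C (Src C i)) b0 f" .
    note D0 = conflationD[OF E0] pullback_squareD[OF pb(1)]
    from ex[OF ip(2) E0] m0 ip obtain t where t: "t \<in> Hom C (Trg C i0) (Trg C g)" "t \<cdot> i0 = g"
      by auto
    have "s \<in> Hom C (Trg C p0) (Src C p1)" "p1 \<cdot> s = Ide C (Trg C p0)" "Trg C p1 = Trg C p0"
      "t \<in> Hom C (Trg C i0) (Src C i1)"
      using z D0 t by auto
    from pushout_split[OF E0 z(2) this(4,1-3)] t(2)
    have "ext_pushout C g (i0, p0) (i1, p1)" using z D0 by auto
    moreover have "ext_pullback C f \<xi> (i0, p0)" using pb ip(1) by auto
    ultimately show "\<zeta> \<in> ext_map C E f g \<Xi>"
      unfolding ext_map_def using z(1,2) E0 \<xi>(1) by blast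
  qed
qed

end

section \<open>Morphisms factoring through projective objects\<close>

context exact_category
begin

text \<open>One set of arrows in place of the family \<open>Proj\<close>, so that the facts about
  \<open>cat_ideal\<close> apply to it.\<close>

definition null_arr :: "'m set" where
  "null_arr = {f \<in> Arr C. f \<in> Proj C E (Src C f) (Trg C f)}"

lemma Proj_eq_null: "Proj C E A B = null_arr \<inter> Hom C A B"
proof -
  have "Proj C E A B \<subseteq> Hom C A B" unfolding Proj_def by blast
  moreover have "f \<in> Proj C E A B \<longleftrightarrow> f \<in> null_arr" if "f \<in> Hom C A B" for f
    using that by (simp add: null_arr_def Hom_iff)
  ultimately show ?thesis by blast
qed

text \<open>The second leg of the factorization starts in a projective object and so lifts along
  \<open>p\<close>.\<close>

lemma null_factor:
  assumes "f \<in> null_arr" "(i, p) \<in> E" "Trg C p = Trg C f"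
  obtains w where "w \<in> Hom C (Src C f) (Src C p)" "p \<cdot> w = f"
proof -
  note D = conflationD[OF assms(2)]
  obtain P u v where P: "projective C E P" "u \<in> Hom C (Src C f) P" "v \<in> Hom C P (Trg C f)" "v \<cdot> u = f"
    using assms(1) unfolding null_arr_def Proj_def by auto
  have "v \<in> Hom C P (Trg C p)" using P assms by simp
  then obtain v' where v': "v' \<in> Hom C P (Src C p)" "p \<cdot> v' = v"
    using P(1) assms(2) unfolding projective_def by blast
  have "p \<cdot> (v' \<cdot> u) = f"
    using Cmp_assoc_Arr[of u v' p] v' P D by (simp add: Hom_iff)
  moreover have "v' \<cdot> u \<in> Hom C (Src C f) (Src C p)"
    using v' P D by (simp add: Hom_iff)
  ultimately show ?thesis using that by blast
qed

lemma null_through: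
  assumes "projective C E P" "u \<in> Hom C A P" "v \<in> Hom C P B"
  shows "v \<cdot> u \<in> null_arr"
proof -
  have "v \<cdot> u \<in> Hom C A B" using assms by (simp add: Hom_iff)
  then have "v \<cdot> u \<in> Proj C E A B" using assms unfolding Proj_def by blast
  then show ?thesis unfolding Proj_eq_null by blast
qed

end

context frobenius_category
begin

lemma syzygy_conflation_ex:
  assumes "A \<in> Obj C"
  obtains i p where "(i, p) \<in> E" "Trg C p = A" "projective C E (Src C p)"
  using enough_projectives[OF assms] unfolding syzygy_conflation_def by (metis prod.collapse)

lemma null_ideal: "cat_ideal C null_arr"
proof (rule cat_idealI)
  show "null_arr \<subseteq> Arr C" by (auto simp: null_arr_def)
  show "Zer C A B \<in> null_arr" if AB: "A \<in> Obj C" "B \<in> Obj C" for A B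
  proof -
    obtain i p where p: "(i, p) \<in> E" "Trg C p = B" "projective C E (Src C p)"
      using syzygy_conflation_ex[OF AB(2)] .
    note D = conflationD[OF p(1)]
    have "p \<cdot> Zer C A (Src C p) \<in> null_arr"
      by (rule null_through[OF p(3), of _ A _ B]) (use p D AB in \<open>auto simp: Hom_iff\<close>)
    then show ?thesis using p D AB by simp
  qed
  show "arr_diff f g \<in> null_arr"
    if fg: "f \<in> null_arr" "g \<in> null_arr" "f \<in> Hom C A B" "g \<in> Hom C A B" for f g A B
  proof -
    \<comment> \<open>Both arrows are rewritten to factor through the same projective, the source of
      \<open>p\<close>, where the difference of the first legs can be formed.\<close>
    obtain i p where p: "(i, p) \<in> E" "Trg C p = B" "projective C E (Src C p)"
      using syzygy_conflation_ex[of B] Hom_Obj[OF fg(3)] by blast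
    note D = conflationD[OF p(1)]
    have T: "Trg C p = Trg C f" "Trg C p = Trg C g" "Src C f = A" "Src C g = A"
      using fg p by (auto simp: Hom_iff)
    obtain v where v: "v \<in> Hom C (Src C f) (Src C p)" "p \<cdot> v = f"
      by (rule null_factor[OF fg(1) p(1) T(1)])
    obtain w where w: "w \<in> Hom C (Src C g) (Src C p)" "p \<cdot> w = g"
      by (rule null_factor[OF fg(2) p(1) T(2)])
    have vw: "v \<in> Hom C A (Src C p)" "p \<cdot> v = f" "w \<in> Hom C A (Src C p)" "p \<cdot> w = g"
      using v w T by auto
    have "p \<cdot> arr_diff v w \<in> null_arr"
      by (rule null_through[OF p(3), of _ A _ B]) (use p D vw in \<open>auto simp: Hom_iff\<close>)
    moreover have "p \<cdot> arr_diff v w = arr_diff f g"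
      using vw D by (simp add: Hom_iff)
    ultimately show ?thesis by simp
  qed
  show "g \<cdot> f \<in> null_arr" if fg: "f \<in> null_arr" "g \<in> Arr C" "Src C g = Trg C f" for f g
  proof -
    obtain P u v where P: "projective C E P" "u \<in> Hom C (Src C f) P" "v \<in> Hom C P (Trg C f)" "v \<cdot> u = f"
      using fg(1) unfolding null_arr_def Proj_def by auto
    have "(g \<cdot> v) \<cdot> u \<in> null_arr"
      by (rule null_through[OF P(1,2), of _ "Trg C g"]) (use P fg in \<open>auto simp: Hom_iff\<close>)
    then show ?thesis using P fg by (simp add: Hom_iff)
  qed
  show "f \<cdot> g \<in> null_arr" if fg: "f \<in> null_arr" "g \<in> Arr C" "Trg C g = Src C f" for f g
  proof -
    obtain P u v where P: "projective C E P" "u \<in> Hom C (Src C f) P" "v \<in> Hom C P (Trg C f)" "v \<cdot> u = f"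
      using fg(1) unfolding null_arr_def Proj_def by auto
    have "v \<cdot> (u \<cdot> g) \<in> null_arr"
      by (rule null_through[OF P(1), of _ "Src C g" _ "Trg C f"]) (use P fg in \<open>auto simp: Hom_iff\<close>)
    then show ?thesis using Cmp_assoc_Arr[of g u v] P fg by (simp add: Hom_iff)
  qed
qed

lemmas null_Arr = ideal_memD(1)[OF null_ideal]
lemmas null_Cmp = ideal_memD(2)[OF null_ideal]
lemmas Cmp_null = ideal_memD(3)[OF null_ideal]

lemma null_diff:
  assumes "f \<in> null_arr" "g \<in> null_arr" "f \<in> Hom C A B" "g \<in> Hom C A B"
  shows "arr_diff f g \<in> null_arr"
proof -
  have "subgroup (null_arr \<inter> Hom C A B) (hom_group C A B)"
    using null_ideal Hom_Obj[OF assms(3)] unfolding cat_ideal_def by blast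
  then have "inv\<^bsub>hom_group C A B\<^esub> g \<in> null_arr"
    using subgroup.m_inv_closed assms by fastforce
  then show ?thesis
    using ideal_Add[OF null_ideal assms(1) _ assms(3), of "arr_neg g"] assms neg_Hom[OF assms(4)]
    by (simp add: arr_diff_def arr_neg_def Hom_iff)
qed

end

section \<open>Suspensions\<close>

text \<open>The defining equation of \<open>seq_morphism\<close> fires only on explicit pairs,
  whereas a chosen conflation \<open>S A\<close> is an opaque one; the form with projections covers
  both.\<close>

lemma seq_morphism_iff [simp]:
  "seq_morphism C \<xi> \<eta> a b c \<longleftrightarrow>
     a \<in> Hom C (Src C (fst \<xi>)) (Src C (fst \<eta>)) \<and> b \<in> Hom C (Trg C (fst \<xi>)) (Trg C (fst \<eta>)) \<and>
     c \<in> Hom C (Trg C (snd \<xi>)) (Trg C (snd \<eta>)) \<and>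
     b \<cdot>\<^bsub>C\<^esub> fst \<xi> = fst \<eta> \<cdot>\<^bsub>C\<^esub> a \<and> c \<cdot>\<^bsub>C\<^esub> snd \<xi> = snd \<eta> \<cdot>\<^bsub>C\<^esub> b"
  by (cases \<xi>; cases \<eta>) simp

locale frobenius_shift = frobenius_category C E
  for C :: "('o, 'm) addcat" (structure) and E :: "('m \<times> 'm) set" +
  fixes S :: "'o \<Rightarrow> 'm \<times> 'm"
  assumes choice: "cosyzygy_choice C E S"
begin

abbreviation infl :: "'o \<Rightarrow> 'm" where "infl A \<equiv> fst (S A)"
abbreviation defl :: "'o \<Rightarrow> 'm" where "defl A \<equiv> snd (S A)"
abbreviation sh :: "'o \<Rightarrow> 'o" where "sh A \<equiv> Trg C (defl A)"

lemma shift_conflation: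
  assumes "A \<in> Obj C"
  shows "(infl A, defl A) \<in> E" "Src C (infl A) = A"
    "injective C E (Trg C (infl A))" "projective C E (Trg C (infl A))"
proof -
  show *: "(infl A, defl A) \<in> E" "Src C (infl A) = A" "injective C E (Trg C (infl A))"
    using choice assms unfolding cosyzygy_choice_def cosyzygy_conflation_def by auto
  show "projective C E (Trg C (infl A))"
    using projective_iff_injective * conflationD(1)[OF *(1)] by simp
qed

lemma shift_simps [simp]:
  assumes "A \<in> Obj C"
  shows "infl A \<in> Arr C" "defl A \<in> Arr C" "Src C (defl A) = Trg C (infl A)"
    "Src C (infl A) = A" "sh A \<in> Obj C"
  using conflationD[OF shift_conflation(1)[OF assms]] shift_conflation(2)[OF assms] by auto

text \<open>A relation, since the arrow induced on cosyzygies is unique only modulo null arrows: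
  \<open>s\<close> represents the suspension of the class of \<open>g\<close>.\<close>

definition shift_of :: "'m \<Rightarrow> 'm \<Rightarrow> bool" where
  "shift_of g s \<longleftrightarrow> g \<in> Arr C \<and>
    (\<exists>e. seq_morphism C (infl (Src C g), defl (Src C g)) (infl (Trg C g), defl (Trg C g)) g e s)"

lemma shift_ofI:
  assumes "A \<in> Obj C" "B \<in> Obj C" "seq_morphism C (infl A, defl A) (infl B, defl B) g e s"
  shows "shift_of g s"
  using assms unfolding shift_of_def by (auto simp: Hom_iff)

lemma shift_of_Hom:
  assumes "shift_of g s"
  shows "g \<in> Arr C" "s \<in> Hom C (sh (Src C g)) (sh (Trg C g))"
  using assms unfolding shift_of_def by auto

lemma shift_of_ex:
  assumes "g \<in> Arr C"
  obtains s where "shift_of g s"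
proof -
  have "g \<in> Hom C (Src C (infl (Src C g))) (Src C (infl (Trg C g)))"
    using assms by (simp add: Hom_iff)
  from seq_morphism_injective[OF shift_conflation(1) shift_conflation(1) shift_conflation(3) this] assms
  show ?thesis using that unfolding shift_of_def by (metis Src_Trg_Obj)
qed

text \<open>The middle object of the chosen conflation at \<open>A\<close> is also projective, so
  \<open>s\<close> lifts to the middle objects and restricts to the kernels: the suspension is
  full.\<close>

lemma shift_of_full:
  assumes AB: "A \<in> Obj C" "B \<in> Obj C" and s: "s \<in> Hom C (sh A) (sh B)"
  obtains g where "shift_of g s" "g \<in> Hom C A B"
proof -
  have "projective C E (Src C (defl A))" using AB shift_conflation(4) by simp
  from seq_morphism_projective[OF shift_conflation(1)[OF AB(1)] shift_conflation(1)[OF AB(2)] this s]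
  obtain g e where m: "seq_morphism C (infl A, defl A) (infl B, defl B) g e s" .
  then show ?thesis using that[OF shift_ofI[OF AB m]] AB by simp
qed

text \<open>The projective through which g - g' factors is injective, so the factorization extends
  over the chosen inflation at \<open>A\<close>. The difference of the two diagrams is then null on
  the left, hence s - s' lifts to the projective middle object at \<open>B\<close>.\<close>

lemma shift_of_cong:
  assumes g: "g \<in> Hom C A B" "g' \<in> Hom C A B" "arr_diff g g' \<in> null_arr"
    and s: "shift_of g s" "shift_of g' s'"
  shows "arr_diff s s' \<in> null_arr"
proof -
  have AB: "A \<in> Obj C" "B \<in> Obj C" using Hom_Obj[OF g(1)] by auto
  note E = shift_conflation[OF AB(1)] shift_conflation[OF AB(2)]
  note D = conflationD[OF E(1)] conflationD[OF E(5)]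
  obtain e e' where
    m: "seq_morphism C (infl A, defl A) (infl B, defl B) g e s" and
    m': "seq_morphism C (infl A, defl A) (infl B, defl B) g' e' s'"
    using s g unfolding shift_of_def Hom_iff by auto
  have d: "seq_morphism C (infl A, defl A) (infl B, defl B) (arr_diff g g') (arr_diff e e') (arr_diff s s')"
    using m m' D by (simp add: Hom_iff)
  obtain P u v where P: "projective C E P" "u \<in> Hom C A P" "v \<in> Hom C P B" "v \<cdot> u = arr_diff g g'"
    using g unfolding null_arr_def Proj_def by (auto simp: Hom_iff)
  have "injective C E P" using P(1) projective_iff_injective unfolding projective_def by blast
  then obtain u' where u': "u' \<in> Hom C (Trg C (infl A)) P" "u' \<cdot> infl A = u"
    using E(1) P(2) AB unfolding injective_def by fastforce
  have "v \<cdot> u' \<in> Hom C (Trg C (infl A)) (Src C (infl B))" "(v \<cdot> u') \<cdot> infl A = arr_diff g g'"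
    using u' P D AB by (auto simp: Hom_iff)
  from seq_morphism_left_to_right[OF E(1,5) d this] obtain w
    where "w \<in> Hom C (sh A) (Src C (defl B))" "defl B \<cdot> w = arr_diff s s'" .
  then show ?thesis
    using null_through[OF E(8), of w "sh A" "defl B" "sh B"] D by (auto simp: Hom_iff)
qed

lemma ext_orthogonal_iff_null:
  assumes f: "f \<in> Arr C" and s: "shift_of g s"
  shows "ext_orthogonal C E f g \<longleftrightarrow>
    (\<forall>x \<in> Hom C (Trg C f) (sh (Src C g)). s \<cdot> (x \<cdot> f) \<in> null_arr)"
proof -
  obtain e where g: "g \<in> Arr C" and
    ms: "seq_morphism C (infl (Src C g), defl (Src C g)) (infl (Trg C g), defl (Trg C g)) g e s"
    using s unfolding shift_of_def by blast
  let ?A = "Src C g" and ?B = "Trg C g"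
  have AB: "?A \<in> Obj C" "?B \<in> Obj C" using g by auto
  note E = shift_conflation[OF AB(1)] shift_conflation[OF AB(2)]
  note D = conflationD[OF E(1)] conflationD[OF E(5)]
  show ?thesis
  proof (intro iffI ballI)
    fix x assume orth: "ext_orthogonal C E f g" and x: "x \<in> Hom C (Trg C f) (sh ?A)"
    \<comment> \<open>This realizes \<open>x\<close> as the classifying arrow of a conflation that
      ends in \<open>Trg C f\<close>.\<close>
    from conflation_pullback[OF E(1) x] obtain i p b
      where ip: "(i, p) \<in> E" "pullback_square C (defl ?A) x b p" "b \<cdot> i = infl ?A"
        "Src C i = Src C (infl ?A)"
        and m: "seq_morphism C (i, p) (infl ?A, defl ?A) (Ide C (Src C (infl ?A))) b x" .
    have tp: "Trg C p = Trg C f" using pullback_squareD[OF ip(2)] x by (simp add: Hom_iff)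
    have "f \<in> Hom C (Src C f) (Trg C p)" using f tp by (simp add: Hom_iff)
    from conflation_pullback[OF ip(1) this] obtain i0 p0 b0
      where E0: "(i0, p0) \<in> E" "Src C i0 = Src C i"
        and m0: "seq_morphism C (i0, p0) (i, p) (Ide C (Src C i)) b0 f" .
    have c: "(i, p) \<in> conflations C E (Trg C f) ?A"
      using ip tp AB by (simp add: conflations_iff)
    have m0': "seq_morphism C (i0, p0) (i, p) (Ide C ?A) b0 f" using m0 ip AB by simp
    obtain t where t: "t \<in> Hom C (Trg C i0) ?B" "t \<cdot> i0 = g"
      using ext_orthogonalD[OF orth f g c E0(1) m0'] .
    \<comment> \<open>The two pullback diagrams followed by the suspension diagram of
      \<open>g\<close> have left component \<open>g\<close> and right component s x f, so an
      extension of \<open>g\<close> and a lift of s x f are the two sides of one homotopy.\<close>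
    have "seq_morphism C (i0, p0) (infl ?B, defl ?B) (g \<cdot> (Ide C ?A \<cdot> Ide C ?A)) (e \<cdot> (b \<cdot> b0)) (s \<cdot> (x \<cdot> f))"
      using seq_morphism_Cmp[OF E0(1) E(1,5) seq_morphism_Cmp[OF E0(1) ip(1) E(1) m0' m] ms] AB by simp
    then have m1: "seq_morphism C (i0, p0) (infl ?B, defl ?B) g (e \<cdot> (b \<cdot> b0)) (s \<cdot> (x \<cdot> f))"
      using AB g by simp
    from seq_morphism_left_to_right[OF E0(1) E(5) m1] t AB obtain w
      where w: "w \<in> Hom C (Trg C p0) (Src C (defl ?B))" "defl ?B \<cdot> w = s \<cdot> (x \<cdot> f)" by auto
    then show "s \<cdot> (x \<cdot> f) \<in> null_arr"
      using null_through[OF E(8), of w "Trg C p0" "defl ?B" "sh ?B"] D by (auto simp: Hom_iff)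
  next
    assume null: "\<forall>x \<in> Hom C (Trg C f) (sh ?A). s \<cdot> (x \<cdot> f) \<in> null_arr"
    show "ext_orthogonal C E f g"
    proof (rule ext_orthogonalI[OF f g])
      fix i p i' p' b
      assume "(i, p) \<in> conflations C E (Trg C f) ?A" and E0: "(i', p') \<in> E"
        and m0: "seq_morphism C (i', p') (i, p) (Ide C ?A) b f"
      then have ip: "(i, p) \<in> E" "Src C i = ?A" "Trg C p = Trg C f"
        by (auto simp: conflations_iff)
      have "Ide C ?A \<in> Hom C (Src C i) (Src C (infl ?A))" using ip AB by (simp add: Hom_iff)
      \<comment> \<open>A given conflation receives its classifying arrow \<open>x\<close> by
        extending the identity of its left end into the injective middle object.\<close>
      from seq_morphism_injective[OF ip(1) E(1,3) this] obtain c x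
        where m: "seq_morphism C (i, p) (infl ?A, defl ?A) (Ide C ?A) c x" .
      have x: "x \<in> Hom C (Trg C f) (sh ?A)" using m ip by simp
      have "seq_morphism C (i', p') (infl ?B, defl ?B) (g \<cdot> (Ide C ?A \<cdot> Ide C ?A)) (e \<cdot> (c \<cdot> b)) (s \<cdot> (x \<cdot> f))"
        using seq_morphism_Cmp[OF E0 E(1,5) seq_morphism_Cmp[OF E0 ip(1) E(1) m0 m] ms] by simp
      then have m1: "seq_morphism C (i', p') (infl ?B, defl ?B) g (e \<cdot> (c \<cdot> b)) (s \<cdot> (x \<cdot> f))"
        using AB g by simp
      have "s \<cdot> (x \<cdot> f) \<in> null_arr" using null x by blast
      from null_factor[OF this E(5)] m1 obtain w
        where w: "w \<in> Hom C (Trg C p') (Src C (defl ?B))" "defl ?B \<cdot> w = s \<cdot> (x \<cdot> f)"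
        by (auto simp: Hom_iff)
      from seq_morphism_right_to_left[OF E0 E(5) m1 w] AB
      show "\<exists>t \<in> Hom C (Trg C i') ?B. t \<cdot> i' = g" by auto
    qed
  qed
qed

end

section \<open>The stable category\<close>

context frobenius_category
begin

abbreviation stab :: "'m \<Rightarrow> 'm set" (\<open>\<pi>\<close>) where "\<pi> \<equiv> stable_map C E"
abbreviation stable_cat :: "('o, 'm set) addcat" (\<open>\<D>\<close>) where "\<D> \<equiv> stable_category C E"

section \<open>Cosets modulo null arrows\<close>

lemma Proj_normal:
  assumes "A \<in> Obj C" "B \<in> Obj C"
  shows "Proj C E A B \<lhd> hom_group C A B"
proof -
  interpret comm_group "hom_group C A B" using assms by (rule Hom_comm_group)
  show ?thesis
    using subgroup_imp_normal[of "Proj C E A B"] null_ideal assms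
    unfolding Proj_eq_null cat_ideal_def by blast
qed

lemma stable_self: "f \<in> Arr C \<Longrightarrow> f \<in> \<pi> f"
  unfolding stable_map_def
  by (rule group.rcos_self[OF Hom_group(2) _ normal_imp_subgroup[OF Proj_normal], of f])
    (auto simp: hom_group_simps Hom_iff)

lemma mem_stable:
  assumes "f \<in> Hom C A B"
  shows "f' \<in> \<pi> f \<longleftrightarrow> f' \<in> Hom C A B \<and> arr_diff f' f \<in> null_arr"
proof -
  have [simp]: "Src C f = A" "Trg C f = B" using assms by (auto simp: Hom_iff)
  have "f' \<in> \<pi> f \<longleftrightarrow> (\<exists>h. h \<in> null_arr \<and> h \<in> Hom C A B \<and> f' = Add C h f)"
    by (auto simp: stable_map_def r_coset_def Proj_eq_null hom_group_simps)
  also have "\<dots> \<longleftrightarrow> f' \<in> Hom C A B \<and> arr_diff f' f \<in> null_arr"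
    using assms Add_Hom diff_Hom Add_diff_cancel by metis
  finally show ?thesis .
qed

lemma stable_eq_iff:
  assumes "f \<in> Hom C A B" "f' \<in> Hom C A B"
  shows "\<pi> f = \<pi> f' \<longleftrightarrow> arr_diff f f' \<in> null_arr"
proof
  assume "\<pi> f = \<pi> f'"
  then show "arr_diff f f' \<in> null_arr"
    using stable_self[of f] assms mem_stable[OF assms(2)] by (simp add: Hom_iff)
next
  assume "arr_diff f f' \<in> null_arr"
  then have "f \<in> \<pi> f'" using assms mem_stable[OF assms(2)] by blast
  then show "\<pi> f = \<pi> f'"
    using group.repr_independence[OF Hom_group(2)[OF assms(1)], of f "Proj C E A B" f']
      normal_imp_subgroup[OF Proj_normal] Hom_Obj[OF assms(1)] assms
    by (simp add: stable_map_def hom_group_simps Hom_iff)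
qed

lemma stable_eq_Zer_iff:
  assumes "f \<in> Hom C A B"
  shows "\<pi> f = \<pi> (Zer C A B) \<longleftrightarrow> f \<in> null_arr"
  using stable_eq_iff[OF assms Zer_Hom] diff_Zer[OF assms] Hom_Obj[OF assms] by simp

text \<open>The unit of the factor group is the subgroup \<open>Proj\<close> itself, which is the
  coset of the zero arrow.\<close>

lemma stable_Zer:
  assumes "A \<in> Obj C" "B \<in> Obj C"
  shows "Zer \<D> A B = \<pi> (Zer C A B)"
proof -
  interpret group "hom_group C A B" using assms Hom_comm_group comm_group.axioms(2) by blast
  have "subgroup (Proj C E A B) (hom_group C A B)"
    using normal_imp_subgroup[OF Proj_normal] assms by blast
  from coset_join2[OF _ this, of "Zer C A B"] subgroup.one_closed[OF this]
  show ?thesis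
    using assms Zer_Hom
    by (simp add: stable_category_def stable_hom_group_def FactGroup_def stable_map_def hom_group_simps)
qed

lemma stable_Src_Trg [simp]:
  assumes "f \<in> Arr C"
  shows "Src \<D> (\<pi> f) = Src C f" "Trg \<D> (\<pi> f) = Trg C f"
proof -
  have f: "f \<in> Hom C (Src C f) (Trg C f)" using assms by (simp add: Hom_iff)
  have "Src C ` \<pi> f = {Src C f}" "Trg C ` \<pi> f = {Trg C f}"
    using stable_self[OF assms] mem_stable[OF f] by (auto simp: Hom_iff)
  then show "Src \<D> (\<pi> f) = Src C f" "Trg \<D> (\<pi> f) = Trg C f"
    by (simp_all add: stable_category_def)
qed

lemma stable_Obj [simp]: "Obj \<D> = Obj C"
  by (simp add: stable_category_def)

lemma stable_Ide: "Ide \<D> A = \<pi> (Ide C A)"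
  by (simp add: stable_category_def)

lemma stable_carrier: "carrier (stable_hom_group C E A B) = \<pi> ` Hom C A B"
  by (auto simp: stable_hom_group_def FactGroup_def RCOSETS_def hom_group_simps stable_map_def Hom_iff)

lemma stable_Arr: "Arr \<D> = \<pi> ` Arr C"
proof -
  have "Arr \<D> = (\<Union>A \<in> Obj C. \<Union>B \<in> Obj C. \<pi> ` Hom C A B)"
    by (simp add: stable_category_def stable_carrier)
  also have "\<dots> = \<pi> ` Arr C"
  proof (intro equalityI subsetI)
    fix F assume "F \<in> \<pi> ` Arr C"
    then obtain f where "f \<in> Arr C" "F = \<pi> f" by blast
    then show "F \<in> (\<Union>A \<in> Obj C. \<Union>B \<in> Obj C. \<pi> ` Hom C A B)"
      by (intro UN_I[of "Src C f"] UN_I[of "Trg C f"] image_eqI[of _ _ f]) (auto simp: Hom_iff)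
  qed (auto simp: Hom_iff)
  finally show ?thesis .
qed

lemma stable_HomI: "f \<in> Hom C A B \<Longrightarrow> \<pi> f \<in> Hom \<D> A B"
  by (auto simp: Hom_def stable_Arr)

lemma stable_HomE:
  assumes "F \<in> Hom \<D> A B"
  obtains f where "f \<in> Hom C A B" "F = \<pi> f"
proof -
  obtain f where "f \<in> Arr C" "F = \<pi> f" using assms by (auto simp: Hom_def stable_Arr)
  then show ?thesis using that[of f] assms by (auto simp: Hom_def)
qed

text \<open>The definition applies \<open>the_elem\<close> to the composites of all representatives,
  so the content is independence of them: replace \<open>f'\<close> by \<open>f\<close> and then
  \<open>g'\<close> by \<open>g\<close>, each time changing the composite by a null arrow.\<close>

lemma stable_Cmp:
  assumes f: "f \<in> Hom C A B" and g: "g \<in> Hom C B D"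
  shows "\<pi> g \<cdot>\<^bsub>\<D>\<^esub> \<pi> f = \<pi> (g \<cdot> f)"
proof -
  have const: "\<pi> (g' \<cdot> f') = \<pi> (g \<cdot> f)" if "g' \<in> \<pi> g" "f' \<in> \<pi> f" for g' f'
  proof -
    have h: "f' \<in> Hom C A B" "arr_diff f' f \<in> null_arr" "g' \<in> Hom C B D" "arr_diff g' g \<in> null_arr"
      using that mem_stable[OF f] mem_stable[OF g] by auto
    have 1: "g' \<cdot> f' \<in> Hom C A D" "g' \<cdot> f \<in> Hom C A D" "g \<cdot> f \<in> Hom C A D"
      using f g h by (auto simp: Hom_iff)
    have "g' \<cdot> arr_diff f' f \<in> null_arr"
      by (rule null_Cmp) (use f h in \<open>auto simp: Hom_iff\<close>)
    moreover have "arr_diff g' g \<cdot> f \<in> null_arr"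
      by (rule Cmp_null) (use f g h in \<open>auto simp: Hom_iff\<close>)
    ultimately have "\<pi> (g' \<cdot> f') = \<pi> (g' \<cdot> f)" "\<pi> (g' \<cdot> f) = \<pi> (g \<cdot> f)"
      using 1 stable_eq_iff[of _ A D] f g h by (auto simp: Hom_iff)
    then show ?thesis by simp
  qed
  have self: "g \<in> \<pi> g" "f \<in> \<pi> f" using f g stable_self by (auto simp: Hom_iff)
  have "(\<lambda>(g, f). \<pi> (g \<cdot> f)) ` (\<pi> g \<times> \<pi> f) = {\<pi> (g \<cdot> f)}"
  proof (intro equalityI subsetI)
    fix F assume "F \<in> (\<lambda>(g, f). \<pi> (g \<cdot> f)) ` (\<pi> g \<times> \<pi> f)"
    then obtain g' f' where "g' \<in> \<pi> g" "f' \<in> \<pi> f" "F = \<pi> (g' \<cdot> f')" by blast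
    then show "F \<in> {\<pi> (g \<cdot> f)}" using const[of g' f'] by blast
  next
    fix F assume "F \<in> {\<pi> (g \<cdot> f)}"
    then show "F \<in> (\<lambda>(g, f). \<pi> (g \<cdot> f)) ` (\<pi> g \<times> \<pi> f)"
      using self by (intro image_eqI[of _ _ "(g, f)"]) auto
  qed
  then show ?thesis by (simp add: stable_category_def)
qed

lemma stable_Add:
  assumes f: "f \<in> Hom C A B" and g: "g \<in> Hom C A B"
  shows "Add \<D> (\<pi> f) (\<pi> g) = \<pi> (Add C f g)"
proof -
  have fg: "Add C f g \<in> Hom C A B" using assms by (rule Add_Hom)
  have "Add \<D> (\<pi> f) (\<pi> g) = mult (stable_hom_group C E (Src \<D> (\<pi> f)) (Trg \<D> (\<pi> f))) (\<pi> f) (\<pi> g)"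
    by (simp add: stable_category_def)
  also have "\<dots> = \<pi> f <#>\<^bsub>hom_group C A B\<^esub> \<pi> g"
    using f by (simp add: stable_hom_group_def FactGroup_def Hom_iff)
  also have "\<dots> = \<pi> (Add C f g)"
    using normal.rcos_sum[OF Proj_normal, of A B f g] f g fg Hom_Obj[OF f]
    by (simp add: stable_map_def hom_group_simps Hom_iff)
  finally show ?thesis .
qed

text \<open>The ambient group for the subgroup test in \<open>stable_ideal\<close>; each law is
  inherited from representatives.\<close>

lemma stable_Hom_comm_group:
  assumes "A \<in> Obj C" "B \<in> Obj C"
  shows "comm_group (hom_group \<D> A B)"
proof (rule comm_groupI)
  fix F G assume "F \<in> carrier (hom_group \<D> A B)" "G \<in> carrier (hom_group \<D> A B)"
  then obtain f g where fg: "f \<in> Hom C A B" "F = \<pi> f" "g \<in> Hom C A B" "G = \<pi> g"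
    by (auto simp: hom_group_def elim!: stable_HomE)
  show "F \<otimes>\<^bsub>hom_group \<D> A B\<^esub> G \<in> carrier (hom_group \<D> A B)"
    using fg by (simp add: hom_group_def stable_Add stable_HomI Add_Hom)
  show "F \<otimes>\<^bsub>hom_group \<D> A B\<^esub> G = G \<otimes>\<^bsub>hom_group \<D> A B\<^esub> F"
    using fg by (simp add: hom_group_def stable_Add Add_comm)
  fix H assume "H \<in> carrier (hom_group \<D> A B)"
  then obtain h where h: "h \<in> Hom C A B" "H = \<pi> h"
    by (auto simp: hom_group_def elim!: stable_HomE)
  show "F \<otimes>\<^bsub>hom_group \<D> A B\<^esub> G \<otimes>\<^bsub>hom_group \<D> A B\<^esub> H =
      F \<otimes>\<^bsub>hom_group \<D> A B\<^esub> (G \<otimes>\<^bsub>hom_group \<D> A B\<^esub> H)"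
    using fg h Add_Hom[OF fg(1,3)] Add_Hom[OF fg(3) h(1)] Add_assoc[OF fg(1,3) h(1)]
    by (simp add: hom_group_def stable_Add)
next
  show "\<one>\<^bsub>hom_group \<D> A B\<^esub> \<in> carrier (hom_group \<D> A B)"
    using assms by (simp add: hom_group_def stable_Zer stable_HomI Zer_Hom)
  fix F assume "F \<in> carrier (hom_group \<D> A B)"
  then obtain f where f: "f \<in> Hom C A B" "F = \<pi> f"
    by (auto simp: hom_group_def elim!: stable_HomE)
  show "\<one>\<^bsub>hom_group \<D> A B\<^esub> \<otimes>\<^bsub>hom_group \<D> A B\<^esub> F = F"
    using assms f stable_Add[OF Zer_Hom f(1)] Add_Zer(2)[OF f(1)]
    by (simp add: hom_group_def stable_Zer)
  show "\<exists>G\<in>carrier (hom_group \<D> A B). G \<otimes>\<^bsub>hom_group \<D> A B\<^esub> F = \<one>\<^bsub>hom_group \<D> A B\<^esub>"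
    using assms f stable_Add[OF neg_Hom[OF f(1)] f(1)] neg_Hom[OF f(1)] Add_neg[OF f(1)]
      Add_comm[OF f(1) neg_Hom[OF f(1)]]
    by (intro bexI[of _ "\<pi> (arr_neg f)"]) (auto simp: hom_group_def stable_Zer stable_HomI)
qed

lemma stable_ideal:
  assumes K: "cat_ideal C K"
  shows "cat_ideal \<D> (\<pi> ` K)"
proof -
  have KA: "f \<in> Arr C" if "f \<in> K" for f using ideal_memD(1)[OF K that] .
  have "subgroup (\<pi> ` K \<inter> Hom \<D> A B) (hom_group \<D> A B)" if AB: "A \<in> Obj C" "B \<in> Obj C" for A B
  proof -
    interpret G: comm_group "hom_group \<D> A B" using AB by (rule stable_Hom_comm_group)
    \<comment> \<open>A coset has the source and target of its representatives, so an image lying in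
      this Hom set comes from a member of \<open>K\<close> with the right ends.\<close>
    have rep: "\<exists>f. f \<in> K \<and> f \<in> Hom C A B \<and> F = \<pi> f" if "F \<in> \<pi> ` K \<inter> Hom \<D> A B" for F
      using that KA by (auto simp: Hom_def)
    show ?thesis
    proof (rule G.subgroupI)
      show "\<pi> ` K \<inter> Hom \<D> A B \<subseteq> carrier (hom_group \<D> A B)"
        by (simp add: hom_group_def)
      show "\<pi> ` K \<inter> Hom \<D> A B \<noteq> {}"
        using ideal_Zer[OF K AB] stable_HomI[OF Zer_Hom[OF AB]] by blast
      fix F assume F: "F \<in> \<pi> ` K \<inter> Hom \<D> A B"
      then obtain f where f: "f \<in> K" "f \<in> Hom C A B" "F = \<pi> f" using rep by blast
      have neg: "arr_neg f \<in> Hom C A B" using neg_Hom f by blast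
      have "subgroup (K \<inter> Hom C A B) (hom_group C A B)"
        using K AB unfolding cat_ideal_def by blast
      from subgroup.m_inv_closed[OF this, of f] f
      have negK: "arr_neg f \<in> K" by (simp add: arr_neg_def Hom_iff)
      have "inv\<^bsub>hom_group \<D> A B\<^esub> F = \<pi> (arr_neg f)"
      proof (rule G.inv_equality)
        show "\<pi> (arr_neg f) \<otimes>\<^bsub>hom_group \<D> A B\<^esub> F = \<one>\<^bsub>hom_group \<D> A B\<^esub>"
          using AB f neg Add_neg[OF f(2)] Add_comm[OF f(2) neg]
          by (simp add: hom_group_def stable_Add stable_Zer)
      qed (use f neg in \<open>auto simp: hom_group_def stable_HomI\<close>)
      then show "inv\<^bsub>hom_group \<D> A B\<^esub> F \<in> \<pi> ` K \<inter> Hom \<D> A B"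
        using negK neg stable_HomI by auto
      fix H assume "H \<in> \<pi> ` K \<inter> Hom \<D> A B"
      then obtain h where h: "h \<in> K" "h \<in> Hom C A B" "H = \<pi> h" using rep by blast
      show "F \<otimes>\<^bsub>hom_group \<D> A B\<^esub> H \<in> \<pi> ` K \<inter> Hom \<D> A B"
        using f h ideal_Add[OF K f(1) h(1) f(2) h(2)] stable_HomI[OF Add_Hom[OF f(2) h(2)]]
        by (auto simp: hom_group_def stable_Add)
    qed
  qed
  moreover have "G \<cdot>\<^bsub>\<D>\<^esub> F \<in> \<pi> ` K"
    if FG: "F \<in> \<pi> ` K" "G \<in> Arr \<D>" "Src \<D> G = Trg \<D> F" for F G
  proof -
    obtain f g where fg: "f \<in> K" "F = \<pi> f" "g \<in> Arr C" "G = \<pi> g"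
      using FG by (auto simp: stable_Arr)
    then have "Src C g = Trg C f" using FG KA by simp
    then show ?thesis
      using fg KA[OF fg(1)] ideal_memD(2)[OF K fg(1,3)] stable_Cmp[of f "Src C f" "Trg C f" g "Trg C g"]
      by (simp add: Hom_iff)
  qed
  moreover have "F \<cdot>\<^bsub>\<D>\<^esub> G \<in> \<pi> ` K"
    if FG: "F \<in> \<pi> ` K" "G \<in> Arr \<D>" "Trg \<D> G = Src \<D> F" for F G
  proof -
    obtain f g where fg: "f \<in> K" "F = \<pi> f" "g \<in> Arr C" "G = \<pi> g"
      using FG by (auto simp: stable_Arr)
    then have "Trg C g = Src C f" using FG KA by simp
    then show ?thesis
      using fg KA[OF fg(1)] ideal_memD(3)[OF K fg(1,3)] stable_Cmp[of g "Src C g" "Src C f" f "Trg C f"]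
      by (simp add: Hom_iff)
  qed
  ultimately show ?thesis
    unfolding cat_ideal_def using KA by (auto simp: stable_Arr)
qed

lemma stable_isoI:
  assumes "a \<in> Hom C A B" "a' \<in> Hom C B A"
    and "arr_diff (a' \<cdot> a) (Ide C A) \<in> null_arr" "arr_diff (a \<cdot> a') (Ide C B) \<in> null_arr"
  shows "is_iso \<D> (\<pi> a)"
proof -
  have "\<pi> (a' \<cdot> a) = \<pi> (Ide C A)" "\<pi> (a \<cdot> a') = \<pi> (Ide C B)"
    using assms stable_eq_iff[of "a' \<cdot> a" A A] stable_eq_iff[of "a \<cdot> a'" B B] Ide_Hom Hom_Obj[OF assms(1)]
      Cmp_Hom by blast+
  then show ?thesis
    unfolding is_iso_def using assms stable_HomI[OF assms(2)] stable_HomI[OF assms(1)]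
      stable_Cmp[OF assms(1,2)] stable_Cmp[OF assms(2,1)]
    by (auto simp: Hom_iff stable_Ide stable_Arr intro!: bexI[of _ "\<pi> a'"])
qed

lemma stable_iso_Ide: "A \<in> Obj C \<Longrightarrow> is_iso \<D> (\<pi> (Ide C A))"
  using stable_isoI[of "Ide C A" A A "Ide C A"] diff_self[of "Ide C A" A A] ideal_Zer[OF null_ideal]
  by (simp add: Ide_Hom)

text \<open>Applied to a composite of comparison morphisms, this shows that syzygy conflations with the
  same left end have stably isomorphic right ends.\<close>

lemma stable_identity_right:
  assumes E: "(i, p) \<in> E" "projective C E (Src C p)"
    and m: "seq_morphism C (i, p) (i, p) (Ide C (Src C i)) b c"
  shows "arr_diff c (Ide C (Trg C p)) \<in> null_arr"
proof -
  note D = conflationD[OF E(1)]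
  let ?A = "Src C i"
  have z: "arr_diff (Ide C ?A) (Ide C ?A) = Zer C ?A ?A" using D diff_self Ide_Hom by simp
  \<comment> \<open>Subtracting the identity morphism leaves 0 on the left, which extends over
    \<open>i\<close> by 0; the difference on the right then factors through the projective source of
    \<open>p\<close>.\<close>
  have "seq_morphism C (i, p) (i, p) (Zer C ?A ?A) (arr_diff b (Ide C (Trg C i))) (arr_diff c (Ide C (Trg C p)))"
    using m D z diff_self[of i ?A "Trg C i"] by (simp add: Hom_iff)
  from seq_morphism_left_to_right[OF E(1,1) this, of "Zer C (Trg C i) ?A"] D
  obtain u where "u \<in> Hom C (Trg C p) (Src C p)" "p \<cdot> u = arr_diff c (Ide C (Trg C p))"
    by (auto simp: Hom_iff)
  then show ?thesis
    using null_through[OF E(2), of u "Trg C p" p "Trg C p"] D by (simp add: Hom_iff)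
qed

end

section \<open>Suspension and triangles in the stable category\<close>

context frobenius_shift
begin

text \<open>The set under \<open>the_elem\<close> ranges over all members of the coset and all
  comparison diagrams; \<open>shift_of_cong\<close> collapses it to one class.\<close>

lemma shift_arr_stable:
  assumes s: "shift_of g s"
  shows "shift_arr C E S (\<pi> g) = \<pi> s"
proof -
  have g: "g \<in> Hom C (Src C g) (Trg C g)" using shift_of_Hom[OF s] by (simp add: Hom_iff)
  have "\<pi> s' = \<pi> s"
    if h: "f \<in> \<pi> g" "seq_morphism C (S (Src C f)) (S (Trg C f)) f e s'" for f e s'
  proof -
    have f: "f \<in> Hom C (Src C g) (Trg C g)" "arr_diff f g \<in> null_arr"
      using h mem_stable[OF g] by auto
    have s': "shift_of f s'" using h(2) f unfolding shift_of_def by (auto simp: Hom_iff)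
    have "arr_diff s' s \<in> null_arr" using shift_of_cong[OF f(1) g f(2) s' s] .
    then show ?thesis
      using stable_eq_iff[of s' _ _ s] shift_of_Hom(2)[OF s] shift_of_Hom(2)[OF s'] f(1)
      by (simp add: Hom_iff)
  qed
  moreover have "\<exists>e. seq_morphism C (S (Src C g)) (S (Trg C g)) g e s"
    using s unfolding shift_of_def by (auto simp: Hom_iff)
  ultimately have "{\<pi> s' | f e s'. f \<in> \<pi> g \<and> seq_morphism C (S (Src C f)) (S (Trg C f)) f e s'} = {\<pi> s}"
    using stable_self[OF shift_of_Hom(1)[OF s]] by blast
  then show ?thesis unfolding shift_arr_def by simp
qed

lemma shift_of_Ide: "A \<in> Obj C \<Longrightarrow> shift_of (Ide C A) (Ide C (sh A))"
  by (rule shift_ofI[of A A _ "Ide C (Trg C (infl A))"]) (auto simp: Hom_iff)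

text \<open>The standard triangle on a representative is distinguished with identities as the
  comparison isomorphisms; \<open>shift_of_Ide\<close> computes the suspension of the first of
  them.\<close>

lemma weak_conflation_ex:
  assumes "U \<in> Arr \<D>"
  shows "\<exists>V. (U, V) \<in> weak_conflations C E S"
proof -
  obtain f where f: "f \<in> Arr C" "U = \<pi> f" using assms by (auto simp: stable_Arr)
  let ?A = "Src C f" and ?B = "Trg C f"
  have AB: "?A \<in> Obj C" "?B \<in> Obj C" using f by auto
  have "f \<in> Hom C (Src C (infl ?A)) ?B" using f AB by (simp add: Hom_iff)
  from conflation_pushout[OF shift_conflation(1)[OF AB(1)] this] obtain g h e
    where gh: "(g, h) \<in> E" "pushout_square C (infl ?A) f e g" "h \<cdot> e = defl ?A" "Trg C h = sh ?A" .
  note D = conflationD[OF gh(1)] pushout_squareD[OF gh(2)]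
  have st: "standard_triangle C S f g h"
    unfolding standard_triangle_def shift_obj_def
    using gh D f by (auto simp: Hom_iff intro!: exI[of _ e])
  have M: "Trg C g \<in> Obj C" using D by simp
  have gH: "g \<in> Hom C ?B (Trg C g)" and hH: "h \<in> Hom C (Trg C g) (sh ?A)" and fH: "f \<in> Hom C ?A ?B"
    using D gh f by (auto simp: Hom_iff)
  note I = Ide_Hom[OF AB(1)] Ide_Hom[OF AB(2)] Ide_Hom[OF M]
  have sA: "shift_arr C E S (\<pi> (Ide C ?A)) = \<pi> (Ide C (sh ?A))"
    using shift_arr_stable[OF shift_of_Ide] AB by simp
  have eqs: "\<pi> (Ide C ?B) \<cdot>\<^bsub>\<D>\<^esub> \<pi> f = \<pi> f \<cdot>\<^bsub>\<D>\<^esub> \<pi> (Ide C ?A)"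
    "\<pi> (Ide C (Trg C g)) \<cdot>\<^bsub>\<D>\<^esub> \<pi> g = \<pi> g \<cdot>\<^bsub>\<D>\<^esub> \<pi> (Ide C ?B)"
    "\<pi> (Ide C (sh ?A)) \<cdot>\<^bsub>\<D>\<^esub> \<pi> h = \<pi> h \<cdot>\<^bsub>\<D>\<^esub> \<pi> (Ide C (Trg C g))"
    using stable_Cmp[OF fH I(2)] stable_Cmp[OF I(1) fH] stable_Cmp[OF gH I(3)] stable_Cmp[OF I(2) gH]
      stable_Cmp[OF hH Ide_Hom] stable_Cmp[OF I(3) hH] AB f D gh by auto
  have "distinguished_triangle C E S (\<pi> f) (\<pi> g) (\<pi> h)"
    unfolding distinguished_triangle_def Let_def
  proof (intro conjI)
    show "\<pi> f \<in> Arr \<D>" using f by (simp add: stable_Arr)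
    show "\<pi> g \<in> Hom \<D> (Trg \<D> (\<pi> f)) (Src \<D> (\<pi> h))"
      "\<pi> h \<in> Hom \<D> (Trg \<D> (\<pi> g)) (shift_obj C S (Src \<D> (\<pi> f)))"
      using stable_HomI[OF gH] stable_HomI[OF hH] f D by (simp_all add: shift_obj_def)
    show "\<exists>f' g' h'. standard_triangle C S f' g' h' \<and>
        (\<exists>a\<in>Hom \<D> (Src \<D> (\<pi> f)) (Src C f'). \<exists>b\<in>Hom \<D> (Trg \<D> (\<pi> f)) (Trg C f').
           \<exists>c\<in>Hom \<D> (Trg \<D> (\<pi> g)) (Trg C g'). is_iso \<D> a \<and> is_iso \<D> b \<and> is_iso \<D> c \<and>
             b \<cdot>\<^bsub>\<D>\<^esub> \<pi> f = \<pi> f' \<cdot>\<^bsub>\<D>\<^esub> a \<and> c \<cdot>\<^bsub>\<D>\<^esub> \<pi> g = \<pi> g' \<cdot>\<^bsub>\<D>\<^esub> b \<and>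
             shift_arr C E S a \<cdot>\<^bsub>\<D>\<^esub> \<pi> h = \<pi> h' \<cdot>\<^bsub>\<D>\<^esub> c)"
      by (rule exI[of _ f], rule exI[of _ g], rule exI[of _ h], rule conjI[OF st],
          rule bexI[of _ "\<pi> (Ide C ?A)"], rule bexI[of _ "\<pi> (Ide C ?B)"],
          rule bexI[of _ "\<pi> (Ide C (Trg C g))"])
        (use eqs sA stable_iso_Ide AB M f D I in \<open>auto simp: stable_HomI\<close>)
  qed
  then show ?thesis using f unfolding weak_conflations_def by auto
qed

text \<open>\<open>A\<close> is a syzygy of \<open>Y\<close>: the syzygy conflation and the chosen
  one both start in \<open>A\<close> and have injective middle objects, so the identity of
  \<open>A\<close> extends in both directions, and the two composites are stable identities on the
  right ends.\<close>

lemma shift_essentially_surjective: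
  assumes Y: "Y \<in> Obj C"
  obtains A a a' where "A \<in> Obj C" "a \<in> Hom C Y (sh A)" "a' \<in> Hom C (sh A) Y"
    "arr_diff (a' \<cdot> a) (Ide C Y) \<in> null_arr" "arr_diff (a \<cdot> a') (Ide C (sh A)) \<in> null_arr"
proof -
  obtain k p where E: "(k, p) \<in> E" "Trg C p = Y" "projective C E (Src C p)"
    using syzygy_conflation_ex[OF Y] .
  note D = conflationD[OF E(1)]
  let ?A = "Src C k"
  have A: "?A \<in> Obj C" using D by simp
  note SA = shift_conflation[OF A]
  have inj: "injective C E (Trg C k)" using E(3) D projective_iff_injective by simp
  have id: "Ide C ?A \<in> Hom C (Src C k) (Src C (infl ?A))" "Ide C ?A \<in> Hom C (Src C (infl ?A)) (Src C k)"
    using A by (auto simp: Hom_iff)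
  obtain b a where m: "seq_morphism C (k, p) (infl ?A, defl ?A) (Ide C ?A) b a"
    using seq_morphism_injective[OF E(1) SA(1,3) id(1)] .
  obtain b' a' where m': "seq_morphism C (infl ?A, defl ?A) (k, p) (Ide C ?A) b' a'"
    using seq_morphism_injective[OF SA(1) E(1) inj id(2)] .
  have "seq_morphism C (k, p) (k, p) (Ide C (Src C k)) (b' \<cdot> b) (a' \<cdot> a)"
    using seq_morphism_Cmp[OF E(1) SA(1) E(1) m m'] A by simp
  from stable_identity_right[OF E(1,3) this] E
  have 1: "arr_diff (a' \<cdot> a) (Ide C Y) \<in> null_arr" by simp
  have "seq_morphism C (infl ?A, defl ?A) (infl ?A, defl ?A) (Ide C (Src C (infl ?A))) (b \<cdot> b') (a \<cdot> a')"
    using seq_morphism_Cmp[OF SA(1) E(1) SA(1) m' m] A by simp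
  from stable_identity_right[OF SA(1) _ this] A SA(4)
  have 2: "arr_diff (a \<cdot> a') (Ide C (sh ?A)) \<in> null_arr" by simp
  show ?thesis
    by (rule that[OF A _ _ 1 2]) (use m m' E in auto)
qed

end

section \<open>Special precovers and preenvelopes\<close>

context exact_category
begin

text \<open>The product is the pullback of two zero arrows into the cokernel of the identity of
  \<open>T\<close>; the projection to \<open>X\<close> is then a pulled back deflation.\<close>

lemma product_deflation:
  assumes T: "T \<in> Obj C" and X: "X \<in> Obj C"
  obtains k S q1 q2 where "(k, q2) \<in> E" "q1 \<in> Hom C S T" "q2 \<in> Hom C S X"
    "\<And>A x y. \<lbrakk>x \<in> Hom C A T; y \<in> Hom C A X\<rbrakk> \<Longrightarrow> \<exists>u \<in> Hom C A S. q1 \<cdot> u = x \<and> q2 \<cdot> u = y"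
    "\<And>A u v. \<lbrakk>u \<in> Hom C A S; v \<in> Hom C A S; q1 \<cdot> u = q1 \<cdot> v; q2 \<cdot> u = q2 \<cdot> v\<rbrakk> \<Longrightarrow> u = v"
proof -
  obtain z where z: "(Ide C T, z) \<in> E" using Ide_inflation[OF T] by blast
  note D = conflationD[OF z]
  let ?Z = "Trg C z"
  \<comment> \<open>As z = z 1 is zero, every pair of arrows into \<open>T\<close> and
    \<open>X\<close> satisfies the cone condition.\<close>
  have zz: "Src C z = T" "z = Zer C T ?Z" using D T by auto
  have Z: "?Z \<in> Obj C" using D by simp
  obtain q1 k q2 where pb: "pullback_square C z (Zer C X ?Z) q1 q2" and E': "(k, q2) \<in> E"
    using deflation_pullback[OF z, of "Zer C X ?Z"] X Z by auto
  have q: "q1 \<in> Arr C" "q2 \<in> Arr C" "Src C q2 = Src C q1" "Trg C q1 = T" "Trg C q2 = X"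
    using pb zz X Z unfolding pullback_square_def by auto
  show ?thesis
  proof (rule that[OF E', of q1 "Src C q1"])
    show "q1 \<in> Hom C (Src C q1) T" "q2 \<in> Hom C (Src C q1) X" using q by (auto simp: Hom_iff)
    show "\<exists>u \<in> Hom C A (Src C q1). q1 \<cdot> u = x \<and> q2 \<cdot> u = y"
      if xy: "x \<in> Hom C A T" "y \<in> Hom C A X" for A x y
    proof -
      have "z \<cdot> x = Zer C A ?Z" "Zer C X ?Z \<cdot> y = Zer C A ?Z"
        using xy Z zz Zer_Cmp[of x T ?Z] by (auto simp: Hom_iff)
      moreover have "x \<in> Hom C A (Src C z)" "y \<in> Hom C A (Src C (Zer C X ?Z))"
        using xy X Z zz by auto
      ultimately show ?thesis using pullback_lift[OF pb, of x A y] by metis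
    qed
    show "u = v" if "u \<in> Hom C A (Src C q1)" "v \<in> Hom C A (Src C q1)" "q1 \<cdot> u = q1 \<cdot> v" "q2 \<cdot> u = q2 \<cdot> v"
      for A u v
      using pullback_unique[OF pb that] .
  qed
qed

text \<open>The deflation \<open>d\<close> is \<open>[i, p] : T \<oplus> P \<rightarrow> X\<close>. It is obtained from the projection of \<open>T \<oplus> X\<close>
  to \<open>X\<close> by the shear automorphism along \<open>i\<close>, followed by a pullback along \<open>p\<close>.\<close>

lemma sum_deflation:
  assumes i: "i \<in> Hom C T X" and ap: "(a, p) \<in> E" "Trg C p = X"
  obtains k d m \<alpha> \<beta> where "(k, d) \<in> E" "Trg C d = X"
    "\<alpha> \<in> Hom C (Src C d) T" "\<beta> \<in> Hom C (Src C d) (Src C p)" "d = Add C (i \<cdot> \<alpha>) (p \<cdot> \<beta>)"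
    "m \<in> Hom C T (Src C d)" "d \<cdot> m = i"
proof -
  have TX: "T \<in> Obj C" "X \<in> Obj C" using Hom_Obj[OF i] by auto
  note Dp = conflationD[OF ap(1)]
  obtain k0 S q1 q2 where E0: "(k0, q2) \<in> E" and q: "q1 \<in> Hom C S T" "q2 \<in> Hom C S X"
    and pair: "\<And>A x y. \<lbrakk>x \<in> Hom C A T; y \<in> Hom C A X\<rbrakk> \<Longrightarrow> \<exists>u \<in> Hom C A S. q1 \<cdot> u = x \<and> q2 \<cdot> u = y"
    and uniq: "\<And>A u v. \<lbrakk>u \<in> Hom C A S; v \<in> Hom C A S; q1 \<cdot> u = q1 \<cdot> v; q2 \<cdot> u = q2 \<cdot> v\<rbrakk> \<Longrightarrow> u = v"
    by (rule product_deflation[OF TX], rule that)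
  note D0 = conflationD[OF E0]
  have S: "S \<in> Obj C" using Hom_Obj[OF q(1)] by simp
  have qS: "q1 \<in> Arr C" "q2 \<in> Arr C" "Src C q1 = S" "Src C q2 = S" "Trg C q1 = T" "Trg C q2 = X"
    "Trg C k0 = S" using q D0 by (auto simp: Hom_iff)
  have iH: "i \<in> Arr C" "Src C i = T" "Trg C i = X" using i by (auto simp: Hom_iff)
  let ?d0 = "Add C (i \<cdot> q1) q2"
  have "?d0 \<in> Hom C S X" "arr_diff q2 (i \<cdot> q1) \<in> Hom C S X" using qS iH by (auto simp: Hom_iff)
  \<comment> \<open>\<open>\<phi>\<close> is the shear (t, x) -> (t, i t + x) and
    \<open>\<psi>\<close> its inverse (t, x) -> (t, x - i t).\<close>
  then obtain \<phi> \<psi> where \<phi>: "\<phi> \<in> Hom C S S" "q1 \<cdot> \<phi> = q1" "q2 \<cdot> \<phi> = ?d0"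
    and \<psi>: "\<psi> \<in> Hom C S S" "q1 \<cdot> \<psi> = q1" "q2 \<cdot> \<psi> = arr_diff q2 (i \<cdot> q1)"
    using pair[OF q(1)] by meson
  have A: "\<phi> \<in> Arr C" "Src C \<phi> = S" "Trg C \<phi> = S" "\<psi> \<in> Arr C" "Src C \<psi> = S" "Trg C \<psi> = S"
    using \<phi> \<psi> by (auto simp: Hom_iff)
  have 1: "\<phi> \<cdot> \<psi> = Ide C S"
  proof (rule uniq)
    show "\<phi> \<cdot> \<psi> \<in> Hom C S S" "Ide C S \<in> Hom C S S" using A S by (auto simp: Hom_iff)
    show "q1 \<cdot> (\<phi> \<cdot> \<psi>) = q1 \<cdot> Ide C S"
      using Cmp_assoc_Arr[of \<psi> \<phi> q1] A qS \<phi> \<psi> by simp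
    have "q2 \<cdot> (\<phi> \<cdot> \<psi>) = ?d0 \<cdot> \<psi>"
      using Cmp_assoc_Arr[of \<psi> \<phi> q2] A qS \<phi> by simp
    also have "\<dots> = Add C (i \<cdot> q1) (arr_diff q2 (i \<cdot> q1))"
      using A qS iH \<psi> by simp
    also have "\<dots> = q2 \<cdot> Ide C S"
      using Add_diff_cancel(4)[of q2 S X "i \<cdot> q1"] qS iH by (simp add: Hom_iff)
    finally show "q2 \<cdot> (\<phi> \<cdot> \<psi>) = q2 \<cdot> Ide C S" .
  qed
  have q2\<psi>\<phi>: "q2 \<cdot> (\<psi> \<cdot> \<phi>) = q2"
  proof -
    have "q2 \<cdot> (\<psi> \<cdot> \<phi>) = arr_diff q2 (i \<cdot> q1) \<cdot> \<phi>"
      using Cmp_assoc_Arr[of \<phi> \<psi> q2] A qS \<psi> by simp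
    also have "\<dots> = arr_diff ?d0 (i \<cdot> q1)"
      using A qS iH \<phi> by simp
    also have "\<dots> = q2"
      using Add_diff_cancel(3)[of q2 S X "i \<cdot> q1"] qS iH by (simp add: Hom_iff)
    finally show ?thesis .
  qed
  have 2: "\<psi> \<cdot> \<phi> = Ide C S"
  proof (rule uniq)
    show "\<psi> \<cdot> \<phi> \<in> Hom C S S" "Ide C S \<in> Hom C S S" using A S by (auto simp: Hom_iff)
    show "q1 \<cdot> (\<psi> \<cdot> \<phi>) = q1 \<cdot> Ide C S"
      using Cmp_assoc_Arr[of \<phi> \<psi> q1] A qS \<phi> \<psi> by simp
    show "q2 \<cdot> (\<psi> \<cdot> \<phi>) = q2 \<cdot> Ide C S"
      using q2\<psi>\<phi> qS by simp
  qed
  have d0\<psi>: "?d0 \<cdot> \<psi> = q2"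
    using Cmp_assoc_Arr[of \<psi> \<phi> q2] 1 A qS \<phi>(3) by simp
  have "seq_morphism C (k0, q2) (\<psi> \<cdot> k0, ?d0) (Ide C (Src C k0)) \<psi> (Ide C X)"
    using A qS D0 TX iH d0\<psi> by (simp add: Hom_iff del: Add_Cmp_Arr)
  from iso_closed[OF E0 _ _ _ this is_iso_Ide is_isoI[OF \<psi>(1) \<phi>(1) 1 2] is_iso_Ide]
  have E1: "(\<psi> \<cdot> k0, ?d0) \<in> E"
    using A qS D0 TX iH by simp
  \<comment> \<open>Pulling \<open>p\<close> back along \<open>q2\<close> replaces the coordinate in
    \<open>X\<close> by one in the source of \<open>p\<close>; the deflation \<open>r\<close> is (t,
    c) -> (t, p c).\<close>
  have "q2 \<in> Hom C S (Trg C p)" using q ap by simp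
  from conflation_pullback[OF ap(1) this] obtain a' r \<beta>
    where E2: "(a', r) \<in> E" and pb: "pullback_square C p q2 \<beta> r" .
  note Q = pullback_squareD[OF pb]
  have R: "r \<in> Arr C" "Trg C r = S" "Src C r = Src C \<beta>" using Q qS by auto
  obtain k where E3: "(k, ?d0 \<cdot> r) \<in> E"
    using deflation_Cmp[OF E2 E1] R qS iH by auto
  have "Ide C T \<in> Hom C T T" "Zer C T X \<in> Hom C T X" using TX Ide_Hom Zer_Hom by auto
  \<comment> \<open>The inclusion of the first summand; paired with 0 in the source of
    \<open>p\<close> it lifts to \<open>m\<close>.\<close>
  then obtain j where j: "j \<in> Hom C T S" "q1 \<cdot> j = Ide C T" "q2 \<cdot> j = Zer C T X"
    using pair by blast
  have "Zer C T (Src C p) \<in> Hom C T (Src C p)" "j \<in> Hom C T (Src C q2)" "p \<cdot> Zer C T (Src C p) = q2 \<cdot> j"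
    using j TX qS Dp ap Zer_Hom by auto
  from pullback_lift[OF pb this] obtain m
    where m: "m \<in> Hom C T (Src C \<beta>)" "\<beta> \<cdot> m = Zer C T (Src C p)" "r \<cdot> m = j" .
  show ?thesis
  proof (rule that[OF E3, of "q1 \<cdot> r" \<beta> m])
    show "Trg C (?d0 \<cdot> r) = X" "q1 \<cdot> r \<in> Hom C (Src C (?d0 \<cdot> r)) T"
      "\<beta> \<in> Hom C (Src C (?d0 \<cdot> r)) (Src C p)" "m \<in> Hom C T (Src C (?d0 \<cdot> r))"
      using qS iH R Q m by (auto simp: Hom_iff)
    show "?d0 \<cdot> r = Add C (i \<cdot> (q1 \<cdot> r)) (p \<cdot> \<beta>)"
      using qS iH R Q by simp
    have "(?d0 \<cdot> r) \<cdot> m = ?d0 \<cdot> j"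
      using qS iH R m Cmp_assoc_Arr[of m r ?d0] by (simp add: Hom_iff del: Add_Cmp_Arr)
    also have "\<dots> = i"
      using qS iH j TX by (simp add: Hom_iff)
    finally show "(?d0 \<cdot> r) \<cdot> m = i" .
  qed
qed

end

section \<open>Precovers modulo null arrows\<close>

context frobenius_category
begin

text \<open>Precovers of the stable category on the level of representatives, where null errors can
  be lifted along deflations.\<close>

definition stable_precover :: "'m set \<Rightarrow> 'o \<Rightarrow> 'm \<Rightarrow> bool" where
  "stable_precover I X i \<longleftrightarrow> i \<in> I \<and> Trg C i = X \<and>
    (\<forall>f \<in> I. Trg C f = X \<longrightarrow> (\<exists>u \<in> Hom C (Src C f) (Src C i). arr_diff f (i \<cdot> u) \<in> null_arr))"

lemma precover_stable_iff:
  assumes I: "cat_ideal C I" and null: "null_arr \<subseteq> I" and i: "i \<in> I"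
  shows "precover \<D> (\<pi> ` I) X (\<pi> i) \<longleftrightarrow> stable_precover I X i"
proof -
  have iA: "i \<in> Arr C" using ideal_memD(1)[OF I i] .
  have "(\<exists>U \<in> Hom \<D> (Src \<D> (\<pi> f)) (Src \<D> (\<pi> i)). \<pi> i \<cdot>\<^bsub>\<D>\<^esub> U = \<pi> f) \<longleftrightarrow>
      (\<exists>u \<in> Hom C (Src C f) (Src C i). arr_diff f (i \<cdot> u) \<in> null_arr)" (is "?L \<longleftrightarrow> ?R")
    if f: "f \<in> I" "Trg C f = Trg C i" for f
  proof -
    have fA: "f \<in> Arr C" using ideal_memD(1)[OF I f(1)] .
    have *: "\<pi> i \<cdot>\<^bsub>\<D>\<^esub> \<pi> u = \<pi> f \<longleftrightarrow> arr_diff f (i \<cdot> u) \<in> null_arr" if u: "u \<in> Hom C (Src C f) (Src C i)" for u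
    proof -
      have "\<pi> i \<cdot>\<^bsub>\<D>\<^esub> \<pi> u = \<pi> (i \<cdot> u)"
        using stable_Cmp[OF u, of i "Trg C i"] iA by (simp add: Hom_iff)
      then show ?thesis
        using stable_eq_iff[of f "Src C f" "Trg C i" "i \<cdot> u"] u f fA iA by (auto simp: Hom_iff)
    qed
    show ?thesis
    proof
      assume ?L
      then obtain u where "u \<in> Hom C (Src C f) (Src C i)" "\<pi> i \<cdot>\<^bsub>\<D>\<^esub> \<pi> u = \<pi> f"
        using fA iA by (auto elim!: stable_HomE)
      then show ?R using * by blast
    next
      assume ?R
      then obtain u where u: "u \<in> Hom C (Src C f) (Src C i)" "arr_diff f (i \<cdot> u) \<in> null_arr" by blast
      then show ?L using *[OF u(1)] stable_HomI[OF u(1)] fA iA by auto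
    qed
  qed
  then show ?thesis
    unfolding precover_def stable_precover_def using i iA ideal_memD(1)[OF I] by auto
qed

text \<open>The syzygy conflation is pulled back along \<open>f\<close>; orthogonality extends
  \<open>g\<close> over the new inflation, and the homotopy transfer turns this into a lift of
  \<open>f\<close> along \<open>i\<close>. The factorization is therefore exact, with difference
  0.\<close>

lemma special_precover_stable:
  assumes I: "cat_ideal C I" and null: "null_arr \<subseteq> I" and i: "ext_special_precover C E I X i"
  shows "stable_precover I X i"
proof -
  obtain k a p g b where i': "i \<in> I" "Trg C i = X" "(k, i) \<in> E"
    and s: "syzygy_conflation C E X (a, p)" and g: "g \<in> ext_right_perp C E I"
    and m: "seq_morphism C (a, p) (k, i) g b (Ide C X)"
    using i unfolding ext_special_precover_def by (metis prod.collapse)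
  have ap: "(a, p) \<in> E" "Trg C p = X" using s by (auto simp: syzygy_conflation_def)
  note D = conflationD[OF ap(1)] conflationD[OF i'(3)]
  have gA: "g \<in> Arr C" using m by (simp add: Hom_iff)
  show ?thesis
    unfolding stable_precover_def
  proof (intro conjI ballI impI i')
    fix f assume f: "f \<in> I" "Trg C f = X"
    have fA: "f \<in> Arr C" using ideal_memD(1)[OF I f(1)] .
    have orth: "ext_orthogonal C E f g" using g f unfolding ext_right_perp_def by blast
    have "f \<in> Hom C (Src C f) (Trg C p)" using fA f ap by (simp add: Hom_iff)
    from conflation_pullback[OF ap(1) this] obtain i0 p0 b0
      where E0: "(i0, p0) \<in> E" and m0: "seq_morphism C (i0, p0) (a, p) (Ide C (Src C a)) b0 f" .
    have sg: "Src C g = Src C a" using m by (simp add: Hom_iff)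
    have "(a, p) \<in> conflations C E (Trg C f) (Src C g)"
      "seq_morphism C (i0, p0) (a, p) (Ide C (Src C g)) b0 f"
      using ap sg f m0 by (simp_all add: conflations_iff)
    from ext_orthogonalD[OF orth fA gA this(1) E0 this(2)]
    obtain t where t: "t \<in> Hom C (Trg C i0) (Trg C g)" "t \<cdot> i0 = g" .
    have "seq_morphism C (i0, p0) (k, i) (g \<cdot> Ide C (Src C a)) (b \<cdot> b0) (Ide C X \<cdot> f)"
      by (rule seq_morphism_Cmp[OF E0 ap(1) i'(3) m0 m])
    then have m1: "seq_morphism C (i0, p0) (k, i) g (b \<cdot> b0) f"
      using gA sg fA f by simp
    have "t \<in> Hom C (Trg C i0) (Src C k)" using t m by (simp add: Hom_iff)
    from seq_morphism_left_to_right[OF E0 i'(3) m1 this t(2)] obtain u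
      where u: "u \<in> Hom C (Trg C p0) (Src C i)" "i \<cdot> u = f" .
    have "Trg C p0 = Src C f" using m0 by (simp add: Hom_iff)
    moreover have "arr_diff f (i \<cdot> u) = Zer C (Src C f) X"
      unfolding u(2) using diff_self[of f] fA f by (simp add: Hom_iff)
    then have "arr_diff f (i \<cdot> u) \<in> null_arr"
      using ideal_Zer[OF null_ideal, of "Src C f" X] fA f by auto
    ultimately show "\<exists>u \<in> Hom C (Src C f) (Src C i). arr_diff f (i \<cdot> u) \<in> null_arr"
      using u(1) by metis
  qed
qed

text \<open>The null error f - i u lifts along the deflation \<open>p\<close>, so a stable
  factorization becomes an equation in \<open>C\<close> with one correction term.\<close>

lemma stable_precover_factor:
  assumes i: "stable_precover I X i" and iA: "i \<in> Arr C" and f: "f \<in> I" "f \<in> Arr C" "Trg C f = X"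
    and ap: "(a, p) \<in> E" "Trg C p = X"
  obtains u v where "u \<in> Hom C (Src C f) (Src C i)" "v \<in> Hom C (Src C f) (Src C p)"
    "Add C (i \<cdot> u) (p \<cdot> v) = f"
proof -
  obtain u where u: "u \<in> Hom C (Src C f) (Src C i)" "arr_diff f (i \<cdot> u) \<in> null_arr"
    using i f unfolding stable_precover_def by blast
  have ti: "Trg C i = X" using i unfolding stable_precover_def by blast
  have d: "Trg C p = Trg C (arr_diff f (i \<cdot> u))" "Src C (arr_diff f (i \<cdot> u)) = Src C f"
    using ap u f iA ti by (simp_all add: Hom_iff)
  obtain v where v: "v \<in> Hom C (Src C (arr_diff f (i \<cdot> u))) (Src C p)" "p \<cdot> v = arr_diff f (i \<cdot> u)"
    by (rule null_factor[OF u(2) ap(1) d(1)])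
  have "Add C (i \<cdot> u) (p \<cdot> v) = f"
    using Add_diff_cancel(4)[of f "Src C f" X "i \<cdot> u"] u v f iA ti by (simp add: Hom_iff)
  then show ?thesis using that[OF u(1), of v] v(1) d(2) by metis
qed

text \<open>A conflation from \<open>Src C a\<close> to the target of \<open>f\<close> is classified
  by an arrow \<open>y\<close> to \<open>X\<close>, and \<open>y \<cdot> f\<close> lies in
  \<open>I\<close>, so it equals i u + p v. Once \<open>v\<close> is subtracted from the middle
  arrow, the remainder is compatible with the part through \<open>i\<close> and defines an arrow
  into the pullback that extends \<open>j\<close>.\<close>

lemma stable_precover_pullback_perp:
  assumes I: "cat_ideal C I" and i: "stable_precover I X i"
    and ap: "(a, p) \<in> E" "Trg C p = X" "projective C E (Src C p)"
    and jq: "(j, q) \<in> E" and pb: "pullback_square C p i b q" "b \<cdot> j = a" "Src C j = Src C a"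
  shows "j \<in> ext_right_perp C E I"
proof -
  note D = conflationD[OF ap(1)] conflationD[OF jq]
  note Q = pullback_squareD[OF pb(1)]
  have inj: "injective C E (Trg C a)" using ap D projective_iff_injective by simp
  have "ext_orthogonal C E f j" if f: "f \<in> I" for f
  proof -
    have fA: "f \<in> Arr C" using ideal_memD(1)[OF I f] .
    show ?thesis
    proof (rule ext_orthogonalI[OF fA D(5)])
      fix c1 p1 i0 p0 b0
      assume "(c1, p1) \<in> conflations C E (Trg C f) (Src C j)" and E0: "(i0, p0) \<in> E"
        and m0: "seq_morphism C (i0, p0) (c1, p1) (Ide C (Src C j)) b0 f"
      then have c: "(c1, p1) \<in> E" "Src C c1 = Src C a" "Trg C p1 = Trg C f"
        using pb by (auto simp: conflations_iff)
      note D0 = conflationD[OF E0] conflationD[OF c(1)]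
      have "Ide C (Src C a) \<in> Hom C (Src C c1) (Src C a)" using c D by (simp add: Hom_iff)
      from seq_morphism_injective[OF c(1) ap(1) inj this] obtain c' y
        where m1: "seq_morphism C (c1, p1) (a, p) (Ide C (Src C a)) c' y" .
      have yH: "y \<in> Arr C" "Src C y = Trg C f" "Trg C y = X" using m1 c ap by (auto simp: Hom_iff)
      have "y \<cdot> f \<in> I" by (rule ideal_memD(2)[OF I f]) (use yH in auto)
      from stable_precover_factor[OF i Q(2) this _ _ ap(1,2)] yH fA
      obtain u v where uv: "u \<in> Hom C (Src C f) (Src C i)" "v \<in> Hom C (Src C f) (Src C p)"
        "Add C (i \<cdot> u) (p \<cdot> v) = y \<cdot> f" by auto
      define e where "e = c' \<cdot> b0"
      have "seq_morphism C (i0, p0) (a, p) (Ide C (Src C a) \<cdot> Ide C (Src C a)) e (y \<cdot> f)"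
        using seq_morphism_Cmp[OF E0 c(1) ap(1) _ m1] m0 pb unfolding e_def by simp
      then have m2: "e \<in> Hom C (Trg C i0) (Trg C a)" "e \<cdot> i0 = a" "(y \<cdot> f) \<cdot> p0 = p \<cdot> e"
        "Src C i0 = Src C a" "Trg C p0 = Src C f"
        using D fA yH by (auto simp: Hom_iff)
      have H: "u \<in> Arr C" "Src C u = Src C f" "Trg C u = Src C i" "v \<in> Arr C" "Src C v = Src C f"
        "Trg C v = Trg C a" "e \<in> Arr C" "Src C e = Trg C i0" "Trg C e = Trg C a" "Trg C i = X"
        using uv m2 D Q ap by (auto simp: Hom_iff)
      \<comment> \<open>The correction vanishes on \<open>i0\<close>, so the left end is unchanged,
        and it turns p e into i u p0.\<close>
      let ?d = "arr_diff e (v \<cdot> p0)"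
      have d: "?d \<in> Hom C (Trg C i0) (Src C p)" using H D D0 m2 by (simp add: Hom_iff)
      have "p \<cdot> e = Add C (i \<cdot> (u \<cdot> p0)) (p \<cdot> (v \<cdot> p0))"
        unfolding m2(3)[symmetric] uv(3)[symmetric] using H D D0 Q m2 ap by simp
      then have pd: "p \<cdot> ?d = i \<cdot> (u \<cdot> p0)"
        using Add_diff_cancel(2)[of "i \<cdot> (u \<cdot> p0)" "Trg C i0" X "p \<cdot> (v \<cdot> p0)"] H D D0 Q m2 ap
        by (simp add: Hom_iff)
      have "u \<cdot> p0 \<in> Hom C (Trg C i0) (Src C i)" using H D0 m2 by (simp add: Hom_iff)
      from pullback_lift[OF pb(1) d this pd] obtain t
        where t: "t \<in> Hom C (Trg C i0) (Src C b)" "b \<cdot> t = ?d" "q \<cdot> t = u \<cdot> p0" .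
      have tH: "t \<in> Arr C" "Src C t = Trg C i0" "Trg C t = Src C b" using t by (auto simp: Hom_iff)
      have "t \<cdot> i0 = j"
      proof (rule pullback_unique[OF pb(1)])
        show "t \<cdot> i0 \<in> Hom C (Src C a) (Src C b)" "j \<in> Hom C (Src C a) (Src C b)"
          using tH D0 m2 D Q pb by (auto simp: Hom_iff)
        have "b \<cdot> (t \<cdot> i0) = ?d \<cdot> i0"
          using Cmp_assoc_Arr[of i0 t b] tH D0 Q t(2) by (simp del: diff_Cmp)
        also have "\<dots> = a"
          using H D D0 m2 diff_Zer[of a "Src C a" "Trg C a"] by (simp add: Hom_iff)
        finally show "b \<cdot> (t \<cdot> i0) = b \<cdot> j" using pb by simp
        have "q \<cdot> (t \<cdot> i0) = (u \<cdot> p0) \<cdot> i0"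
          using Cmp_assoc_Arr[of i0 t q] tH D0 Q t(3) by simp
        also have "\<dots> = q \<cdot> j"
          using H D D0 Q m2 pb by simp
        finally show "q \<cdot> (t \<cdot> i0) = q \<cdot> j" .
      qed
      then show "\<exists>t \<in> Hom C (Trg C i0) (Trg C j). t \<cdot> i0 = j"
        using t D Q by (intro bexI[of _ t]) auto
    qed
  qed
  then show ?thesis unfolding ext_right_perp_def using D by blast
qed

lemma special_precover_of_stable:
  assumes I: "cat_ideal C I" and null: "null_arr \<subseteq> I" and i: "stable_precover I X i"
  shows "\<exists>d. ext_special_precover C E I X d"
proof -
  have i': "i \<in> I" "Trg C i = X" using i unfolding stable_precover_def by auto
  have iA: "i \<in> Arr C" using ideal_memD(1)[OF I i'(1)] .
  have X: "X \<in> Obj C" using iA i' by auto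
  obtain a p where ap: "(a, p) \<in> E" "Trg C p = X" "projective C E (Src C p)"
    using syzygy_conflation_ex[OF X] .
  note D = conflationD[OF ap(1)]
  have inj: "injective C E (Trg C a)" using ap D projective_iff_injective by simp
  have "i \<in> Hom C (Src C i) X" using iA i' by (simp add: Hom_iff)
  from sum_deflation[OF this ap(1,2)] obtain k d m \<alpha> \<beta>
    where kd: "(k, d) \<in> E" "Trg C d = X"
      and \<alpha>: "\<alpha> \<in> Hom C (Src C d) (Src C i)" and \<beta>: "\<beta> \<in> Hom C (Src C d) (Src C p)"
      and d: "d = Add C (i \<cdot> \<alpha>) (p \<cdot> \<beta>)" and m: "m \<in> Hom C (Src C i) (Src C d)" "d \<cdot> m = i" .
  note Dk = conflationD[OF kd(1)]
  \<comment> \<open>Both terms of \<open>d\<close> lie in \<open>I\<close>: one factors through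
    \<open>i\<close>, the other through the projective source of \<open>p\<close>.\<close>
  have "i \<cdot> \<alpha> \<in> I" by (rule ideal_memD(3)[OF I i'(1)]) (use \<alpha> in \<open>auto simp: Hom_iff\<close>)
  moreover have "p \<cdot> \<beta> \<in> I" using null null_through[OF ap(3) \<beta>, of p X] D ap by (auto simp: Hom_iff)
  moreover have "i \<cdot> \<alpha> \<in> Hom C (Src C d) X" "p \<cdot> \<beta> \<in> Hom C (Src C d) X"
    using \<alpha> \<beta> iA i' D ap by (auto simp: Hom_iff)
  ultimately have dI: "d \<in> I" using ideal_Add[OF I] d by metis
  have "Ide C X \<in> Hom C (Trg C p) (Trg C d)" using ap kd X Ide_Hom by simp
  from seq_morphism_projective[OF ap(1) kd(1) ap(3) this] obtain g b
    where mg: "seq_morphism C (a, p) (k, d) g b (Ide C X)" .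
  have gA: "g \<in> Arr C" "Src C g = Src C a" using mg by (auto simp: Hom_iff)
  have "ext_orthogonal C E f g" if f: "f \<in> I" for f
  proof -
    have fA: "f \<in> Arr C" using ideal_memD(1)[OF I f] .
    show ?thesis
    proof (rule ext_orthogonalI[OF fA gA(1)])
      fix c1 p1 i0 p0 b0
      assume "(c1, p1) \<in> conflations C E (Trg C f) (Src C g)" and E0: "(i0, p0) \<in> E"
        and m0: "seq_morphism C (i0, p0) (c1, p1) (Ide C (Src C g)) b0 f"
      then have c: "(c1, p1) \<in> E" "Src C c1 = Src C a" "Trg C p1 = Trg C f"
        using gA by (auto simp: conflations_iff)
      have "Ide C (Src C a) \<in> Hom C (Src C c1) (Src C a)" using c D by (simp add: Hom_iff)
      from seq_morphism_injective[OF c(1) ap(1) inj this] obtain c' y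
        where m1: "seq_morphism C (c1, p1) (a, p) (Ide C (Src C a)) c' y" .
      have yH: "y \<in> Arr C" "Src C y = Trg C f" "Trg C y = X" using m1 c ap by (auto simp: Hom_iff)
      have "y \<cdot> f \<in> I" by (rule ideal_memD(2)[OF I f]) (use yH in auto)
      from stable_precover_factor[OF i iA this _ _ ap(1,2)] yH fA
      obtain u v where uv: "u \<in> Hom C (Src C f) (Src C i)" "v \<in> Hom C (Src C f) (Src C p)"
        "Add C (i \<cdot> u) (p \<cdot> v) = y \<cdot> f" by auto
      have "seq_morphism C (i0, p0) (k, d) (g \<cdot> (Ide C (Src C a) \<cdot> Ide C (Src C a))) (b \<cdot> (c' \<cdot> b0))
          (Ide C X \<cdot> (y \<cdot> f))"
        using seq_morphism_Cmp[OF E0 ap(1) kd(1) seq_morphism_Cmp[OF E0 c(1) ap(1) _ m1] mg] m0 gA by simp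
      then have m2: "seq_morphism C (i0, p0) (k, d) g (b \<cdot> (c' \<cdot> b0)) (y \<cdot> f)"
        using gA D yH fA by simp
      have H: "u \<in> Arr C" "Src C u = Src C f" "Trg C u = Src C i" "v \<in> Arr C" "Src C v = Src C f"
        "Trg C v = Trg C a" "m \<in> Arr C" "Src C m = Src C i" "Trg C m = Trg C k"
        "b \<in> Arr C" "Src C b = Trg C a" "Trg C b = Trg C k" "d \<cdot> b = p"
        using uv m mg D Dk by (auto simp: Hom_iff ap)
      \<comment> \<open>This is a lift of \<open>y \<cdot> f\<close> along \<open>d\<close>: d m = i
        accounts for the term through \<open>i\<close>, and d b = p, from the comparison diagram,
        for the correction term.\<close>
      let ?w = "Add C (m \<cdot> u) (b \<cdot> v)"
      have w: "?w \<in> Hom C (Src C f) (Trg C k)" using H by (simp add: Hom_iff)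
      have "d \<cdot> (m \<cdot> u) = i \<cdot> u" "d \<cdot> (b \<cdot> v) = p \<cdot> v"
        using Cmp_assoc_Arr[of u m d] Cmp_assoc_Arr[of v b d] H Dk m(2) by simp_all
      then have dw: "d \<cdot> ?w = y \<cdot> f" using uv(3) H Dk by simp
      have "?w \<in> Hom C (Trg C p0) (Src C d)"
        using w m0 Dk by (simp add: Hom_iff)
      from seq_morphism_right_to_left[OF E0 kd(1) m2 this dw]
      obtain t where "t \<in> Hom C (Trg C i0) (Src C k)" "t \<cdot> i0 = g" .
      then show "\<exists>t \<in> Hom C (Trg C i0) (Trg C g). t \<cdot> i0 = g"
        using mg by (auto simp: Hom_iff)
    qed
  qed
  then have g: "g \<in> ext_right_perp C E I" unfolding ext_right_perp_def using gA by blast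
  have "syzygy_conflation C E X (a, p)" using ap by (simp add: syzygy_conflation_def)
  then show ?thesis
    unfolding ext_special_precover_def using dI kd g mg by blast
qed

end

section \<open>Ideal cotorsion pairs and ideal torsion pairs\<close>

context frobenius_shift
begin

text \<open>Represents the right perp of the image of \<open>I\<close> in the stable category; it
  stands in \<open>C\<close> for the suspension of \<open>J\<close>.\<close>

definition shifted_perp :: "'m set \<Rightarrow> 'm set" where
  "shifted_perp I = {s \<in> Arr C. \<forall>f \<in> I. \<forall>x \<in> Hom C (Trg C f) (Src C s). s \<cdot> (x \<cdot> f) \<in> null_arr}"

lemma shifted_perp_ideal:
  assumes I: "cat_ideal C I"
  shows "cat_ideal C (shifted_perp I)"
proof (rule cat_idealI)
  have IA: "f \<in> Arr C" if "f \<in> I" for f using ideal_memD(1)[OF I that] .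
  show "shifted_perp I \<subseteq> Arr C" by (auto simp: shifted_perp_def)
  show "Zer C A B \<in> shifted_perp I" if "A \<in> Obj C" "B \<in> Obj C" for A B
    unfolding shifted_perp_def using that IA ideal_Zer[OF null_ideal] by (auto simp: Hom_iff)
  show "arr_diff s s' \<in> shifted_perp I"
    if s: "s \<in> shifted_perp I" "s' \<in> shifted_perp I" "s \<in> Hom C A B" "s' \<in> Hom C A B" for s s' A B
  proof -
    have "arr_diff s s' \<cdot> (x \<cdot> f) \<in> null_arr" if "f \<in> I" "x \<in> Hom C (Trg C f) A" for f x
    proof -
      have "s \<cdot> (x \<cdot> f) \<in> null_arr" "s' \<cdot> (x \<cdot> f) \<in> null_arr"
        using s that by (auto simp: shifted_perp_def Hom_iff)
      then have "arr_diff (s \<cdot> (x \<cdot> f)) (s' \<cdot> (x \<cdot> f)) \<in> null_arr"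
        using null_diff[of _ _ "Src C f" B] s that IA by (simp add: Hom_iff)
      then show ?thesis using s that IA by (simp add: Hom_iff)
    qed
    then show ?thesis using s by (simp add: shifted_perp_def Hom_iff)
  qed
  show "g \<cdot> s \<in> shifted_perp I" if s: "s \<in> shifted_perp I" "g \<in> Arr C" "Src C g = Trg C s" for s g
  proof -
    have sA: "s \<in> Arr C" using s by (simp add: shifted_perp_def)
    have "(g \<cdot> s) \<cdot> (x \<cdot> f) \<in> null_arr" if "f \<in> I" "x \<in> Hom C (Trg C f) (Src C s)" for f x
    proof -
      have "g \<cdot> (s \<cdot> (x \<cdot> f)) \<in> null_arr"
        by (rule null_Cmp) (use s that IA sA in \<open>auto simp: shifted_perp_def Hom_iff\<close>)
      then show ?thesis using s that IA sA by (simp add: Hom_iff)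
    qed
    then show ?thesis using s sA by (simp add: shifted_perp_def)
  qed
  show "s \<cdot> g \<in> shifted_perp I" if s: "s \<in> shifted_perp I" "g \<in> Arr C" "Trg C g = Src C s" for s g
  proof -
    have sA: "s \<in> Arr C" using s by (simp add: shifted_perp_def)
    have "(s \<cdot> g) \<cdot> (x \<cdot> f) \<in> null_arr" if h: "f \<in> I" "x \<in> Hom C (Trg C f) (Src C g)" for f x
    proof -
      \<comment> \<open>The new factor is absorbed into the arrow over which the perp
        quantifies.\<close>
      have "g \<cdot> x \<in> Hom C (Trg C f) (Src C s)" using s h by (simp add: Hom_iff)
      then have "s \<cdot> ((g \<cdot> x) \<cdot> f) \<in> null_arr" using s(1) h(1) unfolding shifted_perp_def by blast
      then show ?thesis using s h IA sA by (simp add: Hom_iff)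
    qed
    then show ?thesis using s sA by (simp add: shifted_perp_def)
  qed
qed

text \<open>The bridge from the Ext side to the Hom side: \<open>ext_orthogonal_iff_null\<close> for
  every \<open>f\<close> in \<open>I\<close>.\<close>

lemma shift_of_mem_shifted_perp:
  assumes I: "cat_ideal C I" and s: "shift_of g s"
  shows "s \<in> shifted_perp I \<longleftrightarrow> g \<in> ext_right_perp C E I"
  using ext_orthogonal_iff_null[OF ideal_memD(1)[OF I] s] shift_of_Hom[OF s]
  by (auto simp: shifted_perp_def ext_right_perp_def Hom_iff)

text \<open>An arrow isomorphic to a member of an ideal is a two-sided multiple of it, which gives
  one inclusion. For the other, stable isomorphisms move \<open>h\<close> between suspended objects,
  where fullness of the suspension provides \<open>g\<close>.\<close>

lemma stable_shift_image_perp: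
  assumes I: "cat_ideal C I"
  shows "stable_shift_image C E S (ext_right_perp C E I) = \<pi> ` shifted_perp I"
proof (intro equalityI subsetI)
  note P = shifted_perp_ideal[OF I]
  fix H assume "H \<in> stable_shift_image C E S (ext_right_perp C E I)"
  then obtain g where g: "g \<in> ext_right_perp C E I" "iso_arrows \<D> H (shift_arr C E S (\<pi> g))"
    unfolding stable_shift_image_def by blast
  have "g \<in> Arr C" using g unfolding ext_right_perp_def by blast
  then obtain s where s: "shift_of g s" using shift_of_ex by blast
  have sP: "s \<in> shifted_perp I" using shift_of_mem_shifted_perp[OF I s] g(1) by blast
  have sA: "s \<in> Arr C" using ideal_memD(1)[OF P sP] .
  have "iso_arrows \<D> H (\<pi> s)" using g(2) shift_arr_stable[OF s] by simp
  then obtain U V where H: "H \<in> Arr \<D>" and U: "U \<in> Hom \<D> (Src \<D> H) (Src \<D> (\<pi> s))"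
    and V: "V \<in> Hom \<D> (Trg \<D> H) (Trg \<D> (\<pi> s))" "is_iso \<D> V" and UV: "V \<cdot>\<^bsub>\<D>\<^esub> H = \<pi> s \<cdot>\<^bsub>\<D>\<^esub> U"
    unfolding iso_arrows_def by blast
  obtain h where h: "h \<in> Arr C" "H = \<pi> h" using H by (auto simp: stable_Arr)
  obtain a where a: "a \<in> Hom C (Src C h) (Src C s)" "U = \<pi> a"
    using U h sA by (auto elim!: stable_HomE)
  obtain b where b: "b \<in> Hom C (Trg C h) (Trg C s)" "V = \<pi> b"
    using V(1) h sA by (auto elim!: stable_HomE)
  obtain b' where b': "b' \<in> Hom C (Trg C s) (Trg C h)" "\<pi> b' \<cdot>\<^bsub>\<D>\<^esub> \<pi> b = Ide \<D> (Trg C h)"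
    using V(2) b unfolding is_iso_def by (auto simp: Hom_iff elim!: stable_HomE)
  note eq = UV[unfolded h(2) a(2) b(2)]
  note a = a(1) and b = b(1)
  have hH: "h \<in> Hom C (Src C h) (Trg C h)" and sH: "s \<in> Hom C (Src C s) (Trg C s)"
    using h sA by (auto simp: Hom_iff)
  have bh: "b \<cdot> h \<in> Hom C (Src C h) (Trg C s)" "s \<cdot> a \<in> Hom C (Src C h) (Trg C s)"
    using Cmp_Hom[OF hH b] Cmp_Hom[OF a sH] .
  have "\<pi> (b' \<cdot> (s \<cdot> a)) = \<pi> b' \<cdot>\<^bsub>\<D>\<^esub> \<pi> (s \<cdot> a)"
    using stable_Cmp[OF bh(2) b'(1)] by simp
  also have "\<dots> = \<pi> b' \<cdot>\<^bsub>\<D>\<^esub> \<pi> (b \<cdot> h)"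
    using eq stable_Cmp[OF hH b] stable_Cmp[OF a sH] by simp
  also have "\<dots> = \<pi> ((b' \<cdot> b) \<cdot> h)"
    using stable_Cmp[OF bh(1) b'(1)] b b' h by (simp add: Hom_iff)
  also have "\<dots> = \<pi> (b' \<cdot> b) \<cdot>\<^bsub>\<D>\<^esub> \<pi> h"
    using stable_Cmp[OF hH Cmp_Hom[OF b b'(1)]] by simp
  also have "\<dots> = \<pi> (Ide C (Trg C h)) \<cdot>\<^bsub>\<D>\<^esub> \<pi> h"
    using stable_Cmp[OF b b'(1)] b'(2) by (simp add: stable_Ide)
  also have "\<dots> = \<pi> h"
    using stable_Cmp[OF hH Ide_Hom] h by simp
  finally have "H = \<pi> (b' \<cdot> (s \<cdot> a))" using h by simp
  moreover have "s \<cdot> a \<in> shifted_perp I"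
    by (rule ideal_memD(3)[OF P sP]) (use a in \<open>auto simp: Hom_iff\<close>)
  then have "b' \<cdot> (s \<cdot> a) \<in> shifted_perp I"
    by (rule ideal_memD(2)[OF P]) (use a b' sA in \<open>auto simp: Hom_iff\<close>)
  ultimately show "H \<in> \<pi> ` shifted_perp I" by blast
next
  note P = shifted_perp_ideal[OF I]
  fix H assume "H \<in> \<pi> ` shifted_perp I"
  then obtain h where h: "h \<in> shifted_perp I" "H = \<pi> h" by blast
  have hA: "h \<in> Arr C" using ideal_memD(1)[OF P h(1)] .
  let ?Y = "Src C h" and ?Z = "Trg C h"
  have YZ: "?Y \<in> Obj C" "?Z \<in> Obj C" using hA by auto
  obtain A a a' where A: "A \<in> Obj C" "a \<in> Hom C ?Y (sh A)" "a' \<in> Hom C (sh A) ?Y"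
    "arr_diff (a' \<cdot> a) (Ide C ?Y) \<in> null_arr" "arr_diff (a \<cdot> a') (Ide C (sh A)) \<in> null_arr"
    using shift_essentially_surjective[OF YZ(1)] .
  obtain B b b' where B: "B \<in> Obj C" "b \<in> Hom C ?Z (sh B)" "b' \<in> Hom C (sh B) ?Z"
    "arr_diff (b' \<cdot> b) (Ide C ?Z) \<in> null_arr" "arr_diff (b \<cdot> b') (Ide C (sh B)) \<in> null_arr"
    using shift_essentially_surjective[OF YZ(2)] .
  \<comment> \<open>The conjugate of \<open>h\<close> by the stable isomorphisms, now an arrow
    between suspensions.\<close>
  define s where "s = b \<cdot> (h \<cdot> a')"
  have "h \<cdot> a' \<in> shifted_perp I"
    by (rule ideal_memD(3)[OF P h(1)]) (use A in \<open>auto simp: Hom_iff\<close>)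
  then have sP: "s \<in> shifted_perp I" unfolding s_def
    by (rule ideal_memD(2)[OF P]) (use A B hA in \<open>auto simp: Hom_iff\<close>)
  have hH: "h \<in> Hom C ?Y ?Z" using hA by (simp add: Hom_iff)
  have bh: "b \<cdot> h \<in> Hom C ?Y (sh B)" using Cmp_Hom[OF hH B(2)] .
  have sH: "s \<in> Hom C (sh A) (sh B)" unfolding s_def using Cmp_Hom[OF Cmp_Hom[OF A(3) hH] B(2)] .
  obtain g where g: "shift_of g s" "g \<in> Hom C A B" using shift_of_full[OF A(1) B(1) sH] .
  have gJ: "g \<in> ext_right_perp C E I" using shift_of_mem_shifted_perp[OF I g(1)] sP by blast
  have aa: "\<pi> (a' \<cdot> a) = \<pi> (Ide C ?Y)"
    using stable_eq_iff[OF Cmp_Hom[OF A(2,3)] Ide_Hom[OF YZ(1)]] A(4) by blast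
  have "\<pi> s \<cdot>\<^bsub>\<D>\<^esub> \<pi> a = \<pi> ((b \<cdot> h) \<cdot> (a' \<cdot> a))"
    using stable_Cmp[OF A(2) sH] A B hA unfolding s_def by (simp add: Hom_iff)
  also have "\<dots> = \<pi> (b \<cdot> h) \<cdot>\<^bsub>\<D>\<^esub> \<pi> (Ide C ?Y)"
    using stable_Cmp[OF Cmp_Hom[OF A(2,3)] bh] aa by simp
  also have "\<dots> = \<pi> b \<cdot>\<^bsub>\<D>\<^esub> \<pi> h"
    using stable_Cmp[OF Ide_Hom[OF YZ(1)] bh] Cmp_Ide[OF bh] stable_Cmp[OF hH B(2)] by simp
  finally have eq: "\<pi> b \<cdot>\<^bsub>\<D>\<^esub> \<pi> h = \<pi> s \<cdot>\<^bsub>\<D>\<^esub> \<pi> a" by simp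
  have "iso_arrows \<D> H (\<pi> s)"
  proof -
    have "H \<in> Arr \<D>" "\<pi> s \<in> Arr \<D>" using h hA sH by (auto simp: stable_Arr Hom_iff)
    moreover have "is_iso \<D> (\<pi> a)" "is_iso \<D> (\<pi> b)"
      using stable_isoI[OF A(2-5)] stable_isoI[OF B(2-5)] .
    moreover have "\<pi> b \<cdot>\<^bsub>\<D>\<^esub> H = \<pi> s \<cdot>\<^bsub>\<D>\<^esub> \<pi> a" using eq h by simp
    moreover have "\<pi> a \<in> Hom \<D> (Src \<D> H) (Src \<D> (\<pi> s))" "\<pi> b \<in> Hom \<D> (Trg \<D> H) (Trg \<D> (\<pi> s))"
      using stable_HomI[OF A(2)] stable_HomI[OF B(2)] h hA sH by (auto simp: Hom_iff)
    ultimately show ?thesis unfolding iso_arrows_def by blast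
  qed
  then have "iso_arrows \<D> H (shift_arr C E S (\<pi> g))" using shift_arr_stable[OF g(1)] by simp
  then show "H \<in> stable_shift_image C E S (ext_right_perp C E I)"
    unfolding stable_shift_image_def using gJ by blast
qed

text \<open>A null \<open>f\<close> makes every composite s x f null, so it is orthogonal to all
  arrows.\<close>

lemma null_subset_left_perp: "J \<subseteq> Arr C \<Longrightarrow> null_arr \<subseteq> ext_left_perp C E J"
proof
  fix f assume J: "J \<subseteq> Arr C" and f: "f \<in> null_arr"
  have fA: "f \<in> Arr C" using null_Arr[OF f] .
  have "ext_orthogonal C E f j" if j: "j \<in> J" for j
  proof -
    obtain s where s: "shift_of j s" using shift_of_ex J j by blast
    have "s \<cdot> (x \<cdot> f) \<in> null_arr" if x: "x \<in> Hom C (Trg C f) (sh (Src C j))" for x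
    proof -
      have "x \<cdot> f \<in> null_arr" by (rule null_Cmp[OF f]) (use x in \<open>auto simp: Hom_iff\<close>)
      then show ?thesis
        by (rule null_Cmp) (use x fA shift_of_Hom[OF s] in \<open>auto simp: Hom_iff\<close>)
    qed
    then show ?thesis using ext_orthogonal_iff_null[OF fA s] by blast
  qed
  then show "f \<in> ext_left_perp C E J" unfolding ext_left_perp_def using fA by blast
qed

lemma stable_zero_comp_iff:
  assumes "f \<in> Arr C" "s \<in> Arr C"
  shows "(\<forall>X \<in> Hom \<D> (Trg \<D> (\<pi> f)) (Src \<D> (\<pi> s)).
      \<pi> s \<cdot>\<^bsub>\<D>\<^esub> X \<cdot>\<^bsub>\<D>\<^esub> \<pi> f = Zer \<D> (Src \<D> (\<pi> f)) (Trg \<D> (\<pi> s))) \<longleftrightarrow>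
    (\<forall>x \<in> Hom C (Trg C f) (Src C s). s \<cdot> (x \<cdot> f) \<in> null_arr)"
proof -
  have fH: "f \<in> Hom C (Src C f) (Trg C f)" and sH: "s \<in> Hom C (Src C s) (Trg C s)"
    using assms by (auto simp: Hom_iff)
  have *: "\<pi> s \<cdot>\<^bsub>\<D>\<^esub> \<pi> x \<cdot>\<^bsub>\<D>\<^esub> \<pi> f = Zer \<D> (Src C f) (Trg C s) \<longleftrightarrow> s \<cdot> (x \<cdot> f) \<in> null_arr"
    if x: "x \<in> Hom C (Trg C f) (Src C s)" for x
  proof -
    have "\<pi> s \<cdot>\<^bsub>\<D>\<^esub> \<pi> x \<cdot>\<^bsub>\<D>\<^esub> \<pi> f = \<pi> ((s \<cdot> x) \<cdot> f)"
      using stable_Cmp[OF x sH] stable_Cmp[OF fH Cmp_Hom[OF x sH]] by simp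
    also have "(s \<cdot> x) \<cdot> f = s \<cdot> (x \<cdot> f)" using Cmp_assoc[OF fH x sH] .
    finally show ?thesis
      using stable_Zer[of "Src C f" "Trg C s"] assms
        stable_eq_Zer_iff[OF Cmp_Hom[OF Cmp_Hom[OF fH x] sH]] by simp
  qed
  show ?thesis
  proof (intro iffI ballI)
    fix x assume "\<forall>X \<in> Hom \<D> (Trg \<D> (\<pi> f)) (Src \<D> (\<pi> s)).
        \<pi> s \<cdot>\<^bsub>\<D>\<^esub> X \<cdot>\<^bsub>\<D>\<^esub> \<pi> f = Zer \<D> (Src \<D> (\<pi> f)) (Trg \<D> (\<pi> s))"
      and x: "x \<in> Hom C (Trg C f) (Src C s)"
    then show "s \<cdot> (x \<cdot> f) \<in> null_arr" using *[OF x] stable_HomI[OF x] assms by simp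
  next
    fix X assume null: "\<forall>x \<in> Hom C (Trg C f) (Src C s). s \<cdot> (x \<cdot> f) \<in> null_arr"
      and "X \<in> Hom \<D> (Trg \<D> (\<pi> f)) (Src \<D> (\<pi> s))"
    then obtain x where x: "x \<in> Hom C (Trg C f) (Src C s)" "X = \<pi> x"
      using assms by (auto elim!: stable_HomE)
    show "\<pi> s \<cdot>\<^bsub>\<D>\<^esub> X \<cdot>\<^bsub>\<D>\<^esub> \<pi> f = Zer \<D> (Src \<D> (\<pi> f)) (Trg \<D> (\<pi> s))"
      using *[OF x(1)] null x assms by simp
  qed
qed

text \<open>The right perp is \<open>shifted_perp I\<close> by construction. For the left perp,
  every \<open>j\<close> in \<open>J\<close> has a suspension in \<open>shifted_perp I\<close>, so
  stable orthogonality to that ideal implies Ext-orthogonality to all of \<open>J\<close>.\<close>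

lemma torsion_pair_of_cotorsion_pair:
  assumes IJ: "ideal_cotorsion_pair C E I J"
  shows "ideal_torsion_pair \<D> (\<pi> ` I) (stable_shift_image C E S J)"
proof -
  have I: "cat_ideal C I" and J: "J = ext_right_perp C E I" "I = ext_left_perp C E J"
    using IJ unfolding ideal_cotorsion_pair_def by blast+
  note P = shifted_perp_ideal[OF I]
  have IA: "f \<in> Arr C" if "f \<in> I" for f using ideal_memD(1)[OF I that] .
  have PA: "s \<in> Arr C" if "s \<in> shifted_perp I" for s using ideal_memD(1)[OF P that] .
  have img: "stable_shift_image C E S J = \<pi> ` shifted_perp I"
    unfolding J(1) by (rule stable_shift_image_perp[OF I])
  have right: "\<pi> s \<in> right_perp \<D> (\<pi> ` I) \<longleftrightarrow> s \<in> shifted_perp I" if s: "s \<in> Arr C" for s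
    unfolding right_perp_def shifted_perp_def using s stable_zero_comp_iff[OF IA s]
    by (auto simp: stable_Arr)
  have left: "\<pi> f \<in> left_perp \<D> (\<pi> ` shifted_perp I) \<longleftrightarrow> f \<in> I" if f: "f \<in> Arr C" for f
  proof
    assume "f \<in> I"
    then show "\<pi> f \<in> left_perp \<D> (\<pi> ` shifted_perp I)"
      unfolding left_perp_def using f stable_zero_comp_iff[OF f PA]
      by (auto simp: stable_Arr shifted_perp_def)
  next
    assume "\<pi> f \<in> left_perp \<D> (\<pi> ` shifted_perp I)"
    then have null: "s \<cdot> (x \<cdot> f) \<in> null_arr"
      if "s \<in> shifted_perp I" "x \<in> Hom C (Trg C f) (Src C s)" for s x
      using that stable_zero_comp_iff[OF f PA[OF that(1)]] unfolding left_perp_def by blast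
    have "ext_orthogonal C E f j" if j: "j \<in> J" for j
    proof -
      have "j \<in> Arr C" using j J(1) unfolding ext_right_perp_def by blast
      then obtain s where s: "shift_of j s" using shift_of_ex by blast
      have "s \<in> shifted_perp I" using shift_of_mem_shifted_perp[OF I s] j J(1) by blast
      then show ?thesis
        using ext_orthogonal_iff_null[OF f s] null shift_of_Hom(2)[OF s] by (auto simp: Hom_iff)
    qed
    then show "f \<in> I" using f J(2) unfolding ext_left_perp_def by blast
  qed
  have "\<pi> ` shifted_perp I = right_perp \<D> (\<pi> ` I)"
  proof (intro equalityI subsetI)
    fix H assume H: "H \<in> right_perp \<D> (\<pi> ` I)"
    then obtain s where "s \<in> Arr C" "H = \<pi> s" unfolding right_perp_def by (auto simp: stable_Arr)
    then show "H \<in> \<pi> ` shifted_perp I" using right[of s] H by blast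
  qed (use right PA in auto)
  moreover have "\<pi> ` I = left_perp \<D> (\<pi> ` shifted_perp I)"
  proof (intro equalityI subsetI)
    fix F assume F: "F \<in> left_perp \<D> (\<pi> ` shifted_perp I)"
    then obtain f where "f \<in> Arr C" "F = \<pi> f" unfolding left_perp_def by (auto simp: stable_Arr)
    then show "F \<in> \<pi> ` I" using left[of f] F by blast
  qed (use left IA in auto)
  ultimately show ?thesis
    unfolding ideal_torsion_pair_def img using stable_ideal[OF I] stable_ideal[OF P] by blast
qed

lemma stable_precovers_iff:
  assumes I: "cat_ideal C I" and null: "null_arr \<subseteq> I"
  shows "(\<exists>F. hom_special_precover \<D> (weak_conflations C E S) (\<pi> ` I) X F) \<longleftrightarrow>
    (\<exists>i. stable_precover I X i)"
proof
  assume "\<exists>F. hom_special_precover \<D> (weak_conflations C E S) (\<pi> ` I) X F"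
  then obtain i where "i \<in> I" "precover \<D> (\<pi> ` I) X (\<pi> i)"
    unfolding hom_special_precover_def by (auto simp: precover_def)
  then show "\<exists>i. stable_precover I X i" using precover_stable_iff[OF I null] by blast
next
  assume "\<exists>i. stable_precover I X i"
  then obtain i where i: "stable_precover I X i" by blast
  then have iI: "i \<in> I" unfolding stable_precover_def by blast
  then have "\<pi> i \<in> Arr \<D>" using ideal_memD(1)[OF I] by (auto simp: stable_Arr)
  then show "\<exists>F. hom_special_precover \<D> (weak_conflations C E S) (\<pi> ` I) X F"
    unfolding hom_special_precover_def
    using weak_conflation_ex precover_stable_iff[OF I null iI] i by blast
qed

lemma special_preenvelope_of_stable:
  assumes IJ: "ideal_cotorsion_pair C E I J" and X: "X \<in> Obj C" and i: "stable_precover I (sh X) i"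
  shows "\<exists>j. ext_special_preenvelope C E J X j"
proof -
  have I: "cat_ideal C I" and J: "J = ext_right_perp C E I" "I = ext_left_perp C E J"
    using IJ unfolding ideal_cotorsion_pair_def by blast+
  note SX = shift_conflation[OF X]
  have i': "i \<in> I" "Trg C i = sh X" using i unfolding stable_precover_def by auto
  have "i \<in> Hom C (Src C i) (sh X)" using i' ideal_memD(1)[OF I i'(1)] by (simp add: Hom_iff)
  from conflation_pullback[OF SX(1) this] obtain j q b
    where jq: "(j, q) \<in> E" and pb: "pullback_square C (defl X) i b q" "b \<cdot> j = infl X"
      "Src C j = Src C (infl X)"
      and m: "seq_morphism C (j, q) (infl X, defl X) (Ide C (Src C (infl X))) b i" .
  \<comment> \<open>The chosen conflation at \<open>X\<close> also has a projective middle object,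
    so it serves as a syzygy conflation of \<open>sh X\<close>.\<close>
  have "j \<in> J"
    unfolding J(1) using stable_precover_pullback_perp[OF I i SX(1) _ _ jq pb] SX(4) X by simp
  moreover have "cosyzygy_conflation C E X (S X)"
    using SX by (simp add: cosyzygy_conflation_def)
  \<comment> \<open>The third component of the pullback diagram is \<open>i\<close>, a member of the
    left perp of \<open>J\<close>, as a special preenvelope demands.\<close>
  moreover have "seq_morphism C (j, q) (S X) (Ide C X) b i" using m X by simp
  moreover have "Src C j = X" using pb X by simp
  ultimately show ?thesis
    unfolding ext_special_preenvelope_def using jq i'(1) J(2) by blast
qed

end

theorem theorem54:
  fixes C :: "('o, 'm) addcat"
    and E :: "('m \<times> 'm) set"
    and S :: "'o \<Rightarrow> 'm \<times> 'm"
    and I J :: "'m set"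
  assumes "frobenius_category C E"
    and "cosyzygy_choice C E S"
    and "ideal_cotorsion_pair C E I J"
  shows "complete_ideal_cotorsion_pair C E I J \<longleftrightarrow>
    complete_ideal_torsion_pair (stable_category C E) (weak_conflations C E S)
      (stable_map C E ` I) (stable_shift_image C E S J)"
proof -
  interpret frobenius_shift C E S
    using assms(1,2) by (simp add: frobenius_shift_def frobenius_shift_axioms_def)
  have I: "cat_ideal C I" and IJ: "I = ext_left_perp C E J" "J \<subseteq> Arr C"
    using assms(3) unfolding ideal_cotorsion_pair_def cat_ideal_def by blast+
  have null: "null_arr \<subseteq> I" using null_subset_left_perp[OF IJ(2)] IJ(1) by simp
  \<comment> \<open>Forwards, a special precover is itself a stable precover. Backwards, a stable
    precover of \<open>X\<close> yields the special precover of \<open>X\<close>, and one of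
    \<open>sh X\<close> the special preenvelope of \<open>X\<close>.\<close>
  have "(\<forall>X \<in> Obj C. (\<exists>i. ext_special_precover C E I X i) \<and> (\<exists>j. ext_special_preenvelope C E J X j)) \<longleftrightarrow>
      (\<forall>X \<in> Obj C. \<exists>i. stable_precover I X i)"
    using special_precover_stable[OF I null] special_precover_of_stable[OF I null]
      special_preenvelope_of_stable[OF assms(3)] shift_simps(5) by meson
  then show ?thesis
    unfolding complete_ideal_cotorsion_pair_def complete_ideal_torsion_pair_def
    using assms(3) torsion_pair_of_cotorsion_pair[OF assms(3)] stable_precovers_iff[OF I null]
    by simp
qed

end
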